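(* Let $QSymm$ be the ring of quasisymmetric functions over $\mathbf{Z}$ in the variables $x_1,x_2,\dots$, equipped with the operations $\lambda_n$ ($n\ge 0$) defined in the context, and write $e_n(\alpha)=\lambda_n(\alpha)$. Then the elements $e_n(\alpha)$, where $\alpha$ runs over all elementary Lyndon compositions and $n$ runs over $\mathbf{N}=\{1,2,3,\dots\}$, form a free set of polynomial generators of $QSymm$ over $\mathbf{Z}$; that is, $QSymm=\mathbf{Z}[\,e_n(\alpha): \alpha \text{ elementary Lyndon},\ n\in\mathbf{N}\,]$ and these elements are algebraically independent over $\mathbf{Z}$.
   Context: A composition is a finite sequence $\alpha=[a_1,\dots,a_m]$ of positive integers; the empty composition is allowed. The monomial quasisymmetric function of $\alpha$, also denoted $\alpha$, is $\sum_{i_1<i_2<\cdots<i_m} x_{i_1}^{a_1}x_{i_2}^{a_2}\cdots x_{i_m}^{a_m}$ (a formal power series of bounded degree in $x_1,x_2,\dots$ with integer coefficients), the empty composition giving $1$. $QSymm$ is the ring (under ordinary multiplication of power series) whose underlying abelian group is free with basis the monomial quasisymmetric functions. For $k\ge1$ let $\psi_k$ be the ring endomorphism $x_j\mapsto x_j^k$ (for all $j$) of the ring of bounded-degree power series; it maps $QSymm$ into itself, with $\psi_k([a_1,\dots,a_m])=[ka_1,\dots,ka_m]$. Define $\lambda_n$ on $QSymm$ by $\sum_{n\ge0}\lambda_n(f)t^n=\exp\big(\sum_{k\ge1}\frac{(-1)^{k-1}}{k}\psi_k(f)t^k\big)$; this is the $\lambda$-ring structure for which every variable $x_j$ satisfies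 $\lambda_1(x_j)=x_j$, $\lambda_i(x_j)=0$ for $i\ge2$, and $\lambda_n$ maps $QSymm$ into $QSymm$. Compositions are compared lexicographically as words over the ordered alphabet $\{1,2,3,\dots\}$ (a proper prefix is smaller). A nonempty composition $\alpha$ is a Lyndon composition (Lyndon word) if it is lexicographically strictly smaller than each of its proper nonempty suffixes. A Lyndon composition $[a_1,\dots,a_m]$ is elementary if $\gcd(a_1,\dots,a_m)=1$. *)

theory Defs
  imports
    Complex_Main
    "HOL-Library.Poly_Mapping"
    "HOL-Library.Sublist"
    "HOL-Computational_Algebra.Formal_Power_Series"
begin

section \<open>Power series of bounded degree in countably many variables\<close>

text \<open>A monomial is its finitely supported exponent function; the variables
  \<open>x\<^sub>1, x\<^sub>2, \<dots>\<close> are indexed by \<open>0, 1, \<dots>\<close>.\<close>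

type_synonym monom = "nat \<Rightarrow>\<^sub>0 nat"

definition mdeg :: "monom \<Rightarrow> nat" where
  "mdeg \<mu> = (\<Sum>i\<in>Poly_Mapping.keys \<mu>. Poly_Mapping.lookup \<mu> i)"

lemma mdeg_zero [simp]: "mdeg 0 = 0"
  by (simp add: mdeg_def)

lemma mdeg_superset:
  assumes "finite A" "Poly_Mapping.keys \<mu> \<subseteq> A"
  shows "mdeg \<mu> = (\<Sum>i\<in>A. Poly_Mapping.lookup \<mu> i)"
  unfolding mdeg_def using assms
  by (intro sum.mono_neutral_left) (auto simp: in_keys_iff)

lemma mdeg_add: "mdeg (\<mu> + \<nu>) = mdeg \<mu> + mdeg \<nu>"
proof -
  let ?A = "Poly_Mapping.keys \<mu> \<union> Poly_Mapping.keys \<nu>"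
  have "Poly_Mapping.keys (\<mu> + \<nu>) \<subseteq> ?A"
    by (rule Poly_Mapping.keys_add)
  then show ?thesis
    by (simp add: mdeg_superset[of ?A] lookup_add sum.distrib)
qed

definition splits :: "monom \<Rightarrow> (monom \<times> monom) set" where
  "splits \<mu> = {(a, b). a + b = \<mu>}"

lemma finite_splits [simp]: "finite (splits \<mu>)"
proof -
  let ?K = "Poly_Mapping.keys \<mu>"
  let ?g = "\<lambda>p. (restrict (Poly_Mapping.lookup (fst p)) ?K, restrict (Poly_Mapping.lookup (snd p)) ?K)"
  let ?P = "PiE ?K (\<lambda>i. {..Poly_Mapping.lookup \<mu> i})"
  have "finite (?P \<times> ?P)"
    by (intro finite_cartesian_product finite_PiE) auto
  moreover have "?g ` splits \<mu> \<subseteq> ?P \<times> ?P"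
    by (auto simp: splits_def lookup_add)
  moreover have "inj_on ?g (splits \<mu>)"
  proof (rule inj_onI)
    fix p q assume p: "p \<in> splits \<mu>" and q: "q \<in> splits \<mu>" and eq: "?g p = ?g q"
    have "Poly_Mapping.lookup (fst p) i = Poly_Mapping.lookup (fst q) i \<and>
          Poly_Mapping.lookup (snd p) i = Poly_Mapping.lookup (snd q) i" for i
    proof (cases "i \<in> ?K")
      case True
      then show ?thesis using eq by (auto dest!: fun_cong[of _ _ i])
    next
      case False
      then have "Poly_Mapping.lookup \<mu> i = 0" by (simp add: in_keys_iff)
      moreover have "fst p + snd p = \<mu>" "fst q + snd q = \<mu>"
        using p q by (auto simp: splits_def)
      ultimately show ?thesis by (metis lookup_add add_is_0)
    qed
    then show "p = q" by (intro prod_eqI poly_mapping_eqI) auto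
  qed
  ultimately show ?thesis by (meson finite_imageD finite_subset)
qed

typedef (overloaded) 'a bdps =
  "{f :: monom \<Rightarrow> 'a::zero. \<exists>d. \<forall>\<mu>. f \<mu> \<noteq> 0 \<longrightarrow> mdeg \<mu> \<le> d}"
  morphisms coeff_bdps Abs_bdps
  by (rule exI[of _ "\<lambda>_. 0"]) auto

setup_lifting type_definition_bdps

lemma bdps_eqI: "(\<And>\<mu>. coeff_bdps f \<mu> = coeff_bdps g \<mu>) \<Longrightarrow> f = g"
  by (simp add: coeff_bdps_inject[symmetric] fun_eq_iff)

lift_definition const_bdps :: "'a::zero \<Rightarrow> 'a bdps" is
  "\<lambda>c \<mu>. if \<mu> = 0 then c else 0"
  by (rule exI[of _ 0]) auto

lift_definition var_bdps :: "nat \<Rightarrow> 'a::zero_neq_one bdps" is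
  "\<lambda>j \<mu>. if \<mu> = Poly_Mapping.single j 1 then 1 else 0"
  by (metis order_refl)

instantiation bdps :: (comm_ring_1) comm_ring_1
begin

lift_definition zero_bdps :: "'a bdps" is "\<lambda>_. 0"
  by simp

lift_definition one_bdps :: "'a bdps" is "\<lambda>\<mu>. if \<mu> = 0 then 1 else 0"
  by (rule exI[of _ 0]) auto

lift_definition plus_bdps :: "'a bdps \<Rightarrow> 'a bdps \<Rightarrow> 'a bdps" is "\<lambda>f g \<mu>. f \<mu> + g \<mu>"
proof -
  fix f g :: "monom \<Rightarrow> 'a"
  assume "\<exists>d. \<forall>\<mu>. f \<mu> \<noteq> 0 \<longrightarrow> mdeg \<mu> \<le> d" "\<exists>d. \<forall>\<mu>. g \<mu> \<noteq> 0 \<longrightarrow> mdeg \<mu> \<le> d"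
  then obtain d e where "\<And>\<mu>. f \<mu> \<noteq> 0 \<Longrightarrow> mdeg \<mu> \<le> d" "\<And>\<mu>. g \<mu> \<noteq> 0 \<Longrightarrow> mdeg \<mu> \<le> e"
    by blast
  then have "\<forall>\<mu>. f \<mu> + g \<mu> \<noteq> 0 \<longrightarrow> mdeg \<mu> \<le> max d e"
    by (metis add_0 max.coboundedI1 max.coboundedI2)
  then show "\<exists>d. \<forall>\<mu>. f \<mu> + g \<mu> \<noteq> 0 \<longrightarrow> mdeg \<mu> \<le> d" ..
qed

lift_definition uminus_bdps :: "'a bdps \<Rightarrow> 'a bdps" is "\<lambda>f \<mu>. - f \<mu>"
  by simp

definition minus_bdps :: "'a bdps \<Rightarrow> 'a bdps \<Rightarrow> 'a bdps" where
  "minus_bdps f g = f + - g"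

lift_definition times_bdps :: "'a bdps \<Rightarrow> 'a bdps \<Rightarrow> 'a bdps" is
  "\<lambda>f g \<mu>. \<Sum>(a, b)\<in>splits \<mu>. f a * g b"
proof -
  fix f g :: "monom \<Rightarrow> 'a"
  assume "\<exists>d. \<forall>\<mu>. f \<mu> \<noteq> 0 \<longrightarrow> mdeg \<mu> \<le> d" "\<exists>d. \<forall>\<mu>. g \<mu> \<noteq> 0 \<longrightarrow> mdeg \<mu> \<le> d"
  then obtain d e where de: "\<And>\<mu>. f \<mu> \<noteq> 0 \<Longrightarrow> mdeg \<mu> \<le> d" "\<And>\<mu>. g \<mu> \<noteq> 0 \<Longrightarrow> mdeg \<mu> \<le> e"
    by blast
  have "mdeg \<mu> \<le> d + e" if nz: "(\<Sum>(a, b)\<in>splits \<mu>. f a * g b) \<noteq> 0" for \<mu>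
  proof -
    obtain p where "p \<in> splits \<mu>" "(case p of (a, b) \<Rightarrow> f a * g b) \<noteq> 0"
      using nz by (meson sum.not_neutral_contains_not_neutral)
    then obtain a b where ab: "a + b = \<mu>" "f a * g b \<noteq> 0"
      by (auto simp: splits_def)
    then have "f a \<noteq> 0" "g b \<noteq> 0" by auto
    then have "mdeg a + mdeg b \<le> d + e" using de by (intro add_mono) auto
    then show ?thesis using ab by (simp add: mdeg_add[symmetric])
  qed
  then show "\<exists>d. \<forall>\<mu>. (\<Sum>(a, b)\<in>splits \<mu>. f a * g b) \<noteq> 0 \<longrightarrow> mdeg \<mu> \<le> d" by blast
qed

instance
proof
  fix f g h :: "'a bdps"
  show "f + g + h = f + (g + h)" by transfer (simp add: add.assoc)
  show "f + g = g + f" by transfer (simp add: add.commute)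
  show "0 + f = f" by transfer simp
  show "- f + f = 0" by transfer simp
  show "f - g = f + - g" by (simp add: minus_bdps_def)
  show "(0::'a bdps) \<noteq> 1" by transfer (metis zero_neq_one)
  show "f * g = g * f"
  proof (transfer, rule ext)
    fix f g :: "monom \<Rightarrow> 'a" and \<mu>
    show "(\<Sum>(a, b)\<in>splits \<mu>. f a * g b) = (\<Sum>(a, b)\<in>splits \<mu>. g a * f b)"
      by (rule sum.reindex_bij_witness[of _ prod.swap prod.swap])
        (auto simp: splits_def ac_simps)
  qed
  show "(f + g) * h = f * h + g * h"
    by transfer (simp add: distrib_right sum.distrib split_def)
  show "1 * f = f"
  proof (transfer, rule ext)
    fix f :: "monom \<Rightarrow> 'a" and \<mu>
    have "(\<Sum>(a, b)\<in>splits \<mu>. (if a = 0 then 1 else 0) * f b)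
        = (\<Sum>(a, b)\<in>{(0 :: monom, \<mu>)}. (if a = 0 then 1 else 0) * f b)"
    proof (rule sum.mono_neutral_right)
      show "{(0 :: monom, \<mu>)} \<subseteq> splits \<mu>"
        by (simp add: splits_def)
      show "\<forall>p\<in>splits \<mu> - {(0, \<mu>)}. (case p of (a, b) \<Rightarrow> (if a = 0 then 1 else 0) * f b) = 0"
        by (auto simp: splits_def split: if_splits)
    qed simp
    then show "(\<Sum>(a, b)\<in>splits \<mu>. (if a = 0 then 1 else 0) * f b) = f \<mu>" by simp
  qed
  show "f * g * h = f * (g * h)"
  proof (transfer, rule ext)
    fix f g h :: "monom \<Rightarrow> 'a" and \<mu>
    have "(\<Sum>(s, c)\<in>splits \<mu>. (\<Sum>(a, b)\<in>splits s. f a * g b) * h c)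
        = (\<Sum>(p, q)\<in>Sigma (splits \<mu>) (\<lambda>p. splits (fst p)). f (fst q) * g (snd q) * h (snd p))"
      by (subst sum.Sigma[symmetric]) (auto simp: sum_distrib_right split_def)
    also have "\<dots> = (\<Sum>(p, q)\<in>Sigma (splits \<mu>) (\<lambda>p. splits (snd p)). f (fst p) * (g (fst q) * h (snd q)))"
      by (rule sum.reindex_bij_witness[of _
            "\<lambda>((a, t), (b, c)). ((a + b, c), (a, b))"
            "\<lambda>((s, c), (a, b)). ((a, b + c), (b, c))"])
        (auto simp: splits_def ac_simps)
    also have "\<dots> = (\<Sum>(a, t)\<in>splits \<mu>. f a * (\<Sum>(b, c)\<in>splits t. g b * h c))"
      by (subst sum.Sigma[symmetric]) (auto simp: sum_distrib_left split_def)
    finally show "(\<Sum>(s, c)\<in>splits \<mu>. (\<Sum>(a, b)\<in>splits s. f a * g b) * h c)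
        = (\<Sum>(a, t)\<in>splits \<mu>. f a * (\<Sum>(b, c)\<in>splits t. g b * h c))" .
  qed
qed

end

section \<open>Quasisymmetric functions\<close>

definition is_composition :: "nat list \<Rightarrow> bool" where
  "is_composition \<alpha> \<longleftrightarrow> (\<forall>a\<in>set \<alpha>. 0 < a)"

text \<open>The coefficient of \<open>\<mu>\<close> in the monomial quasisymmetric function of \<open>\<alpha>\<close> counts the
  index sequences \<open>i\<^sub>1 < \<dots> < i\<^sub>m\<close> whose term in the defining sum is \<open>\<mu>\<close>.\<close>

definition word_monom :: "nat list \<Rightarrow> nat list \<Rightarrow> monom" where
  "word_monom is \<alpha> = (\<Sum>j<length \<alpha>. Poly_Mapping.single (is ! j) (\<alpha> ! j))"

lemma mdeg_single [simp]: "mdeg (Poly_Mapping.single i a) = a"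
  by (simp add: mdeg_def)

lemma mdeg_sum: "mdeg (\<Sum>j\<in>A. F j) = (\<Sum>j\<in>A. mdeg (F j))"
  by (induction A rule: infinite_finite_induct) (auto simp: mdeg_add)

lemma mdeg_word_monom: "mdeg (word_monom is \<alpha>) = (\<Sum>j<length \<alpha>. \<alpha> ! j)"
  by (simp add: word_monom_def mdeg_sum)

lift_definition monomial_qsym :: "nat list \<Rightarrow> 'a::comm_ring_1 bdps" is
  "\<lambda>\<alpha> \<mu>. of_nat (card {is. length is = length \<alpha> \<and> sorted_wrt (<) is \<and> word_monom is \<alpha> = \<mu>})"
proof -
  fix \<alpha> :: "nat list"
  have "mdeg \<mu> \<le> (\<Sum>j<length \<alpha>. \<alpha> ! j)"
    if "(of_nat (card {is. length is = length \<alpha> \<and> sorted_wrt (<) is \<and> word_monom is \<alpha> = \<mu>}) :: 'a) \<noteq> 0"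
    for \<mu>
  proof -
    have "{is. length is = length \<alpha> \<and> sorted_wrt (<) is \<and> word_monom is \<alpha> = \<mu>} \<noteq> {}"
      using that by fastforce
    then show ?thesis using mdeg_word_monom by fastforce
  qed
  then show "\<exists>d. \<forall>\<mu>. (of_nat (card {is. length is = length \<alpha> \<and> sorted_wrt (<) is
      \<and> word_monom is \<alpha> = \<mu>}) :: 'a) \<noteq> 0 \<longrightarrow> mdeg \<mu> \<le> d" by blast
qed

text \<open>Integral quasisymmetric functions are regarded as series with rational coefficients,
  because the exponential defining the operations below needs denominators.
  The definition is the \<open>\<int>\<close>-span of the monomial quasisymmetric functions.\<close>

definition QSymm :: "rat bdps set" where
  "QSymm = {f. \<exists>A c. finite A \<and> (\<forall>\<alpha>\<in>A. is_composition \<alpha>) \<and>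
                 f = (\<Sum>\<alpha>\<in>A. of_int (c \<alpha>) * monomial_qsym \<alpha>)}"

section \<open>The operations\<close>

definition pow_monom :: "nat \<Rightarrow> monom \<Rightarrow> monom" where
  "pow_monom k \<mu> = Poly_Mapping.map ((*) k) \<mu>"

lemma lookup_pow_monom: "Poly_Mapping.lookup (pow_monom k \<mu>) i = k * Poly_Mapping.lookup \<mu> i"
  by (simp add: pow_monom_def Poly_Mapping.map.rep_eq when_def)

lemma pow_monom_add: "pow_monom k (\<mu> + \<nu>) = pow_monom k \<mu> + pow_monom k \<nu>"
  by (rule poly_mapping_eqI) (simp add: lookup_pow_monom lookup_add distrib_left)

lemma pow_monom_zero [simp]: "pow_monom k 0 = 0"
  by (rule poly_mapping_eqI) (simp add: lookup_pow_monom)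

lemma pow_monom_sum: "pow_monom k (\<Sum>j\<in>A. F j) = (\<Sum>j\<in>A. pow_monom k (F j))"
  by (induction A rule: infinite_finite_induct) (auto simp: pow_monom_add)

lemma pow_monom_single: "pow_monom k (Poly_Mapping.single i a) = Poly_Mapping.single i (k * a)"
  by (rule poly_mapping_eqI) (simp add: lookup_pow_monom lookup_single when_def)

lemma pow_monom_inject: "k \<ge> 1 \<Longrightarrow> pow_monom k \<mu> = pow_monom k \<nu> \<longleftrightarrow> \<mu> = \<nu>"
  by (metis lookup_pow_monom mult_left_cancel not_one_le_zero poly_mapping_eqI)

lemma mdeg_pow_monom: "mdeg (pow_monom k \<mu>) = k * mdeg \<mu>"
proof -
  have "Poly_Mapping.keys (pow_monom k \<mu>) \<subseteq> Poly_Mapping.keys \<mu>"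
    by (auto simp: in_keys_iff lookup_pow_monom)
  then show ?thesis
    by (simp add: mdeg_superset[of "Poly_Mapping.keys \<mu>"] lookup_pow_monom sum_distrib_left)
qed

text \<open>The substitution \<open>x\<^sub>j \<mapsto> x\<^sub>j\<^sup>k\<close>, for \<open>k \<ge> 1\<close>: each term \<open>c x\<^sup>\<mu>\<close> becomes \<open>c x\<^sup>k\<^sup>\<mu>\<close>.
  For \<open>k = 0\<close> the value is junk.\<close>

lift_definition psi :: "nat \<Rightarrow> 'a::comm_ring_1 bdps \<Rightarrow> 'a bdps" is
  "\<lambda>k f \<nu>. \<Sum>\<mu> | pow_monom k \<mu> = \<nu>. f \<mu>"
proof -
  fix k and f :: "monom \<Rightarrow> 'a"
  assume "\<exists>d. \<forall>\<mu>. f \<mu> \<noteq> 0 \<longrightarrow> mdeg \<mu> \<le> d"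
  then obtain d where d: "\<And>\<mu>. f \<mu> \<noteq> 0 \<Longrightarrow> mdeg \<mu> \<le> d" by blast
  have "mdeg \<nu> \<le> k * d" if nz: "(\<Sum>\<mu> | pow_monom k \<mu> = \<nu>. f \<mu>) \<noteq> 0" for \<nu>
  proof -
    obtain \<mu> where "pow_monom k \<mu> = \<nu>" "f \<mu> \<noteq> 0"
      using nz by (metis (mono_tags, lifting) mem_Collect_eq sum.not_neutral_contains_not_neutral)
    then show ?thesis using d[of \<mu>] by (auto simp: mdeg_pow_monom)
  qed
  then show "\<exists>d. \<forall>\<nu>. (\<Sum>\<mu> | pow_monom k \<mu> = \<nu>. f \<mu>) \<noteq> 0 \<longrightarrow> mdeg \<nu> \<le> d" by blast
qed

lemma coeff_psi_pow:
  assumes "k \<ge> 1"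
  shows "coeff_bdps (psi k f) (pow_monom k \<mu>) = coeff_bdps f \<mu>"
proof -
  have "{\<nu>. pow_monom k \<nu> = pow_monom k \<mu>} = {\<mu>}"
    using assms by (auto simp: pow_monom_inject)
  then show ?thesis by (simp add: psi.rep_eq)
qed

lemma coeff_psi_nonpow:
  assumes "\<And>\<mu>. \<nu> \<noteq> pow_monom k \<mu>"
  shows "coeff_bdps (psi k f) \<nu> = 0"
proof -
  have "{\<mu>. pow_monom k \<mu> = \<nu>} = {}" using assms by auto
  then show ?thesis unfolding psi.rep_eq by (simp only: sum.empty)
qed

lemma psi_add: "psi k (f + g) = psi k f + psi k g"
  by transfer (simp add: sum.distrib)

lemma psi_one:
  assumes "k \<ge> 1"
  shows "psi k 1 = 1"
proof (rule bdps_eqI)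
  fix \<nu>
  show "coeff_bdps (psi k 1 :: 'a bdps) \<nu> = coeff_bdps 1 \<nu>"
  proof (cases "\<exists>\<mu>. \<nu> = pow_monom k \<mu>")
    case True
    then obtain \<mu> where \<nu>: "\<nu> = pow_monom k \<mu>" by blast
    have "\<nu> = 0 \<longleftrightarrow> \<mu> = 0"
      using pow_monom_inject[OF assms, of \<mu> 0] by (simp add: \<nu>)
    then show ?thesis using coeff_psi_pow[OF assms, of "1 :: 'a bdps" \<mu>]
      by (simp add: \<nu> one_bdps.rep_eq)
  next
    case False
    then have "\<nu> \<noteq> 0" using pow_monom_zero by metis
    then show ?thesis using False by (simp add: coeff_psi_nonpow one_bdps.rep_eq)
  qed
qed

lemma psi_var:
  assumes "k \<ge> 1"
  shows "coeff_bdps (psi k (var_bdps j :: 'a::comm_ring_1 bdps)) \<nu>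
       = (if \<nu> = Poly_Mapping.single j k then 1 else 0)"
proof (cases "\<exists>\<mu>. \<nu> = pow_monom k \<mu>")
  case True
  then obtain \<mu> where \<nu>: "\<nu> = pow_monom k \<mu>" by blast
  have "\<nu> = Poly_Mapping.single j k \<longleftrightarrow> \<mu> = Poly_Mapping.single j 1"
    using pow_monom_inject[OF assms, of \<mu> "Poly_Mapping.single j 1"]
    by (simp add: \<nu> pow_monom_single)
  then show ?thesis by (simp add: \<nu> coeff_psi_pow[OF assms] var_bdps.rep_eq)
next
  case False
  moreover have "Poly_Mapping.single j k = pow_monom k (Poly_Mapping.single j 1)"
    by (simp add: pow_monom_single)
  ultimately have "\<nu> \<noteq> Poly_Mapping.single j k" by metis
  then show ?thesis using False by (simp add: coeff_psi_nonpow)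
qed

lemma pow_monom_split:
  assumes "k \<ge> 1" "a + b = pow_monom k \<mu>" "a = pow_monom k a'"
  shows "\<exists>b'. b = pow_monom k b' \<and> a' + b' = \<mu>"
proof -
  have le: "Poly_Mapping.lookup b i = k * (Poly_Mapping.lookup \<mu> i - Poly_Mapping.lookup a' i)
      \<and> Poly_Mapping.lookup a' i \<le> Poly_Mapping.lookup \<mu> i" for i
  proof -
    have "k * Poly_Mapping.lookup a' i + Poly_Mapping.lookup b i = k * Poly_Mapping.lookup \<mu> i"
      using assms(2,3) by (metis lookup_add lookup_pow_monom)
    moreover from this have "k * Poly_Mapping.lookup a' i \<le> k * Poly_Mapping.lookup \<mu> i"
      by linarith
    then have "Poly_Mapping.lookup a' i \<le> Poly_Mapping.lookup \<mu> i" using assms(1) by simp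
    ultimately show ?thesis by (simp add: diff_mult_distrib2)
  qed
  have "b = pow_monom k (\<mu> - a')" "a' + (\<mu> - a') = \<mu>"
    using le by (auto intro!: poly_mapping_eqI simp: lookup_pow_monom lookup_minus lookup_add)
  then show ?thesis by blast
qed

lemma psi_mult:
  assumes "k \<ge> 1"
  shows "psi k (f * g) = psi k f * psi k g"
proof (rule bdps_eqI)
  fix \<nu>
  let ?P = "\<lambda>(a, b). coeff_bdps (psi k f) a * coeff_bdps (psi k g) b"
  have rhs: "coeff_bdps (psi k f * psi k g) \<nu> = sum ?P (splits \<nu>)"
    by (simp add: times_bdps.rep_eq)
  show "coeff_bdps (psi k (f * g)) \<nu> = coeff_bdps (psi k f * psi k g) \<nu>"
  proof (cases "\<exists>\<mu>. \<nu> = pow_monom k \<mu>")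
    case True
    then obtain \<mu> where \<nu>: "\<nu> = pow_monom k \<mu>" by blast
    let ?h = "\<lambda>(a, b). (pow_monom k a, pow_monom k b)"
    have inj: "inj_on ?h (splits \<mu>)"
      using assms by (auto simp: inj_on_def pow_monom_inject)
    have "sum ?P (splits \<nu>) = sum ?P (?h ` splits \<mu>)"
    proof (rule sum.mono_neutral_right)
      show "?h ` splits \<mu> \<subseteq> splits \<nu>"
        by (auto simp: splits_def \<nu> pow_monom_add[symmetric])
      show "\<forall>p\<in>splits \<nu> - ?h ` splits \<mu>. ?P p = 0"
      proof
        fix p assume p: "p \<in> splits \<nu> - ?h ` splits \<mu>"
        obtain a b where ab: "p = (a, b)" by (cases p)
        have s: "a + b = pow_monom k \<mu>" using p by (simp add: ab splits_def \<nu>)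
        have "\<nexists>a'. a = pow_monom k a'"
        proof
          assume "\<exists>a'. a = pow_monom k a'"
          then obtain a' where a': "a = pow_monom k a'" by blast
          with pow_monom_split[OF assms s] obtain b' where "b = pow_monom k b'" "a' + b' = \<mu>"
            by blast
          then have "p = ?h (a', b')" "(a', b') \<in> splits \<mu>" by (auto simp: ab a' splits_def)
          then show False using p by blast
        qed
        then show "?P p = 0" by (simp add: ab coeff_psi_nonpow)
      qed
    qed auto
    also have "\<dots> = coeff_bdps (f * g) \<mu>"
      by (subst sum.reindex[OF inj])
        (simp add: times_bdps.rep_eq split_def coeff_psi_pow[OF assms])
    finally show ?thesis by (simp add: rhs) (simp add: \<nu> coeff_psi_pow[OF assms])
  next
    case False
    have "?P p = 0" if "p \<in> splits \<nu>" for p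
    proof -
      obtain a b where ab: "p = (a, b)" by (cases p)
      have "\<not> ((\<exists>a'. a = pow_monom k a') \<and> (\<exists>b'. b = pow_monom k b'))"
        using False that by (auto simp: ab splits_def pow_monom_add[symmetric])
      then show ?thesis by (auto simp: ab coeff_psi_nonpow)
    qed
    then show ?thesis using False by (simp add: rhs coeff_psi_nonpow)
  qed
qed

lemma psi_monomial_qsym:
  assumes "k \<ge> 1"
  shows "psi k (monomial_qsym \<alpha> :: 'a::comm_ring_1 bdps) = monomial_qsym (map ((*) k) \<alpha>)"
proof (rule bdps_eqI)
  fix \<nu>
  have wm: "word_monom is (map ((*) k) \<alpha>) = pow_monom k (word_monom is \<alpha>)" for "is"
    by (simp add: word_monom_def pow_monom_sum pow_monom_single)
  show "coeff_bdps (psi k (monomial_qsym \<alpha> :: 'a bdps)) \<nu>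
      = coeff_bdps (monomial_qsym (map ((*) k) \<alpha>)) \<nu>"
  proof (cases "\<exists>\<mu>. \<nu> = pow_monom k \<mu>")
    case True
    then obtain \<mu> where \<nu>: "\<nu> = pow_monom k \<mu>" by blast
    show ?thesis
      by (simp add: \<nu> coeff_psi_pow[OF assms] monomial_qsym.rep_eq wm pow_monom_inject[OF assms])
  next
    case False
    then have "{is. length is = length (map ((*) k) \<alpha>) \<and> sorted_wrt (<) is
        \<and> word_monom is (map ((*) k) \<alpha>) = \<nu>} = {}" by (auto simp: wm)
    then have "coeff_bdps (monomial_qsym (map ((*) k) \<alpha>) :: 'a bdps) \<nu> = 0"
      unfolding monomial_qsym.rep_eq by (simp only: card.empty of_nat_0)
    then show ?thesis using False by (simp add: coeff_psi_nonpow)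
  qed
qed

text \<open>\<open>lambda_arg f\<close> is \<open>\<Sum>\<^bsub>k\<ge>1\<^esub> (-1)\<^bsup>k-1\<^esup>/k \<psi>\<^sub>k(f) t\<^sup>k\<close>.  It has no constant term in \<open>t\<close>, so it
  may be substituted into the exponential series.\<close>

definition exp_series :: "rat bdps fps" where
  "exp_series = Abs_fps (\<lambda>n. const_bdps (1 / fact n))"

definition lambda_arg :: "rat bdps \<Rightarrow> rat bdps fps" where
  "lambda_arg f = Abs_fps (\<lambda>k. if k = 0 then 0
                               else const_bdps ((-1) ^ (k - 1) / of_nat k) * psi k f)"

definition lambda_op :: "nat \<Rightarrow> rat bdps \<Rightarrow> rat bdps" where
  "lambda_op n f = fps_nth (fps_compose exp_series (lambda_arg f)) n"

definition e_op :: "nat \<Rightarrow> nat list \<Rightarrow> rat bdps" where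
  "e_op n \<alpha> = lambda_op n (monomial_qsym \<alpha>)"

section \<open>Lyndon compositions\<close>

definition lyndon :: "nat list \<Rightarrow> bool" where
  "lyndon \<alpha> \<longleftrightarrow> is_composition \<alpha> \<and> \<alpha> \<noteq> [] \<and>
     (\<forall>\<beta>. strict_suffix \<beta> \<alpha> \<and> \<beta> \<noteq> [] \<longrightarrow> (\<alpha>, \<beta>) \<in> lexord less_than)"

definition elementary_lyndon :: "nat list \<Rightarrow> bool" where
  "elementary_lyndon \<alpha> \<longleftrightarrow> lyndon \<alpha> \<and> Gcd (set \<alpha>) = 1"

section \<open>Polynomial generators\<close>

text \<open>Integer polynomials in indeterminates indexed by \<open>'i\<close> are finitely supported functions
  from exponent functions to coefficients.\<close>

type_synonym 'i int_mpoly = "('i \<Rightarrow>\<^sub>0 nat) \<Rightarrow>\<^sub>0 int"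

definition polys_over :: "'i set \<Rightarrow> 'i int_mpoly set" where
  "polys_over I = {p. \<forall>m\<in>Poly_Mapping.keys p. Poly_Mapping.keys m \<subseteq> I}"

definition eval_mpoly :: "('i \<Rightarrow> 'r::comm_ring_1) \<Rightarrow> 'i int_mpoly \<Rightarrow> 'r" where
  "eval_mpoly v p = (\<Sum>m\<in>Poly_Mapping.keys p. of_int (Poly_Mapping.lookup p m) *
                       (\<Prod>i\<in>Poly_Mapping.keys m. v i ^ Poly_Mapping.lookup m i))"

definition int_adjoin :: "'i set \<Rightarrow> ('i \<Rightarrow> 'r::comm_ring_1) \<Rightarrow> 'r set" where
  "int_adjoin I v = eval_mpoly v ` polys_over I"

definition algebraically_independent :: "'i set \<Rightarrow> ('i \<Rightarrow> 'r::comm_ring_1) \<Rightarrow> bool" where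
  "algebraically_independent I v \<longleftrightarrow> (\<forall>p\<in>polys_over I. eval_mpoly v p = 0 \<longrightarrow> p = 0)"

definition gen_index :: "(nat \<times> nat list) set" where
  "gen_index = {(n, \<alpha>). n \<ge> 1 \<and> elementary_lyndon \<alpha>}"

end

theory Submission
  imports Defs "HOL-Library.List_Lexorder" "HOL-Library.Countable_Set"
begin

text \<open>Let \<open>X\<^sub>\<alpha>\<close> be the set of monomials occurring in the monomial quasisymmetric function \<open>\<alpha>\<close>.
  Newton's identities show that \<open>e\<^sub>n(\<alpha>)\<close> is the \<open>n\<close>-th elementary symmetric function of \<open>X\<^sub>\<alpha>\<close>.

  Generation: for a Lyndon composition \<open>a = g\<alpha>\<close> with \<open>\<alpha>\<close> elementary, \<open>e\<^sub>n(a)\<close> is the \<open>n\<close>-th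
  elementary symmetric function of the \<open>g\<close>-th powers of \<open>X\<^sub>\<alpha>\<close>, hence an integer polynomial in the
  \<open>e\<^sub>i(\<alpha>)\<close> by the fundamental theorem on symmetric functions. If \<open>w = a\<^sub>1\<^bsup>r\<^sub>1\<^esup> \<cdots> a\<^sub>k\<^bsup>r\<^sub>k\<^esup>\<close> with
  \<open>a\<^sub>1 > \<cdots> > a\<^sub>k\<close> is the Lyndon factorization of a composition, then
  \<open>e\<^bsub>r\<^sub>1\<^esub>(a\<^sub>1) \<cdots> e\<^bsub>r\<^sub>k\<^esub>(a\<^sub>k)\<close> equals \<open>w\<close> plus an integer combination of compositions that are
  shorter, or of the same length and lexicographically smaller, because the concatenation is the
  largest shuffle of the factors.

  Independence: by Newton's identities \<open>e\<^sub>n(\<alpha>)\<close> is a nonzero rational multiple of the Lyndon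
  composition \<open>n\<alpha>\<close> up to products of at least two Lyndon compositions, and the products of Lyndon
  compositions have pairwise different leading words.\<close>

section \<open>Lyndon words\<close>

text \<open>In a product of monomial quasisymmetric functions, merging two parts shortens the word.
  Comparing words by length before comparing them lexicographically therefore leaves only true
  shuffles at the top. The \<open>r\<close>-th power of a Lyndon composition then has leading
  coefficient \<open>r!\<close>, so such powers can be triangular with unit coefficients only over
  the rationals. Passing to \<open>e_op r\<close> divides this factorial out, the leading
  coefficient becomes 1, and the triangular system is solvable over the integers. For independence
  nonzero leading coefficients suffice, so that part works over the rationals and compares the
  generators with Lyndon compositions through the map sending \<open>(n, \<alpha>)\<close> to the
  multiple of \<open>\<alpha>\<close> by \<open>n\<close>. The denominators in
  \<open>lambda_op\<close> hide integrality. It is recovered by writing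
  \<open>e_op n \<alpha>\<close> as the image of the integral series \<open>elem_sym n\<close> under
  a substitution of monomials for variables, because such substitutions commute with
  \<open>lambda_op\<close>. Membership in \<open>QSymm\<close> is tested by integrality and by
  invariance under increasing relabelling of variables, two properties that pass to products without
  a product formula.\<close>

lemma less_list_iff_lexord: "xs < ys \<longleftrightarrow> (xs, ys) \<in> lexord less_than" for xs ys :: "nat list"
proof -
  have "less_than = {(u, v :: nat). u < v}" by auto
  then show ?thesis by (simp add: list_less_def)
qed

lemma append_less_append_iff [simp]: "(p @ xs < p @ ys) \<longleftrightarrow> xs < ys" for xs ys :: "nat list"
  by (induction p) auto

lemma append_le_append_iff [simp]: "(p @ xs \<le> p @ ys) \<longleftrightarrow> xs \<le> ys" for xs ys :: "nat list"
  by (induction p) auto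

lemma le_append [simp]: "xs \<le> xs @ ys" for xs ys :: "nat list"
  by (induction xs) auto

text \<open>As \<open>ys\<close> is not longer than \<open>xs\<close>, the inequality cannot come
  from a proper prefix. It is decided at a differing letter, and appending changes nothing.\<close>

lemma less_append_mono:
  fixes xs ys :: "nat list"
  assumes "xs < ys" "length ys \<le> length xs"
  shows "xs @ us < ys @ vs"
  using assms
proof (induction xs arbitrary: ys)
  case (Cons x xs)
  then show ?case by (cases ys) auto
qed simp

text \<open>A strict inequality either comes from a proper prefix or is decided at a first differing
  letter; only the second kind survives arbitrary appending. The comparisons of Lyndon words below
  split along this line.\<close>

lemma less_cases:
  fixes xs ys :: "nat list"
  assumes "xs < ys"
  obtains t where "ys = xs @ t" "t \<noteq> []" | "\<And>us vs. xs @ us < ys @ vs"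
proof -
  have "(\<exists>t. ys = xs @ t \<and> t \<noteq> []) \<or> (\<forall>us vs. xs @ us < ys @ vs)"
    using assms
  proof (induction xs arbitrary: ys)
    case (Cons x xs)
    then show ?case by (cases ys) auto
  qed auto
  then show ?thesis using that by blast
qed

lemma lyndon_less_suffix:
  assumes "lyndon (p @ s)" "p \<noteq> []" "s \<noteq> []"
  shows "p @ s < s"
proof -
  have "strict_suffix s (p @ s)" using assms by (auto simp: strict_suffix_def suffix_def)
  then show ?thesis using assms by (simp add: lyndon_def less_list_iff_lexord)
qed

lemma lyndon_append_less_suffix:
  assumes "lyndon (p @ s)" "p \<noteq> []" "s \<noteq> []"
  shows "(p @ s) @ x < s"
  using less_append_mono[OF lyndon_less_suffix[OF assms], of x "[]"] by simp

section \<open>Nonincreasing Lyndon factorizations: uniqueness and existence\<close>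

definition lyndon_factors :: "nat list list \<Rightarrow> bool" where
  "lyndon_factors ls \<longleftrightarrow> sorted_wrt (\<ge>) ls \<and> (\<forall>a\<in>set ls. lyndon a)"

lemma lyndon_factors_Nil [simp]: "lyndon_factors []"
  by (simp add: lyndon_factors_def)

lemma lyndon_factors_Cons:
  "lyndon_factors (a # ls) \<longleftrightarrow> lyndon a \<and> (\<forall>b\<in>set ls. b \<le> a) \<and> lyndon_factors ls"
  by (auto simp: lyndon_factors_def)

lemma lyndon_factors_snoc:
  "lyndon_factors (ls @ [a]) \<longleftrightarrow> lyndon a \<and> (\<forall>b\<in>set ls. a \<le> b) \<and> lyndon_factors ls"
  by (auto simp: lyndon_factors_def sorted_wrt_append)

lemma lyndon_nonempty: "lyndon a \<Longrightarrow> a \<noteq> []"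
  by (simp add: lyndon_def)

text \<open>The suffix \<open>s\<close> starts inside some factor \<open>a\<close>. If
  \<open>x\<close> is the part of \<open>a\<close> from there on, the Lyndon property gives
  \<open>a \<le> x\<close>, and \<open>x\<close> is a prefix of \<open>s\<close>, so
  \<open>l \<le> a \<le> x \<le> s\<close>. The last factor is thus the least nonempty suffix of the
  word, a description that does not mention the factorization.\<close>

lemma last_factor_le_suffix:
  assumes "lyndon_factors (ls @ [l])" "concat (ls @ [l]) = p @ s" "s \<noteq> []"
  shows "l \<le> s"
  using assms
proof (induction ls arbitrary: p)
  case Nil
  show ?case
  proof (cases "p = []")
    case False
    then show ?thesis using Nil lyndon_less_suffix[of p s] by (auto simp: lyndon_factors_Cons)
  qed (use Nil in auto)
next
  case (Cons a ls)
  have eq: "a @ concat (ls @ [l]) = p @ s" using Cons.prems by simp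
  have fl: "lyndon_factors (ls @ [l])" and a: "lyndon a" "l \<le> a"
    using Cons.prems by (auto simp: lyndon_factors_Cons)
  consider x where "p = a @ x" "concat (ls @ [l]) = x @ s"
    | x where "x \<noteq> []" "a = p @ x" "s = x @ concat (ls @ [l])"
    using eq unfolding append_eq_append_conv2
    by (metis append_Nil2 self_append_conv2)
  then show ?case
  proof cases
    case 1
    then show ?thesis using Cons.IH[OF fl] Cons.prems by blast
  next
    case 2
    have "a \<le> x"
      using lyndon_less_suffix[of p x] a 2 by (cases "p = []") auto
    also have "x \<le> s" by (simp add: 2)
    finally show ?thesis using a by simp
  qed
qed

text \<open>Both last factors are the least nonempty suffix of the common word, so they agree and
  can be stripped.\<close>

theorem lyndon_factorization_unique:
  assumes "lyndon_factors ls" "lyndon_factors ls'" "concat ls = concat ls'"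
  shows "ls = ls'"
  using assms
proof (induction ls arbitrary: ls' rule: rev_induct)
  case Nil
  then show ?case
    by (cases ls') (auto simp: lyndon_factors_Cons dest: lyndon_nonempty)
next
  case (snoc l ls)
  have "l \<noteq> []" using snoc.prems by (auto simp: lyndon_factors_snoc dest: lyndon_nonempty)
  with snoc.prems have "ls' \<noteq> []" by auto
  then obtain ks k where ks: "ls' = ks @ [k]" by (metis rev_exhaust)
  have "k \<noteq> []" using snoc.prems by (auto simp: ks lyndon_factors_snoc dest: lyndon_nonempty)
  have "l \<le> k"
    using last_factor_le_suffix[OF snoc.prems(1), of "concat ks" k] snoc.prems \<open>k \<noteq> []\<close>
    by (simp add: ks)
  moreover have "k \<le> l"
    using last_factor_le_suffix[OF snoc.prems(2)[unfolded ks], of "concat ls" l]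
      snoc.prems \<open>l \<noteq> []\<close> by (simp add: ks)
  ultimately have "k = l" by simp
  then show ?case using snoc.IH[of ks] snoc.prems by (simp add: ks lyndon_factors_snoc)
qed

text \<open>The least nonempty suffix \<open>l\<close> is Lyndon, and the word in front of it
  factors by induction on the length. What remains is that the last factor \<open>k\<close> of that
  word is at least \<open>l\<close>.\<close>

theorem lyndon_factorization_exists:
  assumes "is_composition w"
  shows "\<exists>ls. lyndon_factors ls \<and> concat ls = w"
  using assms
proof (induction "length w" arbitrary: w rule: less_induct)
  case less
  show ?case
  proof (cases "w = []")
    case True
    then show ?thesis by (intro exI[of _ "[]"]) simp
  next
    case False
    define S where "S = {s. suffix s w \<and> s \<noteq> []}"
    have fin: "finite S"
      by (rule finite_subset[of _ "set (suffixes w)"]) (auto simp: S_def)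
    have "w \<in> S" using False by (simp add: S_def)
    define l where "l = Min S"
    have "l \<in> S" unfolding l_def using fin \<open>w \<in> S\<close> by (intro Min_in) auto
    then obtain w' where w: "w = w' @ l" and l0: "l \<noteq> []" by (auto simp: S_def suffix_def)
    have min: "l \<le> s" if "suffix s w" "s \<noteq> []" for s
      unfolding l_def using fin that by (intro Min_le) (auto simp: S_def)
    have "lyndon l"
      unfolding lyndon_def
    proof (intro conjI allI impI)
      show "is_composition l" using less.prems by (auto simp: w is_composition_def)
      fix s assume s: "strict_suffix s l \<and> s \<noteq> []"
      then have "suffix s w" by (auto simp: w strict_suffix_def suffix_append)
      then have "l \<le> s" using min s by blast
      moreover have "l \<noteq> s" using s by (auto simp: strict_suffix_def)
      ultimately show "(l, s) \<in> lexord less_than" by (simp add: less_list_iff_lexord[symmetric])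
    qed (rule l0)
    have "is_composition w'" using less.prems by (auto simp: w is_composition_def)
    then obtain ls where ls: "lyndon_factors ls" "concat ls = w'"
      using less.hyps[of w'] l0 by (auto simp: w)
    have "\<forall>b\<in>set ls. l \<le> b"
    proof (cases "ls = []")
      case ne: False
      then obtain ks k where ks: "ls = ks @ [k]" by (metis rev_exhaust)
      have k: "lyndon k" "\<forall>b\<in>set ks. k \<le> b" using ls by (auto simp: ks lyndon_factors_snoc)
      have "suffix (k @ l) w" using ls by (auto simp: w ks suffix_def)
      then have kl: "l \<le> k @ l" using min l0 by blast
      have "l \<le> k"
      proof (rule ccontr)
        assume "\<not> l \<le> k"
        then have "k < l" by simp
        \<comment> \<open>If \<open>l = k @ t\<close>, minimality of \<open>l\<close> against
          \<open>k @ l\<close> gives \<open>t \<le> l\<close>, while \<open>l\<close> being Lyndon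
          gives \<open>l < t\<close>. If a letter decides \<open>k < l\<close>, the suffix
          \<open>k @ l\<close> is smaller than \<open>l\<close>.\<close>
        then show False
        proof (cases rule: less_cases)
          case (1 t)
          then have "t \<le> l" using kl by simp
          then show False
            using lyndon_less_suffix[of k t] 1 \<open>lyndon l\<close> lyndon_nonempty[OF k(1)] by simp
        next
          case 2
          from 2[of l "[]"] show False using kl by simp
        qed
      qed
      then show ?thesis using k by (auto simp: ks)
    qed simp
    then show ?thesis
      using ls \<open>lyndon l\<close> by (intro exI[of _ "ls @ [l]"]) (simp add: lyndon_factors_snoc w)
  qed
qed

section \<open>Products of Lyndon words compared with the suffixes of a larger Lyndon word\<close>

lemma concat_factors_less_suffix:
  assumes "lyndon_factors ls" "lyndon a" "\<forall>b\<in>set ls. b \<le> a" "a = p @ t" "p \<noteq> []" "t \<noteq> []"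
  shows "concat ls < t"
  using assms
proof (induction ls arbitrary: p t)
  case Nil
  then show ?case by (cases t) auto
next
  case (Cons b ls)
  have at: "a @ x < t" for x using Cons.prems lyndon_append_less_suffix by blast
  show ?case
  proof (cases "b = a")
    case False
    then have "b < a" using Cons.prems by auto
    also have "a < t" using at[of "[]"] by simp
    finally have "b < t" .
    then show ?thesis
    proof (cases rule: less_cases)
      case (1 t')
      then have "concat ls < t'"
        using Cons.IH[of "p @ b" t'] Cons.prems by (auto simp: lyndon_factors_Cons)
      then show ?thesis by (simp add: 1)
    next
      case 2
      from 2[of "concat ls" "[]"] show ?thesis by simp
    qed
  qed (simp add: at)
qed

text \<open>This adds the comparison with the whole word \<open>a\<close>, where copies of
  \<open>a\<close> must be excluded from the factors because \<open>a\<close> is not below itself.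
  Together with the comparison for proper suffixes it supplies the suffix condition of the shuffle
  lemmas.\<close>

lemma concat_factors_less:
  assumes "lyndon_factors ls" "lyndon a" "\<forall>b\<in>set ls. b < a"
  shows "concat ls < a"
proof (cases ls)
  case Nil
  then show ?thesis using assms lyndon_nonempty by (cases a) auto
next
  case (Cons b ks)
  then have "b < a" using assms by auto
  then show ?thesis
  proof (cases rule: less_cases)
    case (1 t)
    have "concat ks < t"
      using assms Cons 1 lyndon_nonempty[of b]
      by (intro concat_factors_less_suffix[of ks a b t])
        (auto simp: lyndon_factors_Cons less_imp_le)
    then show ?thesis by (simp add: 1 Cons)
  next
    case 2
    from 2[of "concat ks" "[]"] show ?thesis by (simp add: Cons)
  qed
qed

section \<open>Shuffles\<close>

text \<open>Counts the interleavings of the two words that spell \<open>u\<close>. The set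
  \<open>shuffles\<close> forgets this multiplicity, which is the coefficient of \<open>u\<close> in
  a product.\<close>

fun shuffle_count :: "'a list \<Rightarrow> 'a list \<Rightarrow> 'a list \<Rightarrow> nat" where
  "shuffle_count [] y u = (if u = y then 1 else 0)"
| "shuffle_count (a # x) [] u = (if u = a # x then 1 else 0)"
| "shuffle_count (a # x) (b # y) [] = 0"
| "shuffle_count (a # x) (b # y) (c # u) =
     (if c = a then shuffle_count x (b # y) u else 0) + (if c = b then shuffle_count (a # x) y u else 0)"

lemma shuffle_count_Nil2 [simp]: "shuffle_count x [] u = (if u = x then 1 else 0)"
  by (cases x) auto

lemma shuffle_count_pos: "0 < shuffle_count x y u \<longleftrightarrow> u \<in> shuffles x y"
  by (induction x y u rule: shuffle_count.induct) auto

lemma shuffle_count_commute: "shuffle_count x y u = shuffle_count y x u"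
  by (induction x y u rule: shuffle_count.induct) auto

lemma append_in_shuffles: "x @ y \<in> shuffles x y"
proof (induction x)
  case (Cons a x)
  then show ?case by (cases y) auto
qed simp

text \<open>The shuffles of \<open>z @ y\<close> and \<open>v\<close> that use a letter of \<open>v\<close> before \<open>z\<close> is exhausted.\<close>

fun early_shuffles :: "'a list \<Rightarrow> 'a list \<Rightarrow> 'a list \<Rightarrow> 'a list set" where
  "early_shuffles (e # z) y (d # v) =
     (#) d ` shuffles (e # z @ y) v \<union> (#) e ` early_shuffles z y (d # v)"
| "early_shuffles [] y v = {}"
| "early_shuffles (e # z) y [] = {}"

lemma shuffles_append_eq:
  "shuffles (z @ y) v = early_shuffles z y v \<union> (@) z ` shuffles y v"
proof (induction z)
  case (Cons e z)
  then show ?case by (cases v) (auto simp: image_iff)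
qed simp

text \<open>As \<open>v < z\<close>, the prefix \<open>q\<close> does better in front of \<open>v\<close>: the two words are exchanged up to
  the first position where \<open>z\<close> beats \<open>v\<close>.\<close>

lemma shuffles_exchange:
  fixes u :: "nat list"
  assumes "u \<in> shuffles (q @ z @ y) v" "v < z" "q \<noteq> []"
  shows "\<exists>u'\<in>shuffles (z @ y) (q @ v). u < u' \<or> u = u' \<and> u \<in> early_shuffles z y (q @ v)"
  using assms
proof (induction u arbitrary: q z v)
  case Nil
  then show ?case by auto
next
  case (Cons c u)
  obtain q0 q' where q: "q = q0 # q'" using Cons.prems by (cases q) auto
  obtain e z' where z: "z = e # z'" using Cons.prems by (cases z) auto
  have "c = q0 \<and> u \<in> shuffles (q' @ z @ y) v
    \<or> (\<exists>v'. v = c # v' \<and> u \<in> shuffles (q @ z @ y) v')"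
    using Cons.prems(1) by (cases v) (auto simp: q)
  then consider "c = q0" "u \<in> shuffles (q' @ z @ y) v"
    | v' where "v = c # v'" "u \<in> shuffles (q @ z @ y) v'" by blast
  then show ?case
  proof cases
    case 1
    \<comment> \<open>The word starts with the first letter of \<open>q\<close>. The competing
      shuffle may start with the same letter; there it is used before \<open>z\<close> is exhausted,
      so the result is early.\<close>
    have "\<exists>u'\<in>shuffles (z @ y) (q' @ v). u \<le> u'"
    proof (cases "q' = []")
      case False
      then show ?thesis using Cons.IH[of q' z v] 1 Cons.prems by (auto intro: less_imp_le)
    qed (use 1 in auto)
    then obtain u' where u': "u' \<in> shuffles (z @ y) (q' @ v)" "u \<le> u'" by blast
    then have "q0 # u' \<in> early_shuffles z y (q @ v)" by (auto simp: z q)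
    moreover from this have "q0 # u' \<in> shuffles (z @ y) (q @ v)"
      by (auto simp: shuffles_append_eq)
    ultimately show ?thesis using u' 1 by (intro bexI[of _ "q0 # u'"]) auto
  next
    case 2
    show ?thesis
    proof (cases "c < e")
      case True
      \<comment> \<open>The competing word can start with \<open>e\<close>, which beats
        \<open>c\<close> whatever follows.\<close>
      obtain u' where "u' \<in> shuffles (z' @ y) (q @ v)"
        by (metis append_in_shuffles)
      then have "e # u' \<in> shuffles (z @ y) (q @ v)" by (auto simp: z q)
      then show ?thesis using True by (intro bexI[of _ "e # u'"]) auto
    next
      case False
      \<comment> \<open>The letter shared by \<open>z\<close> and \<open>v\<close> is absorbed into
        the prefix: \<open>q @ z\<close> is \<open>(q @ [c]) @ z'\<close>, and \<open>q @ v\<close>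
        is \<open>(q @ [c]) @ v'\<close>.\<close>
      then have e: "e = c" and "v' < z'" using Cons.prems 2 by (auto simp: z)
      then obtain u' where u': "u' \<in> shuffles (z' @ y) (q @ v)"
        "u < u' \<or> u = u' \<and> u \<in> early_shuffles z' y (q @ v)"
        using Cons.IH[of "q @ [c]" z' v'] 2 by (auto simp: z)
      then show ?thesis by (intro bexI[of _ "c # u'"]) (auto simp: z q e)
    qed
  qed
qed

text \<open>If the first letter of \<open>v\<close> is smaller than that of \<open>z\<close>, using
  it loses at once. If the two agree, the exchange lemma compares the remaining word with a shuffle
  in which \<open>z\<close> has lost its first letter and \<open>v\<close> is complete again; that
  shuffle is strictly larger or is the same word and early, so the induction applies.\<close>

lemma early_shuffle_less:
  fixes u :: "nat list"
  assumes "\<forall>u\<in>shuffles y v. u \<le> Y" "\<forall>p t. z = p @ t \<longrightarrow> t \<noteq> [] \<longrightarrow> v < t"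
    and "u \<in> early_shuffles z y v"
  shows "u < z @ Y"
  using assms(2,3)
proof (induction z arbitrary: u)
  case (Cons e z)
  obtain d v' where v: "v = d # v'" using Cons.prems by (cases v) auto
  have ve: "v < e # z" using Cons.prems(1) by (metis append_Nil list.distinct(1))
  have IH: "w < z @ Y" if "w \<in> early_shuffles z y v" for w
    using Cons.IH[of w] Cons.prems(1) that by (metis append_Cons)
  have le: "w \<le> z @ Y" if "w \<in> shuffles (z @ y) v" for w
    using that IH[of w] assms(1) by (auto simp: shuffles_append_eq less_imp_le)
  from Cons.prems(2) consider w where "u = d # w" "w \<in> shuffles (e # z @ y) v'"
    | w where "u = e # w" "w \<in> early_shuffles z y v" by (auto simp: v)
  then show ?case
  proof cases
    case 1
    show ?thesis
    proof (cases "d < e")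
      case False
      then have e: "e = d" and "v' < z" using ve by (auto simp: v)
      then obtain w' where "w' \<in> shuffles (z @ y) v"
        "w < w' \<or> w = w' \<and> w \<in> early_shuffles z y v"
        using shuffles_exchange[of w "[e]" z y v'] 1 by (auto simp: v)
      then have "w < z @ Y" using le[of w'] IH[of w] by auto
      then show ?thesis by (simp add: 1 e)
    qed (simp add: 1)
  next
    case 2
    then show ?thesis using IH by simp
  qed
qed simp

lemma shuffle_append_le:
  fixes u :: "nat list"
  assumes "\<forall>u\<in>shuffles y v. u \<le> Y" "\<forall>p t. z = p @ t \<longrightarrow> t \<noteq> [] \<longrightarrow> v < t"
    and "u \<in> shuffles (z @ y) v"
  shows "u \<le> z @ Y"
  using assms early_shuffle_less[OF assms(1,2), of u]
  by (auto simp: shuffles_append_eq less_imp_le)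

text \<open>An early use of a letter of \<open>v\<close> gives a strictly smaller word, so
  \<open>z @ Y\<close> can be spelled only by exhausting \<open>z\<close> first.\<close>

lemma shuffle_count_append:
  fixes z :: "nat list"
  assumes "\<forall>u\<in>shuffles y v. u \<le> Y" "\<forall>p t. z = p @ t \<longrightarrow> t \<noteq> [] \<longrightarrow> v < t"
  shows "shuffle_count (z @ y) v (z @ Y) = shuffle_count y v Y"
  using assms(2)
proof (induction z)
  case (Cons e z)
  have IH: "shuffle_count (z @ y) v (z @ Y) = shuffle_count y v Y"
    using Cons.IH Cons.prems by (metis append_Cons)
  show ?case
  proof (cases v)
    case Nil
    then show ?thesis using IH by simp
  next
    case v: (Cons d v')
    have "shuffle_count (e # z @ y) v' (z @ Y) = 0" if "e = d"
    proof (rule ccontr)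
      assume "shuffle_count (e # z @ y) v' (z @ Y) \<noteq> 0"
      then have "z @ Y \<in> shuffles (e # z @ y) v'" by (simp add: shuffle_count_pos[symmetric])
      then have "e # z @ Y \<in> early_shuffles (e # z) y v"
        using that by (simp add: v)
      then show False
        using early_shuffle_less[OF assms(1) Cons.prems, of "e # z @ Y"] by auto
    qed
    then show ?thesis using IH by (simp add: v)
  qed
qed simp

text \<open>For \<open>b < a\<close> the rest lies below every suffix of \<open>a\<close>, and the
  maximum is spelled once. For \<open>b = a\<close> this fails for the suffix \<open>a\<close>
  itself, so one letter \<open>e\<close> is split off, with which both words start: taking it from
  the single \<open>a\<close> contributes one spelling, and taking it from the other word
  contributes those counted by the induction hypothesis.\<close>

lemma lyndon_shuffle_max:
  assumes "lyndon_factors (a # ls)"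
  shows "(\<forall>u\<in>shuffles a (concat ls). u \<le> a @ concat ls) \<and>
         shuffle_count a (concat ls) (a @ concat ls) = Suc (count (mset ls) a)"
  using assms
proof (induction ls)
  case Nil
  then show ?case by simp
next
  case (Cons b ls)
  have a: "lyndon a" and fac: "lyndon_factors (b # ls)" and ba: "b \<le> a"
    using Cons.prems by (auto simp: lyndon_factors_Cons)
  show ?case
  proof (cases "b = a")
    case False
    then have lt: "\<forall>c\<in>set (b # ls). c < a"
      using Cons.prems by (auto simp: lyndon_factors_Cons)
    then have nin: "a \<notin> set (b # ls)" by blast
    have "concat (b # ls) < t" if "a = p @ t" "t \<noteq> []" for p t
      using concat_factors_less_suffix[OF fac a, of p t] concat_factors_less[OF fac a lt] that lt
      by (cases "p = []") (auto simp: less_imp_le)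
    then have D: "\<forall>p t. a = p @ t \<longrightarrow> t \<noteq> [] \<longrightarrow> concat (b # ls) < t" by blast
    have Y: "\<forall>u\<in>shuffles [] (concat (b # ls)). u \<le> concat (b # ls)" by simp
    show ?thesis
      using shuffle_append_le[OF Y D] shuffle_count_append[OF Y D] nin
      by (auto simp: not_in_iff)
  next
    case True
    define y where "y = concat ls"
    have IH: "\<forall>u\<in>shuffles a y. u \<le> a @ y" "shuffle_count a y (a @ y) = Suc (count (mset ls) a)"
      using Cons.IH Cons.prems by (auto simp: lyndon_factors_Cons y_def)
    obtain e s where es: "a = e # s" using lyndon_nonempty[OF a] by (cases a) auto
    have "a @ x < t" if "s = p @ t" "t \<noteq> []" for p t x
      using lyndon_append_less_suffix[of "e # p" t] a that by (simp add: es)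
    then have suff: "\<forall>p t. s = p @ t \<longrightarrow> t \<noteq> [] \<longrightarrow> a @ x < t" for x by blast
    have Y1: "\<forall>u\<in>shuffles [] (a @ y). u \<le> a @ y" by simp
    have Y2: "\<forall>u\<in>shuffles y a. u \<le> a @ y" using IH by (simp add: shuffles_commutes)
    have D2: "\<forall>p t. s = p @ t \<longrightarrow> t \<noteq> [] \<longrightarrow> a < t" using suff[of "[]"] by simp
    note le1 = shuffle_append_le[OF Y1 suff] and le2 = shuffle_append_le[OF Y2 D2]
    note ct1 = shuffle_count_append[OF Y1 suff] and ct2 = shuffle_count_append[OF Y2 D2]
    have "u \<le> a @ a @ y" if "u \<in> shuffles a (a @ y)" for u
    proof -
      from that consider w where "u = e # w" "w \<in> shuffles s (a @ y)"
        | w where "u = e # w" "w \<in> shuffles a (s @ y)" by (auto simp: es)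
      then show ?thesis
        using le1 le2 by cases (auto simp: es shuffles_commutes)
    qed
    moreover have "shuffle_count a (a @ y) (a @ a @ y) = Suc (Suc (count (mset ls) a))"
    proof -
      have "shuffle_count a (a @ y) (a @ a @ y)
          = shuffle_count s (a @ y) (s @ a @ y) + shuffle_count a (s @ y) (s @ a @ y)"
        by (simp add: es)
      also have "shuffle_count s (a @ y) (s @ a @ y) = 1" using ct1 by simp
      also have "shuffle_count a (s @ y) (s @ a @ y) = Suc (count (mset ls) a)"
        using ct2 IH by (simp add: shuffle_count_commute[of a])
      finally show ?thesis by simp
    qed
    ultimately show ?thesis by (simp add: True y_def)
  qed
qed

text \<open>With equal lengths, \<open>y' < y\<close> is decided at a letter. The interleaving is
  copied up to that letter; there the larger letter wins, and any completion will do.\<close>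

lemma shuffles_mono_less:
  fixes u :: "nat list"
  assumes "u \<in> shuffles x y'" "length y' = length y" "y' < y"
  shows "\<exists>u'\<in>shuffles x y. u < u'"
  using assms
proof (induction u arbitrary: x y y')
  case Nil
  then show ?case by auto
next
  case (Cons c u)
  obtain d v where y: "y = d # v" using Cons.prems by (cases y) auto
  obtain d' v' where y': "y' = d' # v'" using Cons.prems by (cases y') auto
  consider x' where "x = c # x'" "u \<in> shuffles x' y'" | "c = d'" "u \<in> shuffles x v'"
    using Cons.prems(1) by (cases x) (auto simp: y')
  then show ?case
  proof cases
    case 1
    then obtain u' where "u' \<in> shuffles x' y" "u < u'" using Cons.IH Cons.prems by blast
    then show ?thesis using 1 by (intro bexI[of _ "c # u'"]) (auto simp: y)
  next
    case 2
    show ?thesis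
    proof (cases "d' < d")
      case True
      obtain u' where "u' \<in> shuffles x v" by (metis append_in_shuffles)
      then show ?thesis using True 2
        by (intro bexI[of _ "d # u'"]) (cases x; auto simp: y)+
    next
      case False
      then have "d' = d" "v' < v" using Cons.prems by (auto simp: y y')
      then obtain u' where "u' \<in> shuffles x v" "u < u'" using Cons.IH[of x v' v] Cons.prems 2
        by (auto simp: y y')
      then show ?thesis using 2 \<open>d' = d\<close>
        by (intro bexI[of _ "d # u'"]) (cases x; auto simp: y)+
    qed
  qed
qed

text \<open>The second conclusion isolates the coefficient of the maximal word: among the smaller or
  equal words of full length only \<open>concat ls\<close> contributes to it.\<close>

lemma lyndon_shuffle_le:
  assumes "lyndon_factors (a # ls)" "length v = length (concat ls)" "v \<le> concat ls"
    and "u \<in> shuffles a v"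
  shows "u \<le> a @ concat ls" "u = a @ concat ls \<Longrightarrow> v = concat ls"
proof -
  have max: "\<forall>u\<in>shuffles a (concat ls). u \<le> a @ concat ls"
    using lyndon_shuffle_max[OF assms(1)] by blast
  have *: "u < a @ concat ls" if "v \<noteq> concat ls"
    using shuffles_mono_less[OF assms(4,2)] assms(3) that max by (auto simp: le_less)
  show "u \<le> a @ concat ls" using * max assms(4) by (cases "v = concat ls") auto
  show "v = concat ls" if "u = a @ concat ls" using * that by auto
qed

abbreviation "lookup \<equiv> Poly_Mapping.lookup"
abbreviation "keys \<equiv> Poly_Mapping.keys"

section \<open>Homomorphisms and the operations\<close>

lemmas coeff_simps = zero_bdps.rep_eq one_bdps.rep_eq plus_bdps.rep_eq uminus_bdps.rep_eq

lemma coeff_minus: "coeff_bdps (f - g) \<mu> = coeff_bdps f \<mu> - coeff_bdps g \<mu>"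
  unfolding minus_bdps_def coeff_simps by simp

lemma coeff_sum: "coeff_bdps (\<Sum>i\<in>A. F i) \<mu> = (\<Sum>i\<in>A. coeff_bdps (F i) \<mu>)"
  by (induction A rule: infinite_finite_induct) (auto simp: coeff_simps)

lemma coeff_mult:
  "coeff_bdps (f * g) \<mu> = (\<Sum>(a, b)\<in>splits \<mu>. coeff_bdps f a * coeff_bdps g b)"
  by (simp add: times_bdps.rep_eq)

lemma coeff_mult_nonzeroE:
  assumes "coeff_bdps (f * g) \<mu> \<noteq> 0"
  obtains a b where "a + b = \<mu>" "coeff_bdps f a \<noteq> 0" "coeff_bdps g b \<noteq> 0"
proof -
  obtain p where "p \<in> splits \<mu>" "(case p of (a, b) \<Rightarrow> coeff_bdps f a * coeff_bdps g b) \<noteq> 0"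
    using assms unfolding coeff_mult by (meson sum.not_neutral_contains_not_neutral)
  then have "fst p + snd p = \<mu>" "coeff_bdps f (fst p) * coeff_bdps g (snd p) \<noteq> 0"
    by (auto simp: splits_def split_def)
  then show ?thesis using that by (metis mult_zero_left mult_zero_right)
qed

lemma const_bdps_1 [simp]: "const_bdps 1 = 1"
  by (rule bdps_eqI) (simp add: const_bdps.rep_eq coeff_simps)

lemma const_bdps_0 [simp]: "const_bdps 0 = 0"
  by (rule bdps_eqI) (simp add: const_bdps.rep_eq coeff_simps)

lemma const_bdps_add: "const_bdps (a + b) = const_bdps a + const_bdps b"
  by (rule bdps_eqI) (simp add: const_bdps.rep_eq coeff_simps)

lemma const_bdps_diff: "const_bdps (a - b) = const_bdps a - const_bdps b"
  by (rule bdps_eqI) (simp add: const_bdps.rep_eq coeff_minus)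

lemma coeff_const_mult [simp]:
  "coeff_bdps (const_bdps c * f) \<mu> = c * coeff_bdps f \<mu>"
proof -
  have "coeff_bdps (const_bdps c * f) \<mu>
      = (\<Sum>(a, b)\<in>{(0, \<mu>)}. coeff_bdps (const_bdps c) a * coeff_bdps f b)"
    unfolding coeff_mult
    by (rule sum.mono_neutral_right[OF finite_splits])
      (auto simp: splits_def const_bdps.rep_eq split: if_splits)
  then show ?thesis by (simp add: const_bdps.rep_eq)
qed

lemma const_bdps_mult: "const_bdps (a * b) = const_bdps a * const_bdps b"
  by (rule bdps_eqI) (simp add: const_bdps.rep_eq)

lemma of_nat_bdps: "of_nat n = const_bdps (of_nat n)"
  by (induction n) (auto simp: const_bdps_add)

lemma of_int_bdps: "of_int z = const_bdps (of_int z)"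
  by (cases z rule: int_diff_cases) (simp add: of_nat_bdps const_bdps_diff)

lemma coeff_of_nat_mult [simp]: "coeff_bdps (of_nat n * f) \<mu> = of_nat n * coeff_bdps f \<mu>"
  by (simp add: of_nat_bdps)

lemma coeff_of_int_mult [simp]: "coeff_bdps (of_int z * f) \<mu> = of_int z * coeff_bdps f \<mu>"
  by (simp add: of_int_bdps)

text \<open>Newton's recursion yields \<open>n\<close> times the \<open>n\<close>-th operation; with
  this cancellation it determines the operation.\<close>

lemma of_nat_bdps_cancel:
  fixes f g :: "rat bdps"
  assumes "n \<noteq> 0" "of_nat n * f = of_nat n * g"
  shows "f = g"
proof (rule bdps_eqI)
  fix \<mu>
  have "of_nat n * coeff_bdps f \<mu> = of_nat n * coeff_bdps g \<mu>"
    using assms(2) by (metis coeff_of_nat_mult)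
  then show "coeff_bdps f \<mu> = coeff_bdps g \<mu>" using assms(1) by simp
qed

lemma lambda_op_0: "lambda_op 0 f = 1"
  by (simp add: lambda_op_def fps_compose_nth exp_series_def)

text \<open>For \<open>E = exp A\<close> this is the coefficient form of \<open>E' = A' E\<close>.
  The factor \<open>Suc k\<close> produced by differentiating cancels the denominators of
  \<open>lambda_arg\<close>.\<close>

lemma lambda_op_Suc:
  "of_nat (Suc n) * lambda_op (Suc n) f =
     (\<Sum>k\<le>n. const_bdps ((-1) ^ k) * psi (Suc k) f * lambda_op (n - k) f)"
proof -
  define A where "A = lambda_arg f"
  define c where "c i = (const_bdps (1 / fact i) :: rat bdps)" for i
  have A0: "fps_nth A 0 = 0" by (simp add: A_def lambda_arg_def)
  have pow0: "fps_nth (A ^ i) k = 0" if "k < i" for i k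
    using startsby_zero_power_prefix[OF A0] that by blast
  \<comment> \<open>The power \<open>A ^ i\<close> has no terms of degree below \<open>i\<close>, so
    one finite truncation of the exponential serves all coefficients up to \<open>N\<close>.\<close>
  have lam: "lambda_op m f = (\<Sum>i\<le>N. c i * fps_nth (A ^ i) m)" if "m \<le> N" for m N
  proof -
    have "(\<Sum>i\<le>N. c i * fps_nth (A ^ i) m) = (\<Sum>i\<in>{0..m}. c i * fps_nth (A ^ i) m)"
      using that by (intro sum.mono_neutral_right) (auto simp: pow0)
    then show ?thesis
      by (simp add: lambda_op_def fps_compose_nth A_def c_def exp_series_def)
  qed
  have ci: "of_nat (Suc i) * c (Suc i) = c i" for i
  proof -
    have "of_nat (Suc i) * c (Suc i) = const_bdps (of_nat (Suc i) * (1 / fact (Suc i)))"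
      by (simp only: c_def of_nat_bdps const_bdps_mult)
    then show ?thesis by (simp add: c_def)
  qed
  have dA: "fps_nth (fps_deriv A) k = const_bdps ((-1) ^ k) * psi (Suc k) f" for k
  proof -
    have "fps_nth A (Suc k) = const_bdps ((-1) ^ k / of_nat (Suc k)) * psi (Suc k) f"
      by (simp add: A_def lambda_arg_def)
    then have "fps_nth (fps_deriv A) k
        = const_bdps (of_nat (Suc k)) * (const_bdps ((-1) ^ k / of_nat (Suc k)) * psi (Suc k) f)"
      by (simp only: fps_deriv_nth of_nat_bdps Suc_eq_plus1)
    also have "\<dots> = const_bdps (of_nat (Suc k) * ((-1) ^ k / of_nat (Suc k))) * psi (Suc k) f"
      by (simp only: const_bdps_mult mult.assoc)
    finally show ?thesis by simp
  qed
  have step: "of_nat (Suc n) * (c (Suc i) * fps_nth (A ^ Suc i) (Suc n))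
      = c i * fps_nth (fps_deriv A * A ^ i) n" for i
  proof -
    have "of_nat (Suc n) * fps_nth (A ^ Suc i) (Suc n) = fps_nth (fps_deriv (A ^ Suc i)) n"
      by (simp only: fps_deriv_nth Suc_eq_plus1[symmetric])
    also have "\<dots> = of_nat (Suc i) * fps_nth (fps_deriv A * A ^ i) n"
      by (simp only: fps_deriv_power diff_Suc_1 mult.assoc fps_mult_left_const_nth)
    finally have eq: "of_nat (Suc n) * fps_nth (A ^ Suc i) (Suc n)
      = of_nat (Suc i) * fps_nth (fps_deriv A * A ^ i) n" .
    have "of_nat (Suc n) * (c (Suc i) * fps_nth (A ^ Suc i) (Suc n))
      = c (Suc i) * (of_nat (Suc n) * fps_nth (A ^ Suc i) (Suc n))"
      by (rule mult.left_commute)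
    also have "\<dots> = (of_nat (Suc i) * c (Suc i)) * fps_nth (fps_deriv A * A ^ i) n"
      unfolding eq by (simp only: mult_ac)
    finally show ?thesis by (simp only: ci)
  qed
  have "of_nat (Suc n) * lambda_op (Suc n) f
      = (\<Sum>i\<le>Suc n. of_nat (Suc n) * (c i * fps_nth (A ^ i) (Suc n)))"
    by (simp only: lam[OF order_refl] sum_distrib_left)
  also have "\<dots> = (\<Sum>i\<le>n. of_nat (Suc n) * (c (Suc i) * fps_nth (A ^ Suc i) (Suc n)))"
    by (subst sum.atMost_Suc_shift) simp
  also have "\<dots> = (\<Sum>i\<le>n. c i * fps_nth (fps_deriv A * A ^ i) n)"
    by (simp only: step)
  also have "\<dots> = (\<Sum>i\<le>n. \<Sum>k\<le>n. fps_nth (fps_deriv A) k * (c i * fps_nth (A ^ i) (n - k)))"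
    by (simp add: fps_mult_nth sum_distrib_left atLeast0AtMost mult_ac del: fps_deriv_nth)
  also have "\<dots> = (\<Sum>k\<le>n. fps_nth (fps_deriv A) k * lambda_op (n - k) f)"
    by (subst sum.swap) (simp add: lam[of _ n] sum_distrib_left del: fps_deriv_nth)
  finally show ?thesis by (simp only: dA)
qed

text \<open>This is the structure entering Newton's recursion: an endomorphism of this kind commutes
  with every \<open>lambda_op n\<close>.\<close>

definition bdps_hom :: "(rat bdps \<Rightarrow> rat bdps) \<Rightarrow> bool" where
  "bdps_hom T \<longleftrightarrow> (\<forall>f g. T (f + g) = T f + T g) \<and> (\<forall>f g. T (f * g) = T f * T g) \<and>
     (\<forall>c. T (const_bdps c) = const_bdps c) \<and> (\<forall>k f. k \<ge> 1 \<longrightarrow> T (psi k f) = psi k (T f))"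

context
  fixes T assumes T: "bdps_hom T"
begin

lemma hom_add: "T (f + g) = T f + T g"
  and hom_mult: "T (f * g) = T f * T g"
  and hom_const: "T (const_bdps c) = const_bdps c"
  and hom_psi: "k \<ge> 1 \<Longrightarrow> T (psi k f) = psi k (T f)"
  using T by (auto simp: bdps_hom_def)

lemma hom_of_int: "T (of_int z) = of_int z"
  by (simp add: of_int_bdps hom_const)

lemma hom_1: "T 1 = 1"
  using hom_of_int[of 1] by simp

lemma hom_sum: "T (\<Sum>i\<in>A. F i) = (\<Sum>i\<in>A. T (F i))"
  using hom_of_int[of 0] by (induction A rule: infinite_finite_induct) (auto simp: hom_add)

lemma hom_uminus: "T (- f) = - T f"
  using hom_add[of "- f" f] hom_of_int[of 0] by (simp add: add_eq_0_iff2)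

lemma hom_lambda_op: "T (lambda_op n f) = lambda_op n (T f)"
proof (induction n rule: less_induct)
  case (less n)
  show ?case
  proof (cases n)
    case 0
    then show ?thesis by (simp add: lambda_op_0 hom_1)
  next
    case (Suc m)
    have IH: "T (lambda_op (m - k) f) = lambda_op (m - k) (T f)" for k
      using less[of "m - k"] by (simp add: Suc)
    have "of_nat n * T (lambda_op n f) = T (of_nat n * lambda_op n f)"
      by (simp add: hom_mult hom_of_int[of "int n", simplified])
    also have "\<dots> = of_nat n * lambda_op n (T f)"
      unfolding Suc lambda_op_Suc by (simp add: hom_sum hom_mult hom_const hom_psi IH)
    finally show ?thesis using of_nat_bdps_cancel[of n] Suc by blast
  qed
qed

end

lemma additive_pow_monom:
  assumes "\<And>a b. \<phi> (a + b) = \<phi> a + \<phi> b"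
  shows "\<phi> (pow_monom k \<mu>) = pow_monom k (\<phi> \<mu>)"
proof (induction k)
  have z: "pow_monom 0 \<nu> = 0" for \<nu> by (rule poly_mapping_eqI) (simp add: lookup_pow_monom)
  case 0
  have "\<phi> 0 + \<phi> 0 = \<phi> 0 + 0" using assms[of 0 0] by simp
  then show ?case by (simp add: z del: add_0_right)
next
  have s: "pow_monom (Suc k) \<nu> = \<nu> + pow_monom k \<nu>" for k \<nu>
    by (rule poly_mapping_eqI) (simp add: lookup_pow_monom lookup_add)
  case (Suc k)
  then show ?case by (simp add: s assms)
qed

lemma coeff_Abs_bdps:
  assumes "\<And>\<mu>. f \<mu> \<noteq> 0 \<Longrightarrow> mdeg \<mu> \<le> d"
  shows "coeff_bdps (Abs_bdps f) = f"
  using assms by (intro Abs_bdps_inverse) auto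

lemma coeff_degree_bound: "\<exists>d. \<forall>\<mu>. coeff_bdps f \<mu> \<noteq> 0 \<longrightarrow> mdeg \<mu> \<le> d"
  using coeff_bdps[of f] by blast

subsection \<open>Substitution of monomials for the variables\<close>

text \<open>Finite fibres make each coefficient of the substituted series a finite sum, and the
  linear bound keeps the degree bounded.\<close>

definition substitution :: "(monom \<Rightarrow> monom) \<Rightarrow> bool" where
  "substitution \<phi> \<longleftrightarrow> (\<forall>a b. \<phi> (a + b) = \<phi> a + \<phi> b) \<and> (\<forall>\<mu>. finite {h. \<phi> h = \<mu>}) \<and>
     (\<exists>N. \<forall>h. mdeg (\<phi> h) \<le> N * mdeg h)"

definition substitute :: "(monom \<Rightarrow> monom) \<Rightarrow> rat bdps \<Rightarrow> rat bdps" where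
  "substitute \<phi> f = Abs_bdps (\<lambda>\<mu>. \<Sum>h | \<phi> h = \<mu>. coeff_bdps f h)"

lemma coeff_substitute:
  assumes "substitution \<phi>"
  shows "coeff_bdps (substitute \<phi> f) \<mu> = (\<Sum>h | \<phi> h = \<mu>. coeff_bdps f h)"
proof -
  obtain d where d: "\<And>\<mu>. coeff_bdps f \<mu> \<noteq> 0 \<Longrightarrow> mdeg \<mu> \<le> d"
    using coeff_degree_bound[of f] by blast
  obtain N where N: "\<And>h. mdeg (\<phi> h) \<le> N * mdeg h" using assms by (auto simp: substitution_def)
  have "mdeg \<mu> \<le> N * d" if nz: "(\<Sum>h | \<phi> h = \<mu>. coeff_bdps f h) \<noteq> 0" for \<mu>
  proof -
    obtain h where "\<phi> h = \<mu>" "coeff_bdps f h \<noteq> 0"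
      using nz by (metis (mono_tags, lifting) mem_Collect_eq sum.not_neutral_contains_not_neutral)
    then show ?thesis using d[of h] N[of h] by (metis le_trans mult_le_mono2)
  qed
  then have "coeff_bdps (substitute \<phi> f) = (\<lambda>\<mu>. \<Sum>h | \<phi> h = \<mu>. coeff_bdps f h)"
    unfolding substitute_def by (rule coeff_Abs_bdps)
  then show ?thesis by simp
qed

text \<open>Once the Adams operations are substitutions themselves, commuting them with another
  substitution reduces to composing maps of monomials.\<close>

lemma psi_eq_substitute:
  assumes "k \<ge> 1"
  shows "substitution (pow_monom k)" "psi k f = substitute (pow_monom k) f"
proof -
  have "finite {h. pow_monom k h = \<mu>}" for \<mu>
  proof (cases "\<exists>h. pow_monom k h = \<mu>")
    case True
    then obtain h where "pow_monom k h = \<mu>" by blast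
    then have "{h. pow_monom k h = \<mu>} = {h}" using assms by (auto simp: pow_monom_inject)
    then show ?thesis by simp
  qed simp
  then show s: "substitution (pow_monom k)"
    by (auto simp: substitution_def pow_monom_add mdeg_pow_monom)
  show "psi k f = substitute (pow_monom k) f"
    by (rule bdps_eqI) (simp add: coeff_substitute[OF s] psi.rep_eq)
qed

lemma substitution_comp:
  assumes "substitution \<phi>" "substitution \<chi>"
  shows "substitution (\<phi> \<circ> \<chi>)"
proof -
  have "{h. \<phi> (\<chi> h) = \<mu>} = (\<Union>h'\<in>{h'. \<phi> h' = \<mu>}. {h. \<chi> h = h'})" for \<mu> by auto
  then have fin: "finite {h. \<phi> (\<chi> h) = \<mu>}" for \<mu>
    using assms by (auto simp: substitution_def)
  obtain N M where NM: "\<And>h. mdeg (\<phi> h) \<le> N * mdeg h" "\<And>h. mdeg (\<chi> h) \<le> M * mdeg h"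
    using assms by (auto simp: substitution_def)
  have "mdeg (\<phi> (\<chi> h)) \<le> (N * M) * mdeg h" for h
    using NM(1)[of "\<chi> h"] NM(2)[of h] by (metis le_trans mult.assoc mult_le_mono2)
  then show ?thesis using assms fin by (auto simp: substitution_def)
qed

lemma substitute_comp:
  assumes "substitution \<phi>" "substitution \<chi>"
  shows "substitute \<phi> (substitute \<chi> f) = substitute (\<phi> \<circ> \<chi>) f"
proof (rule bdps_eqI)
  fix \<mu>
  note c = substitution_comp[OF assms]
  have "(\<Sum>h' | \<phi> h' = \<mu>. \<Sum>h | \<chi> h = h'. coeff_bdps f h)
      = (\<Sum>h'\<in>{h'. \<phi> h' = \<mu>}. \<Sum>h\<in>{h \<in> {h. (\<phi> \<circ> \<chi>) h = \<mu>}. \<chi> h = h'}. coeff_bdps f h)"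
    by (intro sum.cong) auto
  also have "\<dots> = (\<Sum>h | (\<phi> \<circ> \<chi>) h = \<mu>. coeff_bdps f h)"
    using assms c by (intro sum.group) (auto simp: substitution_def)
  finally show "coeff_bdps (substitute \<phi> (substitute \<chi> f)) \<mu> = coeff_bdps (substitute (\<phi> \<circ> \<chi>) f) \<mu>"
    by (simp add: coeff_substitute assms c)
qed

text \<open>Both sides sum over the pairs \<open>(a, b)\<close> with
  \<open>\<phi> a + \<phi> b = \<mu>\<close>, grouped once by \<open>a + b\<close> and once by the
  pair of images.\<close>

lemma substitute_mult:
  assumes "substitution \<phi>"
  shows "substitute \<phi> (f * g) = substitute \<phi> f * substitute \<phi> g"
proof (rule bdps_eqI)
  fix \<mu>
  have fin: "finite {h. \<phi> h = \<nu>}" and add: "\<phi> (a + b) = \<phi> a + \<phi> b" for \<nu> a b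
    using assms by (auto simp: substitution_def)
  let ?t = "\<lambda>(a, b). coeff_bdps f a * coeff_bdps g b"
  define S where "S = {(a, b). \<phi> a + \<phi> b = \<mu>}"
  have "S \<subseteq> (\<Union>(c, d)\<in>splits \<mu>. {a. \<phi> a = c} \<times> {b. \<phi> b = d})"
    by (auto simp: S_def splits_def)
  then have finS: "finite S" by (rule finite_subset) (auto simp: fin)
  have "coeff_bdps (substitute \<phi> (f * g)) \<mu> = (\<Sum>h\<in>{h. \<phi> h = \<mu>}. \<Sum>p\<in>{p \<in> S. fst p + snd p = h}. ?t p)"
    unfolding coeff_substitute[OF assms] coeff_mult
  proof (rule sum.cong[OF refl])
    fix h assume "h \<in> {h. \<phi> h = \<mu>}"
    then have h: "\<phi> h = \<mu>" by simp
    have "p \<in> splits h \<longleftrightarrow> p \<in> S \<and> fst p + snd p = h" for p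
      unfolding splits_def S_def add[symmetric] using h by (cases p) auto
    then have "splits h = {p \<in> S. fst p + snd p = h}" by blast
    then show "sum ?t (splits h) = sum ?t {p \<in> S. fst p + snd p = h}" by simp
  qed
  also have "\<dots> = sum ?t S"
    using finS fin by (intro sum.group) (auto simp: S_def add)
  also have "\<dots> = (\<Sum>q\<in>splits \<mu>. \<Sum>p\<in>{p \<in> S. (\<phi> (fst p), \<phi> (snd p)) = q}. ?t p)"
    by (rule sum.group[OF finS finite_splits, symmetric]) (auto simp: S_def splits_def)
  also have "\<dots> = (\<Sum>(c, d)\<in>splits \<mu>. (\<Sum>a | \<phi> a = c. coeff_bdps f a) * (\<Sum>b | \<phi> b = d. coeff_bdps g b))"
  proof (rule sum.cong[OF refl])
    fix q :: "monom \<times> monom"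
    obtain c d where q: "q = (c, d)" by (cases q)
    assume "q \<in> splits \<mu>"
    then have "c + d = \<mu>" by (simp add: splits_def q)
    then have "p \<in> S \<and> (\<phi> (fst p), \<phi> (snd p)) = q \<longleftrightarrow> p \<in> {a. \<phi> a = c} \<times> {b. \<phi> b = d}" for p
      by (cases p) (simp add: S_def q, metis)
    then have "{p \<in> S. (\<phi> (fst p), \<phi> (snd p)) = q} = {a. \<phi> a = c} \<times> {b. \<phi> b = d}"
      by blast
    then show "(\<Sum>p\<in>{p \<in> S. (\<phi> (fst p), \<phi> (snd p)) = q}. ?t p)
        = (case q of (c, d) \<Rightarrow>
            (\<Sum>a | \<phi> a = c. coeff_bdps f a) * (\<Sum>b | \<phi> b = d. coeff_bdps g b))"
      by (simp add: q sum_product sum.cartesian_product)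
  qed
  finally show "coeff_bdps (substitute \<phi> (f * g)) \<mu> = coeff_bdps (substitute \<phi> f * substitute \<phi> g) \<mu>"
    by (simp add: coeff_mult coeff_substitute[OF assms])
qed

lemma bdps_hom_substitute:
  assumes "substitution \<phi>"
  shows "bdps_hom (substitute \<phi>)"
  unfolding bdps_hom_def
proof (intro conjI allI impI)
  note cs = coeff_substitute[OF assms]
  have add: "\<phi> (a + b) = \<phi> a + \<phi> b" and fin: "finite {h. \<phi> h = \<mu>}" for a b \<mu>
    using assms by (auto simp: substitution_def)
  show "substitute \<phi> (f + g) = substitute \<phi> f + substitute \<phi> g" for f g
    by (rule bdps_eqI) (simp add: cs coeff_simps sum.distrib)
  show "substitute \<phi> (f * g) = substitute \<phi> f * substitute \<phi> g" for f g
    by (rule substitute_mult[OF assms])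
  have "\<phi> 0 = 0" using add[of 0 0] by simp
  then show "substitute \<phi> (const_bdps c) = const_bdps c" for c
    by (intro bdps_eqI) (auto simp: cs const_bdps.rep_eq sum.delta[OF fin])
  fix k :: nat and f assume k: "k \<ge> 1"
  have "\<phi> \<circ> pow_monom k = pow_monom k \<circ> \<phi>"
    by (auto simp: fun_eq_iff additive_pow_monom[of \<phi>] add)
  then show "substitute \<phi> (psi k f) = psi k (substitute \<phi> f)"
    by (simp add: psi_eq_substitute[OF k] substitute_comp assms)
qed

lemma bdps_hom_psi: "k \<ge> 1 \<Longrightarrow> bdps_hom (psi k)"
  using bdps_hom_substitute[OF psi_eq_substitute(1)] psi_eq_substitute(2)
  by (metis ext)

subsection \<open>Renaming and deleting variables\<close>

definition rename_monom :: "(nat \<Rightarrow> nat) \<Rightarrow> monom \<Rightarrow> monom" where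
  "rename_monom \<sigma> \<mu> = (\<Sum>i\<in>keys \<mu>. Poly_Mapping.single (\<sigma> i) (lookup \<mu> i))"

lemma mdeg_rename_monom [simp]: "mdeg (rename_monom \<sigma> \<mu>) = mdeg \<mu>"
  unfolding rename_monom_def mdeg_sum mdeg_single by (simp add: mdeg_def)

lemma lookup_rename_monom:
  assumes "inj \<sigma>"
  shows "lookup (rename_monom \<sigma> \<mu>) (\<sigma> i) = lookup \<mu> i"
    and "j \<notin> range \<sigma> \<Longrightarrow> lookup (rename_monom \<sigma> \<mu>) j = 0"
proof -
  have "lookup (rename_monom \<sigma> \<mu>) (\<sigma> i) = (\<Sum>l\<in>keys \<mu>. if i = l then lookup \<mu> l else 0)"
    using assms
    by (auto simp: rename_monom_def lookup_sum lookup_single when_def inj_eq intro!: sum.cong)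
  then show "lookup (rename_monom \<sigma> \<mu>) (\<sigma> i) = lookup \<mu> i"
    by (simp add: in_keys_iff)
  show "j \<notin> range \<sigma> \<Longrightarrow> lookup (rename_monom \<sigma> \<mu>) j = 0"
    by (auto simp: rename_monom_def lookup_sum lookup_single when_def intro!: sum.neutral)
qed

lemma rename_monom_eqI:
  assumes "inj \<sigma>" "\<And>i. lookup \<nu> (\<sigma> i) = lookup \<mu> i" "\<And>j. j \<notin> range \<sigma> \<Longrightarrow> lookup \<nu> j = 0"
  shows "rename_monom \<sigma> \<mu> = \<nu>"
proof (rule poly_mapping_eqI)
  fix j
  show "lookup (rename_monom \<sigma> \<mu>) j = lookup \<nu> j"
    using assms lookup_rename_monom[OF assms(1)] by (cases "j \<in> range \<sigma>") auto
qed

lemma keys_rename_monom: "inj \<sigma> \<Longrightarrow> keys (rename_monom \<sigma> \<mu>) = \<sigma> ` keys \<mu>"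
  using lookup_rename_monom(2)[of \<sigma> _ \<mu>]
  by (force simp: in_keys_iff lookup_rename_monom(1))

lemma rename_monom_add:
  "inj \<sigma> \<Longrightarrow> rename_monom \<sigma> (a + b) = rename_monom \<sigma> a + rename_monom \<sigma> b"
  by (rule rename_monom_eqI) (auto simp: lookup_add lookup_rename_monom)

lemma rename_monom_inject:
  "inj \<sigma> \<Longrightarrow> rename_monom \<sigma> a = rename_monom \<sigma> b \<longleftrightarrow> a = b"
  by (metis lookup_rename_monom(1) poly_mapping_eqI)

text \<open>Exponents are nonnegative, so both parts of a renamed monomial involve only variables in
  the range of \<open>\<sigma>\<close> and can be pulled back.\<close>

lemma splits_rename_monom:
  assumes "inj \<sigma>"
  shows "splits (rename_monom \<sigma> \<mu>) = map_prod (rename_monom \<sigma>) (rename_monom \<sigma>) ` splits \<mu>"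
proof (intro equalityI subsetI)
  fix p assume "p \<in> splits (rename_monom \<sigma> \<mu>)"
  then obtain a b where p: "p = (a, b)" and ab: "a + b = rename_monom \<sigma> \<mu>"
    by (auto simp: splits_def)
  have l: "lookup a j + lookup b j = lookup (rename_monom \<sigma> \<mu>) j" for j
    by (simp add: ab[symmetric] lookup_add)
  have z: "lookup a j = 0 \<and> lookup b j = 0" if "j \<notin> range \<sigma>" for j
    using l[of j] lookup_rename_monom(2)[OF assms that, of \<mu>] by simp
  have mk: "lookup (Poly_Mapping.map_key \<sigma> c) i = lookup c (\<sigma> i)" for c :: monom and i
    using assms by (simp add: map_key.rep_eq)
  have "rename_monom \<sigma> (Poly_Mapping.map_key \<sigma> a) = a"
    "rename_monom \<sigma> (Poly_Mapping.map_key \<sigma> b) = b"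
    by (auto intro!: rename_monom_eqI assms simp: mk z)
  moreover have "Poly_Mapping.map_key \<sigma> a + Poly_Mapping.map_key \<sigma> b = \<mu>"
    by (rule poly_mapping_eqI) (simp add: lookup_add mk l lookup_rename_monom[OF assms])
  ultimately show "p \<in> map_prod (rename_monom \<sigma>) (rename_monom \<sigma>) ` splits \<mu>"
    by (intro image_eqI[of _ _ "(Poly_Mapping.map_key \<sigma> a, Poly_Mapping.map_key \<sigma> b)"])
      (auto simp: p splits_def)
qed (auto simp: splits_def rename_monom_add[OF assms, symmetric])

text \<open>\<open>restrict_vars \<sigma>\<close> sets the variables outside the range of \<open>\<sigma>\<close> to zero and
  replaces \<open>x\<^bsub>\<sigma> i\<^esub>\<close> by \<open>x\<^sub>i\<close>.\<close>

definition restrict_vars :: "(nat \<Rightarrow> nat) \<Rightarrow> rat bdps \<Rightarrow> rat bdps" where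
  "restrict_vars \<sigma> f = Abs_bdps (\<lambda>\<mu>. coeff_bdps f (rename_monom \<sigma> \<mu>))"

lemma coeff_restrict_vars:
  "coeff_bdps (restrict_vars \<sigma> f) \<mu> = coeff_bdps f (rename_monom \<sigma> \<mu>)"
proof -
  obtain d where "\<forall>\<mu>. coeff_bdps f \<mu> \<noteq> 0 \<longrightarrow> mdeg \<mu> \<le> d"
    using coeff_degree_bound by blast
  then have "mdeg \<mu> \<le> d" if "coeff_bdps f (rename_monom \<sigma> \<mu>) \<noteq> 0" for \<mu>
    using that by (metis mdeg_rename_monom)
  then have "coeff_bdps (restrict_vars \<sigma> f) = (\<lambda>\<mu>. coeff_bdps f (rename_monom \<sigma> \<mu>))"
    unfolding restrict_vars_def by (rule coeff_Abs_bdps)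
  then show ?thesis by simp
qed

lemma bdps_hom_restrict_vars:
  assumes "inj \<sigma>"
  shows "bdps_hom (restrict_vars \<sigma>)"
  unfolding bdps_hom_def
proof (intro conjI allI impI bdps_eqI)
  note cr = coeff_restrict_vars
  fix f g \<mu>
  show "coeff_bdps (restrict_vars \<sigma> (f + g)) \<mu> = coeff_bdps (restrict_vars \<sigma> f + restrict_vars \<sigma> g) \<mu>"
    by (simp add: cr coeff_simps)
  have "inj_on (map_prod (rename_monom \<sigma>) (rename_monom \<sigma>)) (splits \<mu>)"
    using assms by (auto simp: inj_on_def rename_monom_inject)
  then show "coeff_bdps (restrict_vars \<sigma> (f * g)) \<mu> = coeff_bdps (restrict_vars \<sigma> f * restrict_vars \<sigma> g) \<mu>"
    by (simp add: cr coeff_mult splits_rename_monom[OF assms] sum.reindex split_def)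
next
  fix c \<mu>
  have "rename_monom \<sigma> 0 = 0" by (simp add: rename_monom_def)
  then have "rename_monom \<sigma> \<mu> = 0 \<longleftrightarrow> \<mu> = 0" using rename_monom_inject[OF assms] by metis
  then show "coeff_bdps (restrict_vars \<sigma> (const_bdps c)) \<mu> = coeff_bdps (const_bdps c) \<mu>"
    by (simp add: coeff_restrict_vars const_bdps.rep_eq)
next
  fix k :: nat and f \<mu> assume k: "k \<ge> 1"
  show "coeff_bdps (restrict_vars \<sigma> (psi k f)) \<mu> = coeff_bdps (psi k (restrict_vars \<sigma> f)) \<mu>"
  proof (cases "\<exists>\<nu>. \<mu> = pow_monom k \<nu>")
    case True
    then obtain \<nu> where "\<mu> = pow_monom k \<nu>" by blast
    then show ?thesis
      by (simp add: coeff_restrict_vars coeff_psi_pow[OF k]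
          additive_pow_monom[of "rename_monom \<sigma>"] rename_monom_add[OF assms])
  next
    case False
    have "rename_monom \<sigma> \<mu> \<noteq> pow_monom k \<nu>" for \<nu>
    proof
      assume eq: "rename_monom \<sigma> \<mu> = pow_monom k \<nu>"
      have "\<mu> = pow_monom k (Poly_Mapping.map_key \<sigma> \<nu>)"
      proof (rule poly_mapping_eqI)
        fix i
        have "lookup \<mu> i = lookup (pow_monom k \<nu>) (\<sigma> i)"
          by (simp add: eq[symmetric] lookup_rename_monom[OF assms])
        then show "lookup \<mu> i = lookup (pow_monom k (Poly_Mapping.map_key \<sigma> \<nu>)) i"
          using assms by (simp add: lookup_pow_monom map_key.rep_eq)
      qed
      then show False using False by blast
    qed
    then show ?thesis using False by (simp add: coeff_restrict_vars coeff_psi_nonpow)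
  qed
qed

section \<open>Quasisymmetric functions\<close>

text \<open>The unique composition whose monomial quasisymmetric function contains
  \<open>\<mu>\<close>.\<close>

definition word_of :: "monom \<Rightarrow> nat list" where
  "word_of \<mu> = map (lookup \<mu>) (sorted_list_of_set (keys \<mu>))"

lemma length_word_of [simp]: "length (word_of \<mu>) = card (keys \<mu>)"
  by (simp add: word_of_def)

lemma is_composition_word_of [simp]: "is_composition (word_of \<mu>)"
  by (auto simp: is_composition_def word_of_def in_keys_iff)

lemma sum_list_word_of [simp]: "sum_list (word_of \<mu>) = mdeg \<mu>"
  by (simp add: word_of_def mdeg_def sum_list_distinct_conv_sum_set)

lemma word_of_0 [simp]: "word_of 0 = []"
  by (simp add: word_of_def)

lemma word_of_eq:
  assumes "sorted_wrt (<) js" "set js = keys \<mu>"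
  shows "word_of \<mu> = map (lookup \<mu>) js"
proof -
  have "sorted_list_of_set (keys \<mu>) = js"
    using assms by (metis strict_sorted_equal strict_sorted_list_of_set set_sorted_list_of_set
        finite_keys)
  then show ?thesis by (simp add: word_of_def)
qed

lemma lookup_word_monom:
  assumes "length js = length \<alpha>" "distinct js"
  shows "j < length \<alpha> \<Longrightarrow> lookup (word_monom js \<alpha>) (js ! j) = \<alpha> ! j"
    and "i \<notin> set js \<Longrightarrow> lookup (word_monom js \<alpha>) i = 0"
proof -
  assume j: "j < length \<alpha>"
  have "lookup (word_monom js \<alpha>) (js ! j) = (\<Sum>l<length \<alpha>. if j = l then \<alpha> ! l else 0)"
    using assms j
    by (auto simp: word_monom_def lookup_sum lookup_single when_def nth_eq_iff_index_eq
        intro!: sum.cong)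
  then show "lookup (word_monom js \<alpha>) (js ! j) = \<alpha> ! j" using j by simp
next
  assume "i \<notin> set js"
  then show "lookup (word_monom js \<alpha>) i = 0"
    using assms by (auto simp: word_monom_def lookup_sum lookup_single when_def intro!: sum.neutral)
qed

lemma word_monom_word_of:
  assumes "is_composition \<alpha>" "length js = length \<alpha>" "sorted_wrt (<) js"
  shows "keys (word_monom js \<alpha>) = set js" "word_of (word_monom js \<alpha>) = \<alpha>"
proof -
  have d: "distinct js" using assms by (simp add: strict_sorted_iff)
  note lk = lookup_word_monom[OF assms(2) d]
  have nz: "\<alpha> ! j \<noteq> 0" if "j < length \<alpha>" for j
    using assms(1) that by (auto simp: is_composition_def)
  show k: "keys (word_monom js \<alpha>) = set js"
  proof (intro equalityI subsetI)
    fix i assume "i \<in> keys (word_monom js \<alpha>)"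
    then show "i \<in> set js" using lk(2)[of i] by (auto simp: in_keys_iff)
  next
    fix i assume "i \<in> set js"
    then obtain j where "j < length \<alpha>" "i = js ! j" using assms(2) by (metis in_set_conv_nth)
    then show "i \<in> keys (word_monom js \<alpha>)" using lk(1) nz by (simp add: in_keys_iff)
  qed
  have "word_of (word_monom js \<alpha>) = map (lookup (word_monom js \<alpha>)) js"
    using assms(3) k by (intro word_of_eq) auto
  also have "\<dots> = \<alpha>"
    using assms(2) lk(1) by (intro nth_equalityI) auto
  finally show "word_of (word_monom js \<alpha>) = \<alpha>" .
qed

lemma word_monom_keys: "word_monom (sorted_list_of_set (keys \<mu>)) (word_of \<mu>) = \<mu>"
proof (rule poly_mapping_eqI)
  fix i
  let ?js = "sorted_list_of_set (keys \<mu>)"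
  note lk = lookup_word_monom[of ?js "word_of \<mu>"]
  show "lookup (word_monom ?js (word_of \<mu>)) i = lookup \<mu> i"
  proof (cases "i \<in> set ?js")
    case True
    then obtain j where j: "j < length ?js" "i = ?js ! j" by (metis in_set_conv_nth)
    then show ?thesis using lk(1)[of j] by (simp add: word_of_def)
  next
    case False
    then show ?thesis using lk(2)[of i] by (simp add: in_keys_iff)
  qed
qed

text \<open>The index sequence is forced to be the increasing enumeration of the support, so the
  count in the definition is zero or one.\<close>

lemma coeff_monomial_qsym:
  assumes "is_composition \<alpha>"
  shows "coeff_bdps (monomial_qsym \<alpha>) \<mu> = (if word_of \<mu> = \<alpha> then 1 else 0)"
proof -
  define S where "S = {js. length js = length \<alpha> \<and> sorted_wrt (<) js \<and> word_monom js \<alpha> = \<mu>}"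
  have "card S = (if word_of \<mu> = \<alpha> then 1 else 0)"
  proof (cases "word_of \<mu> = \<alpha>")
    case True
    have "js = sorted_list_of_set (keys \<mu>)" if "js \<in> S" for js
      using that word_monom_word_of(1)[OF assms, of js] unfolding S_def
      by (metis (mono_tags, lifting) mem_Collect_eq strict_sorted_equal strict_sorted_list_of_set
          set_sorted_list_of_set finite_keys)
    moreover have "sorted_list_of_set (keys \<mu>) \<in> S"
      using True word_monom_keys[of \<mu>] by (auto simp: S_def)
    ultimately have "S = {sorted_list_of_set (keys \<mu>)}" by blast
    then show ?thesis using True by simp
  next
    case False
    then have "js \<notin> S" for js using word_monom_word_of(2)[OF assms, of js] unfolding S_def by blast
    then have "S = {}" by blast
    then show ?thesis using False by simp
  qed
  then show ?thesis by (simp add: monomial_qsym.rep_eq S_def)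
qed

section \<open>Relabelling of variables and the intrinsic description of quasisymmetric
  functions\<close>

lemma rename_monom_word_monom:
  assumes "inj \<sigma>" "length js = length \<alpha>"
  shows "rename_monom \<sigma> (word_monom js \<alpha>) = word_monom (map \<sigma> js) \<alpha>"
proof -
  have 0: "rename_monom \<sigma> 0 = 0" by (simp add: rename_monom_def)
  have single: "rename_monom \<sigma> (Poly_Mapping.single i a) = Poly_Mapping.single (\<sigma> i) a" for i a
    by (simp add: rename_monom_def)
  have sum: "rename_monom \<sigma> (\<Sum>j\<in>A. F j) = (\<Sum>j\<in>A. rename_monom \<sigma> (F j))" for A :: "nat set" and F
    by (induction A rule: infinite_finite_induct) (auto simp: 0 rename_monom_add[OF assms(1)])
  show ?thesis using assms(2) by (auto simp: word_monom_def sum single intro!: sum.cong)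
qed

lemma word_of_rename_monom:
  assumes "strict_mono \<sigma>"
  shows "word_of (rename_monom \<sigma> \<mu>) = word_of \<mu>"
proof -
  have inj: "inj \<sigma>" using assms by (rule strict_mono_imp_inj_on)
  let ?js = "sorted_list_of_set (keys \<mu>)"
  have "sorted_wrt (<) (map \<sigma> ?js)"
    using assms by (simp add: sorted_wrt_map strict_mono_less)
  then have "word_of (rename_monom \<sigma> \<mu>) = map (lookup (rename_monom \<sigma> \<mu>)) (map \<sigma> ?js)"
    by (intro word_of_eq) (auto simp: keys_rename_monom[OF inj])
  then show ?thesis by (simp add: word_of_def o_def lookup_rename_monom(1)[OF inj])
qed

text \<open>Every monomial is an increasing relabelling of the packed monomial with the same word,
  which lives in an initial segment of the variables. Invariance under such relabellings therefore
  forces equal coefficients on equal words.\<close>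

lemma word_of_standardize:
  "\<exists>\<sigma>. strict_mono \<sigma> \<and> rename_monom \<sigma> (word_monom [0..<length (word_of \<mu>)] (word_of \<mu>)) = \<mu>"
proof -
  define js where "js = sorted_list_of_set (keys \<mu>)"
  \<comment> \<open>Past the end of \<open>js\<close> the shift by \<open>Suc (sum_list js)\<close>
    exceeds every entry of \<open>js\<close> and keeps the map strictly increasing.\<close>
  define \<sigma> where "\<sigma> j = (if j < length js then js ! j else j + Suc (sum_list js))" for j
  have sorted: "sorted_wrt (<) js" by (simp add: js_def)
  have bound: "js ! j \<le> sum_list js" if "j < length js" for j
    using that by (intro member_le_sum_list) auto
  have "\<sigma> i < \<sigma> j" if "i < j" for i j
    using that sorted_wrt_nth_less[OF sorted that] bound[of i] by (auto simp: \<sigma>_def)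
  then have mono: "strict_mono \<sigma>" by (rule strict_monoI)
  have len: "length (word_of \<mu>) = length js" by (simp add: js_def)
  have "map \<sigma> [0..<length (word_of \<mu>)] = js"
    unfolding len by (rule nth_equalityI) (auto simp: \<sigma>_def)
  then have "rename_monom \<sigma> (word_monom [0..<length (word_of \<mu>)] (word_of \<mu>)) = \<mu>"
    using word_monom_keys[of \<mu>]
    by (subst rename_monom_word_monom) (auto simp: js_def strict_mono_imp_inj_on[OF mono])
  then show ?thesis using mono by blast
qed

definition quasisymmetric :: "rat bdps \<Rightarrow> bool" where
  "quasisymmetric f \<longleftrightarrow> (\<forall>\<mu> \<nu>. word_of \<mu> = word_of \<nu> \<longrightarrow> coeff_bdps f \<mu> = coeff_bdps f \<nu>)"

definition integral_coeffs :: "rat bdps \<Rightarrow> bool" where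
  "integral_coeffs f \<longleftrightarrow> (\<forall>\<mu>. coeff_bdps f \<mu> \<in> \<int>)"

text \<open>Being fixed by ring homomorphisms that commute with the operations passes at once to
  sums, products and \<open>lambda_op\<close>.\<close>

lemma quasisymmetric_iff:
  "quasisymmetric f \<longleftrightarrow> (\<forall>\<sigma>. strict_mono \<sigma> \<longrightarrow> restrict_vars \<sigma> f = f)"
proof (intro iffI allI impI)
  fix \<sigma> :: "nat \<Rightarrow> nat" assume f: "quasisymmetric f" and "strict_mono \<sigma>"
  then have "word_of (rename_monom \<sigma> \<mu>) = word_of \<mu>" for \<mu> by (simp add: word_of_rename_monom)
  then have "coeff_bdps f (rename_monom \<sigma> \<mu>) = coeff_bdps f \<mu>" for \<mu>
    using f unfolding quasisymmetric_def by blast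
  then show "restrict_vars \<sigma> f = f" by (intro bdps_eqI) (simp add: coeff_restrict_vars)
next
  assume inv: "\<forall>\<sigma>. strict_mono \<sigma> \<longrightarrow> restrict_vars \<sigma> f = f"
  have std: "coeff_bdps f \<mu> = coeff_bdps f (word_monom [0..<length (word_of \<mu>)] (word_of \<mu>))" for \<mu>
  proof -
    obtain \<sigma> where "strict_mono \<sigma>"
      and \<sigma>: "rename_monom \<sigma> (word_monom [0..<length (word_of \<mu>)] (word_of \<mu>)) = \<mu>"
      using word_of_standardize by blast
    then show ?thesis using inv by (metis coeff_restrict_vars)
  qed
  show "quasisymmetric f"
    unfolding quasisymmetric_def
  proof (intro allI impI)
    fix \<mu> \<nu> assume "word_of \<mu> = word_of \<nu>"
    then show "coeff_bdps f \<mu> = coeff_bdps f \<nu>" using std[of \<mu>] std[of \<nu>] by (simp only:)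
  qed
qed

text \<open>Bounded degree leaves finitely many words, because the letters and the length of a word
  are at most the degree of its monomial. The integer coefficients are then read off at packed
  monomials.\<close>

theorem QSymm_iff: "f \<in> QSymm \<longleftrightarrow> integral_coeffs f \<and> quasisymmetric f"
proof
  assume "f \<in> QSymm"
  then obtain A c where A: "\<forall>\<alpha>\<in>A. is_composition \<alpha>"
    and f: "f = (\<Sum>\<alpha>\<in>A. of_int (c \<alpha>) * monomial_qsym \<alpha>)"
    by (auto simp: QSymm_def)
  have "coeff_bdps f \<mu> = (\<Sum>\<alpha>\<in>A. of_int (c \<alpha>) * (if word_of \<mu> = \<alpha> then 1 else 0))" for \<mu>
    unfolding f coeff_sum coeff_of_int_mult using A
    by (intro sum.cong) (auto simp: coeff_monomial_qsym)
  then show "integral_coeffs f \<and> quasisymmetric f"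
    by (auto simp: integral_coeffs_def quasisymmetric_def intro!: Ints_sum Ints_mult)
next
  assume f: "integral_coeffs f \<and> quasisymmetric f"
  obtain d where d: "\<forall>\<mu>. coeff_bdps f \<mu> \<noteq> 0 \<longrightarrow> mdeg \<mu> \<le> d" using coeff_degree_bound by blast
  define A where "A = word_of ` {\<mu>. coeff_bdps f \<mu> \<noteq> 0}"
  \<comment> \<open>The coefficient at the packed monomial is an integer by hypothesis; the floor
    only converts its type.\<close>
  define c where "c \<alpha> = \<lfloor>coeff_bdps f (word_monom [0..<length \<alpha>] \<alpha>)\<rfloor>" for \<alpha>
  have "set (word_of \<mu>) \<subseteq> {..d} \<and> length (word_of \<mu>) \<le> d" if "coeff_bdps f \<mu> \<noteq> 0" for \<mu>
  proof -
    have "mdeg \<mu> \<le> d" using d that by blast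
    moreover have "x \<le> mdeg \<mu>" if "x \<in> set (word_of \<mu>)" for x
      using member_le_sum_list[OF that] by simp
    moreover have "card (keys \<mu>) \<le> mdeg \<mu>"
      using sum_mono[of "keys \<mu>" "\<lambda>_. 1" "lookup \<mu>"] by (auto simp: mdeg_def in_keys_iff)
    ultimately show ?thesis by fastforce
  qed
  then have "A \<subseteq> {xs. set xs \<subseteq> {..d} \<and> length xs \<le> d}" by (auto simp: A_def)
  then have fin: "finite A" by (rule finite_subset) (simp add: finite_lists_length_le)
  have comp: "\<forall>\<alpha>\<in>A. is_composition \<alpha>" by (auto simp: A_def)
  have c: "of_int (c (word_of \<mu>)) = coeff_bdps f \<mu>" for \<mu>
  proof -
    have "word_of (word_monom [0..<length (word_of \<mu>)] (word_of \<mu>)) = word_of \<mu>"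
      by (intro word_monom_word_of(2)) (auto simp: strict_sorted_iff)
    then have "coeff_bdps f (word_monom [0..<length (word_of \<mu>)] (word_of \<mu>)) = coeff_bdps f \<mu>"
      using f unfolding quasisymmetric_def by blast
    then show ?thesis using f unfolding c_def integral_coeffs_def by (metis Ints_cases floor_of_int)
  qed
  have "f = (\<Sum>\<alpha>\<in>A. of_int (c \<alpha>) * monomial_qsym \<alpha>)"
  proof (rule bdps_eqI)
    fix \<mu>
    have "coeff_bdps (\<Sum>\<alpha>\<in>A. of_int (c \<alpha>) * monomial_qsym \<alpha>) \<mu>
        = (\<Sum>\<alpha>\<in>A. if word_of \<mu> = \<alpha> then of_int (c \<alpha>) else 0)"
      unfolding coeff_sum coeff_of_int_mult using comp
      by (intro sum.cong) (auto simp: coeff_monomial_qsym)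
    also have "\<dots> = (if word_of \<mu> \<in> A then of_int (c (word_of \<mu>)) else 0)"
      using fin by simp
    also have "\<dots> = coeff_bdps f \<mu>" unfolding c by (auto simp: A_def)
    finally show "coeff_bdps f \<mu> = coeff_bdps (\<Sum>\<alpha>\<in>A. of_int (c \<alpha>) * monomial_qsym \<alpha>) \<mu>" by simp
  qed
  then show "f \<in> QSymm" using fin comp unfolding QSymm_def by blast
qed

lemma integral_coeffs_arith:
  "integral_coeffs (of_int z)" "integral_coeffs f \<Longrightarrow> integral_coeffs (- f)"
  "integral_coeffs f \<Longrightarrow> integral_coeffs g \<Longrightarrow> integral_coeffs (f + g)"
  "integral_coeffs f \<Longrightarrow> integral_coeffs g \<Longrightarrow> integral_coeffs (f - g)"
  by (simp_all add: integral_coeffs_def plus_bdps.rep_eq uminus_bdps.rep_eq coeff_minus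
      of_int_bdps const_bdps.rep_eq)

lemma integral_coeffs_mult:
  assumes "integral_coeffs f" "integral_coeffs g"
  shows "integral_coeffs (f * g)"
  unfolding integral_coeffs_def coeff_mult
proof
  fix \<mu>
  have "(case p of (a, b) \<Rightarrow> coeff_bdps f a * coeff_bdps g b) \<in> \<int>" for p
    using assms by (cases p) (simp add: integral_coeffs_def)
  then show "(\<Sum>(a, b)\<in>splits \<mu>. coeff_bdps f a * coeff_bdps g b) \<in> \<int>"
    by (rule Ints_sum)
qed

lemma restrict_vars_fixed_arith:
  assumes "inj \<sigma>"
  shows "restrict_vars \<sigma> (of_int z) = of_int z"
    "restrict_vars \<sigma> f = f \<Longrightarrow> restrict_vars \<sigma> (- f) = - f"
    "restrict_vars \<sigma> f = f \<Longrightarrow> restrict_vars \<sigma> g = g \<Longrightarrow> restrict_vars \<sigma> (f + g) = f + g"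
    "restrict_vars \<sigma> f = f \<Longrightarrow> restrict_vars \<sigma> g = g \<Longrightarrow> restrict_vars \<sigma> (f * g) = f * g"
    "restrict_vars \<sigma> f = f \<Longrightarrow> restrict_vars \<sigma> (lambda_op n f) = lambda_op n f"
  using bdps_hom_restrict_vars[OF assms]
  by (simp_all add: hom_of_int hom_add hom_mult hom_uminus hom_lambda_op)

lemma quasisymmetric_arith:
  "quasisymmetric (of_int z)" "quasisymmetric f \<Longrightarrow> quasisymmetric (- f)"
  "quasisymmetric f \<Longrightarrow> quasisymmetric g \<Longrightarrow> quasisymmetric (f + g)"
  "quasisymmetric f \<Longrightarrow> quasisymmetric g \<Longrightarrow> quasisymmetric (f * g)"
  "quasisymmetric f \<Longrightarrow> quasisymmetric (lambda_op n f)"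
  unfolding quasisymmetric_iff
  by (blast intro: restrict_vars_fixed_arith strict_mono_imp_inj_on)+

lemma QSymm_arith:
  "of_int z \<in> QSymm" "f \<in> QSymm \<Longrightarrow> - f \<in> QSymm"
  "f \<in> QSymm \<Longrightarrow> g \<in> QSymm \<Longrightarrow> f + g \<in> QSymm"
  "f \<in> QSymm \<Longrightarrow> g \<in> QSymm \<Longrightarrow> f * g \<in> QSymm"
  by (simp_all add: QSymm_iff integral_coeffs_arith integral_coeffs_mult quasisymmetric_arith)

lemma monomial_qsym_in_QSymm:
  assumes "is_composition \<alpha>"
  shows "monomial_qsym \<alpha> \<in> QSymm"
  using assms by (auto simp: QSymm_iff integral_coeffs_def quasisymmetric_def coeff_monomial_qsym)

section \<open>Symmetric functions\<close>

definition indicator_monom :: "nat set \<Rightarrow> monom" where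
  "indicator_monom S = (\<Sum>i\<in>S. Poly_Mapping.single i 1)"

lemma lookup_indicator_monom [simp]:
  "finite S \<Longrightarrow> lookup (indicator_monom S) i = (if i \<in> S then 1 else 0)"
  by (simp add: indicator_monom_def lookup_sum lookup_single when_def)

lemma keys_indicator_monom [simp]: "finite S \<Longrightarrow> keys (indicator_monom S) = S"
  by (auto simp: in_keys_iff split: if_splits)

lemma mdeg_indicator_monom [simp]: "mdeg (indicator_monom S) = card S"
  by (simp add: indicator_monom_def mdeg_sum)

lemma card_keys_le_mdeg: "card (keys \<mu>) \<le> mdeg \<mu>"
  using sum_mono[of "keys \<mu>" "\<lambda>_. 1" "lookup \<mu>"] by (auto simp: mdeg_def in_keys_iff)

definition squarefree_monom :: "nat \<Rightarrow> monom \<Rightarrow> bool" where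
  "squarefree_monom n h \<longleftrightarrow> (\<forall>i. lookup h i \<le> 1) \<and> card (keys h) = n"

lemma squarefree_monom_eq:
  assumes "squarefree_monom n h"
  shows "h = indicator_monom (keys h)"
proof (rule poly_mapping_eqI)
  fix i
  have "lookup h i \<le> 1" using assms by (simp add: squarefree_monom_def)
  then show "lookup h i = lookup (indicator_monom (keys h)) i" by (auto simp: in_keys_iff)
qed

definition elem_sym :: "nat \<Rightarrow> rat bdps" where
  "elem_sym n = Abs_bdps (\<lambda>h. if squarefree_monom n h then 1 else 0)"

lemma coeff_elem_sym: "coeff_bdps (elem_sym n) h = (if squarefree_monom n h then 1 else 0)"
proof -
  have "mdeg h \<le> n" if "squarefree_monom n h" for h
    using squarefree_monom_eq[OF that] that
    by (metis mdeg_indicator_monom order_refl squarefree_monom_def)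
  then have "coeff_bdps (elem_sym n) = (\<lambda>h. if squarefree_monom n h then 1 else 0)"
    unfolding elem_sym_def by (intro coeff_Abs_bdps[of _ n]) (auto split: if_splits)
  then show ?thesis by simp
qed

lemma elem_sym_0: "elem_sym 0 = 1"
  by (rule bdps_eqI) (auto simp: coeff_elem_sym squarefree_monom_def coeff_simps)

lemma squarefree_monom_1: "squarefree_monom (Suc 0) h \<longleftrightarrow> (\<exists>j. h = Poly_Mapping.single j 1)"
proof
  assume h: "squarefree_monom (Suc 0) h"
  then obtain j where "keys h = {j}" by (auto simp: squarefree_monom_def card_1_singleton_iff)
  then have "h = Poly_Mapping.single j 1"
    using squarefree_monom_eq[OF h] by (simp add: indicator_monom_def)
  then show "\<exists>j. h = Poly_Mapping.single j 1" ..
qed (auto simp: squarefree_monom_def lookup_single when_def)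

lemma coeff_psi_elem_sym_1:
  assumes "k \<ge> 1"
  shows "coeff_bdps (psi k (elem_sym (Suc 0))) h = (if \<exists>j. h = Poly_Mapping.single j k then 1 else 0)"
proof (cases "\<exists>g. h = pow_monom k g")
  case True
  then obtain g where g: "h = pow_monom k g" by blast
  have "h = Poly_Mapping.single j k \<longleftrightarrow> g = Poly_Mapping.single j 1" for j
    using pow_monom_inject[OF assms, of g "Poly_Mapping.single j 1"] by (simp add: g pow_monom_single)
  then show ?thesis
    by (simp only: g coeff_psi_pow[OF assms] coeff_elem_sym squarefree_monom_1)
next
  case False
  then have "\<nexists>j. h = Poly_Mapping.single j k" by (metis pow_monom_single mult.right_neutral)
  then show ?thesis using False by (simp add: coeff_psi_nonpow)
qed

lemma psi_1_elem_sym_1: "psi (Suc 0) (elem_sym (Suc 0)) = elem_sym (Suc 0)"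
  by (rule bdps_eqI) (simp add: coeff_psi_elem_sym_1 coeff_elem_sym squarefree_monom_1)

text \<open>\<open>card (hook_set N k h)\<close> is the coefficient at \<open>h\<close> of the sum of all
  \<open>x\<^sub>j\<^sup>k x\<^bsub>i\<^sub>1\<^esub> \<cdots> x\<^bsub>i\<^sub>r\<^esub>\<close> with \<open>i\<^sub>1 < \<dots> < i\<^sub>r\<close> different from \<open>j\<close> and \<open>r = N - k\<close>;
  these sums telescope in Newton's identities.\<close>

definition hook_set :: "nat \<Rightarrow> nat \<Rightarrow> monom \<Rightarrow> nat set" where
  "hook_set N k h =
     {j. lookup h j = k \<and> (\<forall>i. i \<noteq> j \<longrightarrow> lookup h i \<le> 1) \<and> card (keys h - {j}) + k = N}"

definition hook_count :: "nat \<Rightarrow> nat \<Rightarrow> monom \<Rightarrow> rat" where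
  "hook_count N k h = of_nat (card (hook_set N k h))"

lemma finite_hook_set: "finite (hook_set N (Suc k) h)"
  by (rule finite_subset[of _ "keys h"]) (auto simp: hook_set_def in_keys_iff)

text \<open>A power of \<open>x_j\<close> with exponent \<open>Suc k\<close> meets a squarefree
  monomial of degree \<open>n - k\<close>. Either \<open>x_j\<close> is absent from the latter,
  giving a hook with exponent \<open>Suc k\<close>, or it is present and the exponent rises by
  one.\<close>

lemma coeff_power_sum_mult_elem_sym:
  assumes "k \<le> n"
  shows "coeff_bdps (psi (Suc k) (elem_sym (Suc 0)) * elem_sym (n - k)) h =
     hook_count (Suc n) (Suc k) h + hook_count (Suc n) (Suc (Suc k)) h"
proof -
  let ?s = "\<lambda>j. Poly_Mapping.single j (Suc k) :: monom"
  define J where "J = {j. Suc k \<le> lookup h j \<and> squarefree_monom (n - k) (h - ?s j)}"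
  define g where "g j = (?s j, h - ?s j)" for j
  have split: "?s j + (h - ?s j) = h" if "Suc k \<le> lookup h j" for j
    using that by (intro poly_mapping_eqI) (auto simp: lookup_add lookup_minus lookup_single when_def)
  have inj: "inj_on g J"
    unfolding g_def inj_on_def by (metis Pair_inject Suc_neq_Zero keys_single singleton_inject)
  have finJ: "finite J"
    by (rule finite_subset[of _ "keys h"]) (auto simp: J_def in_keys_iff)
  let ?t = "\<lambda>(a, b). coeff_bdps (psi (Suc k) (elem_sym (Suc 0))) a * coeff_bdps (elem_sym (n - k)) b"
  have "coeff_bdps (psi (Suc k) (elem_sym (Suc 0)) * elem_sym (n - k)) h = sum ?t (splits h)"
    by (rule coeff_mult)
  also have "\<dots> = sum ?t (g ` J)"
  proof (rule sum.mono_neutral_right[OF finite_splits])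
    show "g ` J \<subseteq> splits h" using split by (auto simp: g_def J_def splits_def)
    show "\<forall>p\<in>splits h - g ` J. ?t p = 0"
    proof
      fix p assume p: "p \<in> splits h - g ` J"
      obtain a b where ab: "p = (a, b)" by (cases p)
      have h: "h = a + b" using p by (simp add: ab splits_def)
      have "\<not> squarefree_monom (n - k) b" if a: "a = ?s j" for j
      proof
        assume sq: "squarefree_monom (n - k) b"
        have b: "b = h - ?s j" by (simp add: h a)
        have "Suc k \<le> lookup h j" by (simp add: h a lookup_add)
        then have "p = g j \<and> j \<in> J" using sq by (simp add: ab g_def J_def a b[symmetric])
        then show False using p by blast
      qed
      then show "?t p = 0" by (auto simp: ab coeff_psi_elem_sym_1 coeff_elem_sym)
    qed
  qed
  also have "\<dots> = (\<Sum>j\<in>J. 1)"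
    unfolding sum.reindex[OF inj] o_def
  proof (rule sum.cong[OF refl])
    fix j assume "j \<in> J"
    then have "squarefree_monom (n - k) (h - ?s j)" "\<exists>i. ?s j = ?s i" by (auto simp: J_def)
    then show "?t (g j) = 1" by (simp add: g_def coeff_psi_elem_sym_1 coeff_elem_sym)
  qed
  also have "\<dots> = of_nat (card J)" by simp
  also have "J = hook_set (Suc n) (Suc k) h \<union> hook_set (Suc n) (Suc (Suc k)) h"
  proof (rule set_eqI)
    fix j
    let ?b = "h - ?s j"
    have off: "(\<forall>i. lookup ?b i \<le> 1) \<longleftrightarrow>
        lookup h j \<le> Suc (Suc k) \<and> (\<forall>i. i \<noteq> j \<longrightarrow> lookup h i \<le> 1)"
      by (auto simp: lookup_minus lookup_single when_def le_diff_conv)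
    have keys: "keys ?b = keys h - {j} \<union> (if lookup h j > Suc k then {j} else {})"
      by (auto simp: in_keys_iff lookup_minus lookup_single when_def split: if_splits)
    have card: "card (keys ?b) = card (keys h - {j}) + (if lookup h j > Suc k then 1 else 0)"
      unfolding keys by (subst card_Un_disjoint) auto
    define P where "P \<longleftrightarrow> (\<forall>i. i \<noteq> j \<longrightarrow> lookup h i \<le> 1)"
    have "squarefree_monom (n - k) ?b \<longleftrightarrow> lookup h j \<le> Suc (Suc k) \<and> P \<and>
        card (keys h - {j}) + (if lookup h j > Suc k then 1 else 0) = n - k"
      unfolding squarefree_monom_def P_def using off card by metis
    then have J: "j \<in> J \<longleftrightarrow> Suc k \<le> lookup h j \<and> lookup h j \<le> Suc (Suc k) \<and> P \<and>
        card (keys h - {j}) + (if lookup h j > Suc k then 1 else 0) = n - k"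
      by (simp add: J_def)
    have H: "j \<in> hook_set (Suc n) i h \<longleftrightarrow>
        lookup h j = i \<and> P \<and> card (keys h - {j}) + i = Suc n" for i
      by (simp add: hook_set_def P_def)
    show "j \<in> J \<longleftrightarrow> j \<in> hook_set (Suc n) (Suc k) h \<union> hook_set (Suc n) (Suc (Suc k)) h"
      unfolding Un_iff J H using assms by (cases "Suc k < lookup h j") auto
  qed
  also have "card \<dots> = card (hook_set (Suc n) (Suc k) h) + card (hook_set (Suc n) (Suc (Suc k)) h)"
    by (rule card_Un_disjoint[OF finite_hook_set finite_hook_set]) (auto simp: hook_set_def)
  finally show ?thesis by (simp add: hook_count_def)
qed

text \<open>In a squarefree monomial each of the \<open>Suc n\<close> variables can serve as the
  distinguished one.\<close>

lemma hook_count_1: "hook_count (Suc n) (Suc 0) h = of_nat (Suc n) * coeff_bdps (elem_sym (Suc n)) h"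
proof (cases "squarefree_monom (Suc n) h")
  case True
  then have le: "lookup h i \<le> 1" for i by (simp add: squarefree_monom_def)
  have "hook_set (Suc n) (Suc 0) h = keys h"
  proof (intro equalityI subsetI)
    fix j assume j: "j \<in> keys h"
    then have "lookup h j = 1" using le[of j] by (simp add: in_keys_iff)
    then show "j \<in> hook_set (Suc n) (Suc 0) h" using True j le
      by (auto simp: hook_set_def squarefree_monom_def)
  qed (auto simp: hook_set_def in_keys_iff)
  then show ?thesis using True by (simp add: hook_count_def coeff_elem_sym squarefree_monom_def)
next
  case False
  have "j \<notin> hook_set (Suc n) (Suc 0) h" for j
  proof
    assume j: "j \<in> hook_set (Suc n) (Suc 0) h"
    then have jk: "j \<in> keys h" by (simp add: hook_set_def in_keys_iff)
    have "lookup h i \<le> 1" for i using j by (cases "i = j") (auto simp: hook_set_def)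
    moreover have "card (keys h) = Suc n"
      using j card.remove[OF finite_keys jk] by (simp add: hook_set_def)
    ultimately show False using False by (simp add: squarefree_monom_def)
  qed
  then have "hook_set (Suc n) (Suc 0) h = {}" by blast
  then show ?thesis using False by (simp add: hook_count_def coeff_elem_sym)
qed

text \<open>The alternating sum of neighbouring hook counts telescopes. The last count vanishes
  since its exponent \<open>n + 2\<close> exceeds the total degree \<open>n + 1\<close>. The result
  has the shape of the recursion for \<open>lambda_op\<close>, with the power sums as Adams images
  of \<open>elem_sym 1\<close>.\<close>

lemma newton_elem_sym:
  "of_nat (Suc n) * elem_sym (Suc n) =
     (\<Sum>k\<le>n. const_bdps ((-1) ^ k) * psi (Suc k) (elem_sym (Suc 0)) * elem_sym (n - k))"
proof (rule bdps_eqI)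
  fix h
  let ?A = "\<lambda>k. hook_count (Suc n) (Suc k) h"
  have tel: "(\<Sum>k\<le>m. (-1) ^ k * (?A k + ?A (Suc k))) = ?A 0 + (-1) ^ m * ?A (Suc m)" for m
    by (induction m) (auto simp: algebra_simps)
  have "hook_set (Suc n) (Suc (Suc n)) h = {}" by (auto simp: hook_set_def)
  then have last: "?A (Suc n) = 0" by (simp add: hook_count_def)
  have "coeff_bdps (\<Sum>k\<le>n. const_bdps ((-1) ^ k) * psi (Suc k) (elem_sym (Suc 0)) * elem_sym (n - k)) h
      = (\<Sum>k\<le>n. (-1) ^ k * (?A k + ?A (Suc k)))"
    unfolding coeff_sum mult.assoc coeff_const_mult
    by (intro sum.cong refl) (simp add: coeff_power_sum_mult_elem_sym)
  also have "\<dots> = ?A 0" using tel[of n] last by simp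
  finally show "coeff_bdps (of_nat (Suc n) * elem_sym (Suc n)) h = coeff_bdps
      (\<Sum>k\<le>n. const_bdps ((-1) ^ k) * psi (Suc k) (elem_sym (Suc 0)) * elem_sym (n - k)) h"
    using hook_count_1[of n h] by (simp only: coeff_of_nat_mult)
qed

lemma lambda_op_elem_sym_1: "lambda_op n (elem_sym (Suc 0)) = elem_sym n"
proof (induction n rule: less_induct)
  case (less n)
  show ?case
  proof (cases n)
    case 0
    then show ?thesis by (simp add: lambda_op_0 elem_sym_0)
  next
    case (Suc m)
    have IH: "lambda_op (m - k) (elem_sym (Suc 0)) = elem_sym (m - k)" for k
      using less[of "m - k"] by (simp add: Suc)
    have "of_nat n * lambda_op n (elem_sym (Suc 0)) = of_nat n * elem_sym n"
      unfolding Suc lambda_op_Suc newton_elem_sym IH ..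
    then show ?thesis using of_nat_bdps_cancel[of n] Suc by blast
  qed
qed

text \<open>The difference is the sum of the monomials with one squared variable and
  \<open>n - 1\<close> simple ones. After substituting monomials this becomes the statement that the
  error terms have shorter words.\<close>

lemma elem_sym_1_mult_keys:
  assumes "coeff_bdps (elem_sym (Suc 0) * elem_sym n - of_nat (Suc n) * elem_sym (Suc n)) h \<noteq> 0"
  shows "card (keys h) \<le> n"
proof -
  have "coeff_bdps (elem_sym (Suc 0) * elem_sym n - of_nat (Suc n) * elem_sym (Suc n)) h
      = hook_count (Suc n) (Suc (Suc 0)) h"
    using coeff_power_sum_mult_elem_sym[of 0 n h] hook_count_1[of n h]
    by (simp add: coeff_minus psi_1_elem_sym_1 del: of_nat_Suc)
  then have "hook_set (Suc n) (Suc (Suc 0)) h \<noteq> {}" using assms by (auto simp: hook_count_def)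
  then obtain j where j: "j \<in> hook_set (Suc n) (Suc (Suc 0)) h" by blast
  then have jk: "j \<in> keys h" by (simp add: hook_set_def in_keys_iff)
  show ?thesis using j card.remove[OF finite_keys jk] by (simp add: hook_set_def)
qed

subsection \<open>The fundamental theorem\<close>

inductive_set ring_closure :: "rat bdps set \<Rightarrow> rat bdps set" for G where
  closure_gen: "x \<in> G \<Longrightarrow> x \<in> ring_closure G"
| closure_of_int: "of_int z \<in> ring_closure G"
| closure_add: "x \<in> ring_closure G \<Longrightarrow> y \<in> ring_closure G \<Longrightarrow> x + y \<in> ring_closure G"
| closure_mult: "x \<in> ring_closure G \<Longrightarrow> y \<in> ring_closure G \<Longrightarrow> x * y \<in> ring_closure G"

lemma closure_0: "0 \<in> ring_closure G" and closure_1: "1 \<in> ring_closure G"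
  using closure_of_int[of 0 G] closure_of_int[of 1 G] by simp_all

lemma closure_uminus: "x \<in> ring_closure G \<Longrightarrow> - x \<in> ring_closure G"
  using closure_mult[OF closure_of_int[of "-1" G]] by fastforce

lemma closure_diff: "x \<in> ring_closure G \<Longrightarrow> y \<in> ring_closure G \<Longrightarrow> x - y \<in> ring_closure G"
  using closure_add[OF _ closure_uminus] by fastforce

lemma closure_sum: "(\<And>i. i \<in> A \<Longrightarrow> F i \<in> ring_closure G) \<Longrightarrow> sum F A \<in> ring_closure G"
  by (induction A rule: infinite_finite_induct) (auto intro: closure_0 closure_add)

lemma closure_prod: "(\<And>i. i \<in> A \<Longrightarrow> F i \<in> ring_closure G) \<Longrightarrow> prod F A \<in> ring_closure G"
  by (induction A rule: infinite_finite_induct) (auto intro: closure_1 closure_mult)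

lemma closure_hom:
  assumes "bdps_hom T" "x \<in> ring_closure G" "\<And>g. g \<in> G \<Longrightarrow> T g \<in> ring_closure H"
  shows "T x \<in> ring_closure H"
  using assms(2)
  by induction
    (auto simp: assms(3) hom_of_int[OF assms(1)] hom_add[OF assms(1)] hom_mult[OF assms(1)]
      intro: ring_closure.intros)

section \<open>Series invariant under all permutations of the variables\<close>

definition symmetric_bdps :: "rat bdps \<Rightarrow> bool" where
  "symmetric_bdps f \<longleftrightarrow> (\<forall>\<pi>. bij \<pi> \<longrightarrow> restrict_vars \<pi> f = f)"

lemma symmetric_bdps_coeff:
  "symmetric_bdps f \<Longrightarrow> bij \<pi> \<Longrightarrow> coeff_bdps f (rename_monom \<pi> h) = coeff_bdps f h"
  unfolding symmetric_bdps_def by (metis coeff_restrict_vars)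

lemma symmetric_bdpsI:
  "(\<And>\<pi> h. bij \<pi> \<Longrightarrow> coeff_bdps f (rename_monom \<pi> h) = coeff_bdps f h) \<Longrightarrow> symmetric_bdps f"
  unfolding symmetric_bdps_def by (auto intro!: bdps_eqI simp: coeff_restrict_vars)

lemma symmetric_bdps_arith:
  "symmetric_bdps (of_int z)" "symmetric_bdps f \<Longrightarrow> symmetric_bdps (- f)"
  "symmetric_bdps f \<Longrightarrow> symmetric_bdps g \<Longrightarrow> symmetric_bdps (f + g)"
  "symmetric_bdps f \<Longrightarrow> symmetric_bdps g \<Longrightarrow> symmetric_bdps (f * g)"
  unfolding symmetric_bdps_def
  by (blast intro: restrict_vars_fixed_arith bij_is_inj)+

lemma symmetric_bdps_diff:
  "symmetric_bdps f \<Longrightarrow> symmetric_bdps g \<Longrightarrow> symmetric_bdps (f - g)"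
  using symmetric_bdps_arith(3)[OF _ symmetric_bdps_arith(2)] by fastforce

lemma symmetric_elem_sym: "symmetric_bdps (elem_sym n)"
proof (rule symmetric_bdpsI)
  fix \<pi> :: "nat \<Rightarrow> nat" and h assume \<pi>: "bij \<pi>"
  note inj = bij_is_inj[OF \<pi>]
  have "(\<forall>i. lookup (rename_monom \<pi> h) i \<le> 1) \<longleftrightarrow> (\<forall>i. lookup h i \<le> 1)"
  proof (intro iffI allI)
    show "lookup h i \<le> 1" if "\<forall>i. lookup (rename_monom \<pi> h) i \<le> 1" for i
      using that lookup_rename_monom(1)[OF inj, of h i] by metis
    show "lookup (rename_monom \<pi> h) i \<le> 1" if "\<forall>i. lookup h i \<le> 1" for i
      using that lookup_rename_monom[OF inj, where \<mu> = h] by (cases "i \<in> range \<pi>") auto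
  qed
  moreover have "card (keys (rename_monom \<pi> h)) = card (keys h)"
    using inj by (simp add: keys_rename_monom card_image inj_on_subset)
  ultimately show "coeff_bdps (elem_sym n) (rename_monom \<pi> h) = coeff_bdps (elem_sym n) h"
    by (simp add: coeff_elem_sym squarefree_monom_def)
qed

lemma integral_elem_sym: "integral_coeffs (elem_sym n)"
  by (simp add: integral_coeffs_def coeff_elem_sym)

text \<open>The bijection is an involution exchanging \<open>S - S'\<close> and
  \<open>S' - S\<close> and fixing everything else, so it also fixes every monomial supported in
  both sets.\<close>

lemma exists_swap:
  fixes S S' :: "nat set"
  assumes "finite S" "finite S'" "card S = card S'"
  shows "\<exists>\<pi>. bij \<pi> \<and> \<pi> ` S = S' \<and> (\<forall>x\<in>S \<inter> S'. \<pi> x = x)"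
proof -
  have "card (S - S') = card (S' - S)" using assms
    by (metis Int_commute add_diff_cancel_right' card_Diff_subset_Int finite_Int)
  then obtain b where b: "bij_betw b (S - S') (S' - S)"
    using assms finite_same_card_bij[of "S - S'" "S' - S"] by auto
  define b' where "b' = inv_into (S - S') b"
  have b': "bij_betw b' (S' - S) (S - S')" unfolding b'_def by (rule bij_betw_inv_into[OF b])
  define \<pi> where "\<pi> x = (if x \<in> S - S' then b x else if x \<in> S' - S then b' x else x)" for x
  have bx: "b x \<in> S' - S" "b' (b x) = x" if "x \<in> S - S'" for x
    using b that by (auto simp: b'_def bij_betw_def inv_into_f_f)
  have b'x: "b' x \<in> S - S'" "b (b' x) = x" if "x \<in> S' - S" for x
    using b b' that by (auto simp: b'_def bij_betw_def f_inv_into_f)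
  have inv: "\<pi> (\<pi> x) = x" for x
    using bx[of x] b'x[of x] by (auto simp: \<pi>_def)
  then have "bij \<pi>" by (rule involuntory_imp_bij)
  moreover have "\<pi> ` S = S'"
  proof (intro equalityI subsetI)
    show "y \<in> S'" if "y \<in> \<pi> ` S" for y using that bx by (auto simp: \<pi>_def)
    show "y \<in> \<pi> ` S" if "y \<in> S'" for y
    proof (rule image_eqI[of _ _ "\<pi> y"])
      show "y = \<pi> (\<pi> y)" by (simp add: inv)
      show "\<pi> y \<in> S" using that b'x[of y] by (auto simp: \<pi>_def)
    qed
  qed
  ultimately show ?thesis by (intro exI[of _ \<pi>]) (auto simp: \<pi>_def)
qed

lemma rename_indicator_monom:
  assumes "inj \<pi>" "finite S"
  shows "rename_monom \<pi> (indicator_monom S) = indicator_monom (\<pi> ` S)"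
  using assms by (intro rename_monom_eqI) (auto simp: inj_image_mem_iff)

lemma symmetric_coeff_indicator:
  assumes "symmetric_bdps f" "finite S" "finite S'" "card S = card S'" "keys h \<subseteq> S" "keys h \<subseteq> S'"
  shows "coeff_bdps f (h + indicator_monom S) = coeff_bdps f (h + indicator_monom S')"
proof -
  obtain \<pi> where \<pi>: "bij \<pi>" "\<pi> ` S = S'" "\<forall>x\<in>S \<inter> S'. \<pi> x = x"
    using exists_swap assms by meson
  note inj = bij_is_inj[OF \<pi>(1)]
  have "lookup h (\<pi> i) = lookup h i" for i
  proof (cases "i \<in> keys h \<or> \<pi> i \<in> keys h")
    case True
    then have "\<pi> i = i"
    proof
      assume "\<pi> i \<in> keys h"
      then have "\<pi> (\<pi> i) = \<pi> i" using \<pi>(3) assms by blast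
      then show ?thesis using inj by (simp add: inj_eq)
    qed (use \<pi>(3) assms in blast)
    then show ?thesis by simp
  qed (simp add: in_keys_iff)
  moreover have "j \<in> range \<pi>" for j using \<pi>(1) by (simp add: bij_is_surj)
  ultimately have "rename_monom \<pi> h = h" using inj by (intro rename_monom_eqI) auto
  then have "rename_monom \<pi> (h + indicator_monom S) = h + indicator_monom S'"
    using inj assms \<pi> by (simp add: rename_monom_add rename_indicator_monom)
  then show ?thesis using symmetric_bdps_coeff[OF assms(1) \<pi>(1)] by metis
qed

text \<open>If no monomial of \<open>f\<close> involves fewer than \<open>l\<close> variables, then subtracting a suitable multiple
  of \<open>e\<^sub>l\<close> removes those with exactly \<open>l\<close> variables.\<close>

lemma elem_sym_quotient:
  assumes "symmetric_bdps f" "integral_coeffs f" "\<forall>h. coeff_bdps f h \<noteq> 0 \<longrightarrow> mdeg h \<le> d"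
  obtains g where "symmetric_bdps g" "integral_coeffs g"
    "\<forall>h. coeff_bdps g h \<noteq> 0 \<longrightarrow> mdeg h + l \<le> d"
    "\<And>h. card (keys h) < l \<Longrightarrow> coeff_bdps (elem_sym l * g) h = 0"
    "\<And>h. card (keys h) = l \<Longrightarrow> coeff_bdps (elem_sym l * g) h = coeff_bdps f h"
proof -
  define S where "S h = (SOME S. finite S \<and> keys h \<subseteq> S \<and> card S = l)" for h :: monom
  have S: "finite (S h)" "keys h \<subseteq> S h" "card (S h) = l" if "card (keys h) \<le> l" for h
  proof -
    obtain B where "finite B" "card B = l - card (keys h)" "B \<subseteq> - keys h"
      using infinite_arbitrarily_large[of "- keys h" "l - card (keys h)"] by auto
    then have "finite (keys h \<union> B) \<and> keys h \<subseteq> keys h \<union> B \<and> card (keys h \<union> B) = l"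
      using that by (subst card_Un_disjoint) auto
    then have "finite (S h) \<and> keys h \<subseteq> S h \<and> card (S h) = l" unfolding S_def by (rule someI)
    then show "finite (S h)" "keys h \<subseteq> S h" "card (S h) = l" by auto
  qed
  \<comment> \<open>The coefficient of \<open>g\<close> at \<open>h\<close> is that of
    \<open>f\<close> at \<open>h\<close> times \<open>l\<close> distinct variables covering those of
    \<open>h\<close>; by symmetry the choice of these variables is immaterial.\<close>
  define g where "g = Abs_bdps
    (\<lambda>h. if card (keys h) \<le> l then coeff_bdps f (h + indicator_monom (S h)) else 0)"
  have deg: "mdeg h + l \<le> d"
    if "(if card (keys h) \<le> l then coeff_bdps f (h + indicator_monom (S h)) else 0) \<noteq> 0" for h
    using that assms(3) S(3)[of h] by (auto simp: mdeg_add split: if_splits dest!: spec)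
  then have "mdeg h \<le> d"
    if "(if card (keys h) \<le> l then coeff_bdps f (h + indicator_monom (S h)) else 0) \<noteq> 0" for h
    using that by fastforce
  then have "coeff_bdps g = (\<lambda>h. if card (keys h) \<le> l then coeff_bdps f (h + indicator_monom (S h)) else 0)"
    unfolding g_def by (rule coeff_Abs_bdps)
  then have g: "coeff_bdps g h = (if card (keys h) \<le> l then coeff_bdps f (h + indicator_monom (S h)) else 0)"
    for h by simp
  have indep: "coeff_bdps f (h + indicator_monom (S h)) = coeff_bdps f (h + indicator_monom K)"
    if "finite K" "keys h \<subseteq> K" "card K = l" for h K
  proof -
    have "card (keys h) \<le> l" using that card_mono by blast
    then show ?thesis using S that by (intro symmetric_coeff_indicator assms) auto
  qed
  show thesis
  proof (rule that[of g])
    show "symmetric_bdps g"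
    proof (rule symmetric_bdpsI)
      fix \<pi> :: "nat \<Rightarrow> nat" and h assume \<pi>: "bij \<pi>"
      note inj = bij_is_inj[OF \<pi>]
      have card: "card (keys (rename_monom \<pi> h)) = card (keys h)"
        using inj by (simp add: keys_rename_monom card_image inj_on_subset)
      show "coeff_bdps g (rename_monom \<pi> h) = coeff_bdps g h"
      proof (cases "card (keys h) \<le> l")
        case True
        note Sh = S[OF True]
        have "coeff_bdps f (rename_monom \<pi> h + indicator_monom (S (rename_monom \<pi> h)))
            = coeff_bdps f (rename_monom \<pi> h + indicator_monom (\<pi> ` S h))"
          using inj Sh by (intro indep) (auto simp: keys_rename_monom card_image inj_on_subset)
        also have "\<dots> = coeff_bdps f (rename_monom \<pi> (h + indicator_monom (S h)))"
          using inj Sh by (simp add: rename_monom_add rename_indicator_monom)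
        also have "\<dots> = coeff_bdps f (h + indicator_monom (S h))"
          by (rule symmetric_bdps_coeff[OF assms(1) \<pi>])
        finally show ?thesis using True by (simp add: g card)
      qed (simp add: g card)
    qed
    show "integral_coeffs g" using assms(2) by (simp add: integral_coeffs_def g)
    show "\<forall>h. coeff_bdps g h \<noteq> 0 \<longrightarrow> mdeg h + l \<le> d" using deg by (simp only: g) blast
  next
    fix h
    \<comment> \<open>A squarefree divisor of degree \<open>l\<close> uses \<open>l\<close>
      variables of \<open>h\<close>. If \<open>h\<close> has exactly \<open>l\<close>, the divisor
      is the product of all of them, so the coefficient of the product is a single term.\<close>
    have *: "card (keys h) \<ge> l \<and> (card (keys h) = l \<longrightarrow> a = indicator_monom (keys h))"
      if ab: "a + b = h" and a: "coeff_bdps (elem_sym l) a \<noteq> 0" for a b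
    proof -
      have sq: "squarefree_monom l a" using a by (auto simp: coeff_elem_sym split: if_splits)
      have sub: "keys a \<subseteq> keys h" using ab by (auto simp: in_keys_iff lookup_add)
      have "keys a = keys h" if "card (keys h) = l"
        using sub that sq by (intro card_subset_eq) (auto simp: squarefree_monom_def)
      moreover have "l \<le> card (keys h)"
        using sub sq card_mono[OF finite_keys sub] by (simp add: squarefree_monom_def)
      ultimately show ?thesis using squarefree_monom_eq[OF sq] by auto
    qed
    show "coeff_bdps (elem_sym l * g) h = 0" if lt: "card (keys h) < l"
    proof (rule ccontr)
      assume "coeff_bdps (elem_sym l * g) h \<noteq> 0"
      then obtain a b where "a + b = h" "coeff_bdps (elem_sym l) a \<noteq> 0"
        by (rule coeff_mult_nonzeroE)
      then show False using *[of a b] lt by simp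
    qed
    show "coeff_bdps (elem_sym l * g) h = coeff_bdps f h" if eq: "card (keys h) = l"
    proof -
      let ?i = "indicator_monom (keys h)"
      have ih: "?i + (h - ?i) = h"
        by (rule poly_mapping_eqI) (auto simp: lookup_add lookup_minus in_keys_iff)
      have sub: "keys (h - ?i) \<subseteq> keys h" by (auto simp: in_keys_iff lookup_minus)
      have "coeff_bdps (elem_sym l * g) h
          = (\<Sum>(a, b)\<in>{(?i, h - ?i)}. coeff_bdps (elem_sym l) a * coeff_bdps g b)"
        unfolding coeff_mult
      proof (rule sum.mono_neutral_right[OF finite_splits])
        show "{(?i, h - ?i)} \<subseteq> splits h" using ih by (simp add: splits_def)
        show "\<forall>p\<in>splits h - {(?i, h - ?i)}.
            (case p of (a, b) \<Rightarrow> coeff_bdps (elem_sym l) a * coeff_bdps g b) = 0"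
        proof
          fix p assume p: "p \<in> splits h - {(?i, h - ?i)}"
          obtain a b where ab: "p = (a, b)" by (cases p)
          have s: "a + b = h" using p by (simp add: ab splits_def)
          have "a \<noteq> ?i"
          proof
            assume a: "a = ?i"
            then have "b = h - ?i" using s by (metis add_diff_cancel_left')
            then show False using p by (simp add: ab a)
          qed
          then have "coeff_bdps (elem_sym l) a = 0" using *[OF s] eq by blast
          then show "(case p of (a, b) \<Rightarrow> coeff_bdps (elem_sym l) a * coeff_bdps g b) = 0"
            by (simp add: ab)
        qed
      qed
      also have "\<dots> = coeff_bdps g (h - ?i)"
        using eq by (simp add: coeff_elem_sym squarefree_monom_def)
      also have "\<dots> = coeff_bdps f (h - ?i + indicator_monom (S (h - ?i)))"
        using card_mono[OF finite_keys sub] eq by (simp add: g)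
      also have "\<dots> = coeff_bdps f (h - ?i + ?i)"
        using sub eq by (intro indep) auto
      also have "h - ?i + ?i = h" using ih by (simp add: add.commute)
      finally show ?thesis .
    qed
  qed
qed

text \<open>Outer induction on the degree bound \<open>d\<close>, inner induction on
  \<open>m\<close>, where every monomial has at least \<open>Suc d - m\<close> variables. For
  \<open>m = 0\<close> this exceeds the degree, so the series vanishes. Otherwise the monomials with
  the least possible number \<open>l\<close> of variables are removed by subtracting a constant if
  \<open>l = 0\<close>, and \<open>elem_sym l * g\<close> if not; here \<open>g\<close> has smaller
  degree and is settled by the outer induction. Counting variables replaces the usual order on
  monomials.\<close>

theorem symmetric_in_closure:
  assumes "symmetric_bdps f" "integral_coeffs f"
  shows "f \<in> ring_closure (elem_sym ` {1..})"
proof -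
  obtain d where "\<forall>h. coeff_bdps f h \<noteq> 0 \<longrightarrow> mdeg h \<le> d" using coeff_degree_bound by blast
  then show ?thesis using assms
  proof (induction d arbitrary: f rule: less_induct)
    case (less d)
    have "f \<in> ring_closure (elem_sym ` {1..})"
      if "m \<le> Suc d" "symmetric_bdps f" "integral_coeffs f"
        "\<forall>h. coeff_bdps f h \<noteq> 0 \<longrightarrow> mdeg h \<le> d"
        "\<forall>h. coeff_bdps f h \<noteq> 0 \<longrightarrow> Suc d \<le> card (keys h) + m" for m f
      using that
    proof (induction m arbitrary: f)
      case 0
      have "coeff_bdps f h = 0" for h
        using 0(4,5) card_keys_le_mdeg[of h] by (metis add_0_right le_trans not_less_eq_eq)
      then have "f = 0" by (intro bdps_eqI) (simp add: coeff_simps)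
      then show ?case by (simp add: closure_0)
    next
      case (Suc m)
      define l where "l = d - m"
      have l: "l + m = d" using Suc.prems(1) by (simp add: l_def)
      have low: "l \<le> card (keys h)" if "coeff_bdps f h \<noteq> 0" for h
        using Suc.prems(5) that l by fastforce
      show ?case
      proof (cases "l = 0")
        case True
        obtain z where z: "coeff_bdps f 0 = of_int z"
          using Suc.prems(3) by (auto simp: integral_coeffs_def elim: Ints_cases)
        let ?f = "f - of_int z"
        have c: "coeff_bdps ?f h = (if h = 0 then 0 else coeff_bdps f h)" for h
          by (simp add: coeff_minus of_int_bdps const_bdps.rep_eq z)
        have "?f \<in> ring_closure (elem_sym ` {1..})"
        proof (rule Suc.IH)
          show "\<forall>h. coeff_bdps ?f h \<noteq> 0 \<longrightarrow> Suc d \<le> card (keys h) + m"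
          proof (intro allI impI)
            fix h assume "coeff_bdps ?f h \<noteq> 0"
            then have "h \<noteq> 0" by (auto simp: c)
            then have "card (keys h) \<ge> 1" by (simp add: Suc_le_eq card_gt_0_iff)
            then show "Suc d \<le> card (keys h) + m" using l True by simp
          qed
          show "\<forall>h. coeff_bdps ?f h \<noteq> 0 \<longrightarrow> mdeg h \<le> d" using Suc.prems(4) by (simp add: c)
        qed (use Suc.prems in \<open>auto intro: symmetric_bdps_diff symmetric_bdps_arith integral_coeffs_arith\<close>)
        then have "?f + of_int z \<in> ring_closure (elem_sym ` {1..})"
          by (intro closure_add closure_of_int)
        then show ?thesis by simp
      next
        case False
        obtain g where g: "symmetric_bdps g" "integral_coeffs g"
          "\<forall>h. coeff_bdps g h \<noteq> 0 \<longrightarrow> mdeg h + l \<le> d"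
          "\<And>h. card (keys h) < l \<Longrightarrow> coeff_bdps (elem_sym l * g) h = 0"
          "\<And>h. card (keys h) = l \<Longrightarrow> coeff_bdps (elem_sym l * g) h = coeff_bdps f h"
          using elem_sym_quotient[OF Suc.prems(2,3,4), of l] by metis
        have "\<forall>h. coeff_bdps g h \<noteq> 0 \<longrightarrow> mdeg h \<le> d - l" using g(3) by fastforce
        moreover have "d - l < d" using False l by simp
        ultimately have gc: "g \<in> ring_closure (elem_sym ` {1..})"
          using less.IH g(1,2) by blast
        have eg: "elem_sym l * g \<in> ring_closure (elem_sym ` {1..})"
          using False by (intro closure_mult gc closure_gen) auto
        have deg: "mdeg h \<le> d" if nz: "coeff_bdps (elem_sym l * g) h \<noteq> 0" for h
        proof -
          obtain a b where ab: "a + b = h" "coeff_bdps (elem_sym l) a \<noteq> 0" "coeff_bdps g b \<noteq> 0"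
            using nz by (rule coeff_mult_nonzeroE)
          then have "squarefree_monom l a" by (auto simp: coeff_elem_sym split: if_splits)
          then have "mdeg a = l"
            by (metis squarefree_monom_eq squarefree_monom_def mdeg_indicator_monom)
          then show ?thesis using g(3) ab by (auto simp: mdeg_add)
        qed
        let ?f = "f - elem_sym l * g"
        have "?f \<in> ring_closure (elem_sym ` {1..})"
        proof (rule Suc.IH)
          show "\<forall>h. coeff_bdps ?f h \<noteq> 0 \<longrightarrow> Suc d \<le> card (keys h) + m"
          proof (intro allI impI)
            fix h assume nz: "coeff_bdps ?f h \<noteq> 0"
            have "\<not> card (keys h) < l" using nz low[of h] g(4)[of h] by (auto simp: coeff_minus)
            moreover have "card (keys h) \<noteq> l" using nz g(5)[of h] by (auto simp: coeff_minus)
            ultimately show "Suc d \<le> card (keys h) + m" using l by simp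
          qed
          show "\<forall>h. coeff_bdps ?f h \<noteq> 0 \<longrightarrow> mdeg h \<le> d"
            using Suc.prems(4) deg by (metis coeff_minus diff_0_right)
        qed (use Suc.prems g in \<open>auto intro: symmetric_bdps_diff symmetric_bdps_arith
            integral_coeffs_arith integral_coeffs_mult symmetric_elem_sym integral_elem_sym\<close>)
        then have "?f + elem_sym l * g \<in> ring_closure (elem_sym ` {1..})"
          by (intro closure_add eg)
        then show ?thesis by simp
      qed
    qed
    from this[of "Suc d" f] show ?case using less.prems by simp
  qed
qed

section \<open>The generators as elementary symmetric functions of monomials\<close>

lemma pow_monom_0_left [simp]: "pow_monom 0 \<mu> = 0"
  by (rule poly_mapping_eqI) (simp add: lookup_pow_monom)

lemma pow_monom_1_left [simp]: "pow_monom (Suc 0) \<mu> = \<mu>"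
  by (rule poly_mapping_eqI) (simp add: lookup_pow_monom)

lemma pow_monom_add_left: "pow_monom (a + b) \<mu> = pow_monom a \<mu> + pow_monom b \<mu>"
  by (rule poly_mapping_eqI) (simp add: lookup_pow_monom lookup_add distrib_right)

definition monom_subst :: "(nat \<Rightarrow> monom) \<Rightarrow> monom \<Rightarrow> monom" where
  "monom_subst X h = (\<Sum>j\<in>keys h. pow_monom (lookup h j) (X j))"

lemma monom_subst_superset:
  assumes "finite A" "keys h \<subseteq> A"
  shows "monom_subst X h = (\<Sum>j\<in>A. pow_monom (lookup h j) (X j))"
  unfolding monom_subst_def using assms
  by (intro sum.mono_neutral_left) (auto simp: in_keys_iff)

lemma monom_subst_add: "monom_subst X (a + b) = monom_subst X a + monom_subst X b"
proof -
  let ?A = "keys a \<union> keys b"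
  have "keys (a + b) \<subseteq> ?A" by (rule Poly_Mapping.keys_add)
  then show ?thesis
    by (simp add: monom_subst_superset[of ?A] lookup_add pow_monom_add_left sum.distrib)
qed

lemma monom_subst_single: "monom_subst X (Poly_Mapping.single j (Suc 0)) = X j"
  by (simp add: monom_subst_def)

text \<open>Only the finitely many \<open>X j\<close> dividing \<open>\<mu>\<close> can occur in a
  preimage of \<open>\<mu>\<close>. The common positive degree \<open>N\<close> bounds the exponents
  by the degree of \<open>\<mu>\<close>.\<close>

lemma substitution_monom_subst:
  assumes "inj X" "\<And>j. mdeg (X j) = N" "N \<ge> 1"
  shows "substitution (monom_subst X)"
proof -
  have deg: "mdeg (monom_subst X h) = N * mdeg h" for h
    unfolding monom_subst_def mdeg_sum mdeg_pow_monom assms(2)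
    by (simp add: mdeg_def sum_distrib_left mult.commute)
  have "finite {h. monom_subst X h = \<mu>}" for \<mu>
  proof -
    \<comment> \<open>The first components of the splits of \<open>\<mu>\<close> are its divisors,
      so \<open>J\<close> indexes the \<open>X j\<close> dividing \<open>\<mu>\<close>.\<close>
    define J where "J = X -` (fst ` splits \<mu>)"
    have finJ: "finite J" unfolding J_def using assms(1) by (intro finite_vimageI) auto
    \<comment> \<open>A common multiple of all possible preimages, which are then found among its
      finitely many divisors.\<close>
    define top where "top = (\<Sum>j\<in>J. Poly_Mapping.single j (mdeg \<mu>))"
    have ltop: "lookup top j = (if j \<in> J then mdeg \<mu> else 0)" for j
      using finJ by (simp add: top_def lookup_sum lookup_single when_def)
    have "h \<in> fst ` splits top" if h: "monom_subst X h = \<mu>" for h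
    proof -
      have "lookup h j \<le> mdeg h" for j
        using member_le_sum[of j "keys h" "lookup h"]
        by (cases "j \<in> keys h") (auto simp: mdeg_def in_keys_iff)
      moreover have "mdeg h \<le> mdeg \<mu>" using deg[of h] h assms(3) by simp
      ultimately have le: "lookup h j \<le> mdeg \<mu>" for j by (meson le_trans)
      have "j \<in> J" if j: "j \<in> keys h" for j
      proof -
        obtain k where k: "lookup h j = Suc k" using j by (metis in_keys_iff not0_implies_Suc)
        have "\<mu> = pow_monom (Suc k) (X j) + (\<Sum>i\<in>keys h - {j}. pow_monom (lookup h i) (X i))"
          using j h by (simp add: monom_subst_def sum.remove k)
        also have "\<dots> = X j + (pow_monom k (X j) + (\<Sum>i\<in>keys h - {j}. pow_monom (lookup h i) (X i)))"
          using pow_monom_add_left[of "Suc 0" k "X j"] by (simp add: add.assoc)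
        finally show ?thesis unfolding J_def splits_def by force
      qed
      then have "h + (top - h) = top"
        using le by (intro poly_mapping_eqI) (auto simp: lookup_add lookup_minus ltop in_keys_iff)
      then show ?thesis by (force simp: splits_def)
    qed
    then have "{h. monom_subst X h = \<mu>} \<subseteq> fst ` splits top" by blast
    then show ?thesis by (rule finite_subset) simp
  qed
  then show ?thesis unfolding substitution_def using deg monom_subst_add by (metis order_refl)
qed

text \<open>The substitution replaces the variables by an enumeration \<open>X\<close> of the
  monomials with word \<open>\<alpha>\<close>. Each \<open>X j\<close> involves
  \<open>length \<alpha>\<close> variables, and the resulting bound turns variable counts of
  symmetric functions into bounds on the lengths of words.\<close>

lemma monomial_qsym_substitution:
  assumes "is_composition \<alpha>" "\<alpha> \<noteq> []"
  obtains \<phi> where "substitution \<phi>" "monomial_qsym \<alpha> = substitute \<phi> (elem_sym (Suc 0))"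
    "\<And>h. card (keys (\<phi> h)) \<le> card (keys h) * length \<alpha>"
proof -
  define W where "W = {\<mu>. word_of \<mu> = \<alpha>}"
  have "W \<subseteq> (\<lambda>js. word_monom js \<alpha>) ` UNIV"
    using word_monom_keys unfolding W_def by (metis (mono_tags, lifting) mem_Collect_eq rangeI subsetI)
  then have count: "countable W" by (rule countable_subset) auto
  \<comment> \<open>Shifted copies of one monomial show that \<open>W\<close> is infinite, as a
    bijection with the set of all variables demands.\<close>
  define r where "r k = word_monom [k..<k + length \<alpha>] \<alpha>" for k
  have r: "keys (r k) = {k..<k + length \<alpha>}" "r k \<in> W" for k
    using word_monom_word_of[OF assms(1), of "[k..<k + length \<alpha>]"]
    by (simp_all add: r_def W_def strict_sorted_iff)
  have "inj r"
  proof (rule injI)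
    fix k l assume "r k = r l"
    then have "{k..<k + length \<alpha>} = {l..<l + length \<alpha>}" using r(1) by metis
    then show "k = l" using assms(2) by (simp add: atLeastLessThan_eq_iff)
  qed
  then have "infinite (range r)" by (rule range_inj_infinite)
  then have "infinite W" using r(2) by (meson finite_subset image_subsetI)
  with count obtain e :: "monom \<Rightarrow> nat" where e: "bij_betw e W UNIV" by (rule countableE_infinite)
  define X where "X = inv_into W e"
  have X: "bij_betw X UNIV W" unfolding X_def by (rule bij_betw_inv_into[OF e])
  then have inj: "inj X" and ran: "range X = W" by (auto simp: bij_betw_def)
  have wX: "word_of (X j) = \<alpha>" for j using ran by (auto simp: W_def)
  have degX: "mdeg (X j) = sum_list \<alpha>" for j using sum_list_word_of[of "X j"] wX by simp
  have "sum_list \<alpha> \<ge> 1"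
    using assms by (cases \<alpha>) (auto simp: is_composition_def)
  then have sub: "substitution (monom_subst X)"
    using inj degX by (intro substitution_monom_subst[of X "sum_list \<alpha>"]) auto
  show thesis
  proof (rule that[OF sub])
    show "monomial_qsym \<alpha> = substitute (monom_subst X) (elem_sym (Suc 0))"
    proof (rule bdps_eqI)
      fix \<mu>
      have fin: "finite {h. monom_subst X h = \<mu>}" using sub by (simp add: substitution_def)
      have "coeff_bdps (substitute (monom_subst X) (elem_sym (Suc 0))) \<mu>
          = (\<Sum>h | monom_subst X h = \<mu>. if \<exists>j. h = Poly_Mapping.single j 1 then 1 else 0)"
        by (simp add: coeff_substitute[OF sub] coeff_elem_sym squarefree_monom_1)
      also have "\<dots> = (if word_of \<mu> = \<alpha> then 1 else 0)"
      proof (cases "word_of \<mu> = \<alpha>")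
        case True
        then have "\<mu> \<in> range X" unfolding ran W_def by simp
        then obtain j where j: "X j = \<mu>" by blast
        let ?s = "Poly_Mapping.single j 1 :: monom"
        have "i = j" if "X i = \<mu>" for i using inj j that by (auto dest: injD)
        then have eq: "(if \<exists>i. h = Poly_Mapping.single i 1 then 1 else 0) = (if h = ?s then 1 else 0 :: rat)"
          if "h \<in> {h. monom_subst X h = \<mu>}" for h
          using that by (auto simp: monom_subst_single)
        have "(\<Sum>h | monom_subst X h = \<mu>. if \<exists>j. h = Poly_Mapping.single j 1 then 1 else 0)
            = (\<Sum>h | monom_subst X h = \<mu>. if h = ?s then 1 else 0 :: rat)"
          by (rule sum.cong[OF refl eq])
        also have "\<dots> = 1" using fin j by (simp add: monom_subst_single)
        finally show ?thesis using True by simp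
      next
        case False
        have "(\<Sum>h | monom_subst X h = \<mu>. if \<exists>j. h = Poly_Mapping.single j 1 then 1 else 0) = (0 :: rat)"
        proof (rule sum.neutral, rule ballI)
          fix h assume "h \<in> {h. monom_subst X h = \<mu>}"
          then have "h \<noteq> Poly_Mapping.single j 1" for j
            using False wX[of j] by (auto simp: monom_subst_single)
          then show "(if \<exists>j. h = Poly_Mapping.single j 1 then 1 else 0) = (0 :: rat)" by simp
        qed
        then show ?thesis using False by simp
      qed
      finally show "coeff_bdps (monomial_qsym \<alpha>) \<mu>
          = coeff_bdps (substitute (monom_subst X) (elem_sym (Suc 0))) \<mu>"
        by (simp add: coeff_monomial_qsym[OF assms(1)])
    qed
    fix h
    have "keys (monom_subst X h) \<subseteq> (\<Union>j\<in>keys h. keys (X j))"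
    proof
      fix i assume i: "i \<in> keys (monom_subst X h)"
      show "i \<in> (\<Union>j\<in>keys h. keys (X j))"
      proof (rule ccontr)
        assume "i \<notin> (\<Union>j\<in>keys h. keys (X j))"
        then have "lookup (X j) i = 0" if "j \<in> keys h" for j using that by (auto simp: in_keys_iff)
        then have "lookup (monom_subst X h) i = 0"
          by (simp add: monom_subst_def lookup_sum lookup_pow_monom)
        then show False using i by (simp add: in_keys_iff)
      qed
    qed
    then have "card (keys (monom_subst X h)) \<le> card (\<Union>j\<in>keys h. keys (X j))"
      by (intro card_mono) auto
    also have "\<dots> \<le> (\<Sum>j\<in>keys h. card (keys (X j)))" by (rule card_UN_le) simp
    also have "\<dots> = card (keys h) * length \<alpha>"
      using wX length_word_of by (metis (no_types, lifting) sum.cong sum_constant of_nat_id)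
    finally show "card (keys (monom_subst X h)) \<le> card (keys h) * length \<alpha>" .
  qed
qed

section \<open>Integrality and length bounds for the generators\<close>

lemma integral_coeffs_substitute:
  assumes "substitution \<phi>" "integral_coeffs f"
  shows "integral_coeffs (substitute \<phi> f)"
  using assms by (auto simp: integral_coeffs_def coeff_substitute intro!: Ints_sum)

definition max_length :: "rat bdps \<Rightarrow> nat \<Rightarrow> bool" where
  "max_length f n \<longleftrightarrow> (\<forall>\<mu>. coeff_bdps f \<mu> \<noteq> 0 \<longrightarrow> card (keys \<mu>) \<le> n)"

lemma max_length_substitute:
  assumes "substitution \<phi>" "\<And>h. card (keys (\<phi> h)) \<le> card (keys h) * l" "max_length f n"
  shows "max_length (substitute \<phi> f) (n * l)"
  unfolding max_length_def
proof (intro allI impI)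
  fix \<mu> assume "coeff_bdps (substitute \<phi> f) \<mu> \<noteq> 0"
  then obtain h where "\<phi> h = \<mu>" "coeff_bdps f h \<noteq> 0"
    unfolding coeff_substitute[OF assms(1)]
    by (metis (mono_tags, lifting) mem_Collect_eq sum.not_neutral_contains_not_neutral)
  then show "card (keys \<mu>) \<le> n * l"
    using assms(2)[of h] assms(3) unfolding max_length_def by (metis le_trans mult_le_mono1)
qed

lemma max_length_mult:
  assumes "max_length f n" "max_length g m"
  shows "max_length (f * g) (n + m)"
  unfolding max_length_def
proof (intro allI impI)
  fix \<mu> assume "coeff_bdps (f * g) \<mu> \<noteq> 0"
  then obtain a b where ab: "a + b = \<mu>" "coeff_bdps f a \<noteq> 0" "coeff_bdps g b \<noteq> 0"
    by (rule coeff_mult_nonzeroE)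
  have "card (keys \<mu>) \<le> card (keys a \<union> keys b)"
    unfolding ab(1)[symmetric] by (intro card_mono Poly_Mapping.keys_add) auto
  also have "\<dots> \<le> card (keys a) + card (keys b)" by (rule card_Un_le)
  also have "\<dots> \<le> n + m" using ab assms by (intro add_mono) (auto simp: max_length_def)
  finally show "card (keys \<mu>) \<le> n + m" .
qed

lemma max_length_1: "max_length 1 0"
  by (auto simp: max_length_def coeff_simps)

lemma max_length_prod:
  assumes "finite A" "\<And>b. b \<in> A \<Longrightarrow> max_length (f b) (n b)"
  shows "max_length (prod f A) (sum n A)"
  using assms by (induction A) (auto simp: max_length_1 max_length_mult)

lemma e_op_0 [simp]: "e_op 0 \<alpha> = 1"
  by (simp add: e_op_def lambda_op_0)

context
  fixes \<alpha> :: "nat list"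
  assumes comp: "is_composition \<alpha>" and ne: "\<alpha> \<noteq> []"
begin

text \<open>Integrality comes from the substitution into \<open>elem_sym n\<close>, quasisymmetry
  from the invariance of \<open>lambda_op\<close> under relabelling; neither description shows
  both.\<close>

lemma e_op_in_QSymm: "e_op n \<alpha> \<in> QSymm"
proof -
  obtain \<phi> where \<phi>: "substitution \<phi>" "monomial_qsym \<alpha> = substitute \<phi> (elem_sym (Suc 0))"
    using monomial_qsym_substitution[OF comp ne] by blast
  have "e_op n \<alpha> = substitute \<phi> (elem_sym n)"
    by (simp add: e_op_def \<phi>(2) hom_lambda_op[OF bdps_hom_substitute[OF \<phi>(1)], symmetric]
        lambda_op_elem_sym_1)
  then have "integral_coeffs (e_op n \<alpha>)"
    using \<phi>(1) by (simp add: integral_coeffs_substitute integral_elem_sym)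
  moreover have "quasisymmetric (e_op n \<alpha>)"
    using monomial_qsym_in_QSymm[OF comp] by (simp add: e_op_def QSymm_iff quasisymmetric_arith)
  ultimately show ?thesis by (simp add: QSymm_iff)
qed

text \<open>All three are images under \<open>\<phi>\<close> of facts on elementary symmetric
  functions. In the last one, \<open>psi k\<close> commutes with \<open>\<phi>\<close> and
  \<open>psi k (elem_sym n)\<close> is symmetric with integer coefficients, so the fundamental
  theorem applies before substituting.\<close>

lemma max_length_e_op: "max_length (e_op n \<alpha>) (n * length \<alpha>)"
  and max_length_e_op_step:
    "max_length (monomial_qsym \<alpha> * e_op n \<alpha> - of_nat (Suc n) * e_op (Suc n) \<alpha>) (n * length \<alpha>)"
  and e_op_scaled: "k \<ge> 1 \<Longrightarrow> e_op n (map ((*) k) \<alpha>) \<in> ring_closure ((\<lambda>i. e_op i \<alpha>) ` {1..})"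
proof -
  obtain \<phi> where \<phi>: "substitution \<phi>" "monomial_qsym \<alpha> = substitute \<phi> (elem_sym (Suc 0))"
    "\<And>h. card (keys (\<phi> h)) \<le> card (keys h) * length \<alpha>"
    using monomial_qsym_substitution[OF comp ne] by blast
  note hom = bdps_hom_substitute[OF \<phi>(1)]
  have e: "e_op n \<alpha> = substitute \<phi> (elem_sym n)" for n
    by (simp add: e_op_def \<phi>(2) hom_lambda_op[OF hom, symmetric] lambda_op_elem_sym_1)
  have "max_length (elem_sym n) n"
    by (auto simp: max_length_def coeff_elem_sym squarefree_monom_def split: if_splits)
  then show "max_length (e_op n \<alpha>) (n * length \<alpha>)"
    unfolding e using \<phi> by (intro max_length_substitute)
  have nat: "substitute \<phi> (of_nat i) = of_nat i" for i
    using hom_of_int[OF hom, of "int i"] by simp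
  have "substitute \<phi> (f - g) = substitute \<phi> f - substitute \<phi> g" for f g
    using hom_add[OF hom, of f "- g"] by (simp add: hom_uminus[OF hom])
  then have "monomial_qsym \<alpha> * e_op n \<alpha> - of_nat (Suc n) * e_op (Suc n) \<alpha>
      = substitute \<phi> (elem_sym (Suc 0) * elem_sym n - of_nat (Suc n) * elem_sym (Suc n))"
    by (simp only: e \<phi>(2) hom_mult[OF hom] nat)
  moreover have "max_length (elem_sym (Suc 0) * elem_sym n - of_nat (Suc n) * elem_sym (Suc n)) n"
    unfolding max_length_def using elem_sym_1_mult_keys by blast
  ultimately show "max_length (monomial_qsym \<alpha> * e_op n \<alpha> - of_nat (Suc n) * e_op (Suc n) \<alpha>)
      (n * length \<alpha>)"
    using \<phi> by (simp only: max_length_substitute)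
  show "e_op n (map ((*) k) \<alpha>) \<in> ring_closure ((\<lambda>i. e_op i \<alpha>) ` {1..})" if k: "k \<ge> 1"
  proof -
    have "e_op n (map ((*) k) \<alpha>) = psi k (e_op n \<alpha>)"
      by (simp add: e_op_def psi_monomial_qsym[OF k, symmetric] hom_lambda_op[OF bdps_hom_psi[OF k]])
    also have "\<dots> = substitute \<phi> (psi k (elem_sym n))"
      by (simp add: e hom_psi[OF hom k])
    finally have eq: "e_op n (map ((*) k) \<alpha>) = substitute \<phi> (psi k (elem_sym n))" .
    have "symmetric_bdps (psi k (elem_sym n))"
      using symmetric_elem_sym[of n] hom_psi[OF bdps_hom_restrict_vars k]
      unfolding symmetric_bdps_def by (metis bij_is_inj)
    moreover have "integral_coeffs (psi k (elem_sym n))"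
      unfolding psi_eq_substitute(2)[OF k]
      by (intro integral_coeffs_substitute psi_eq_substitute(1)[OF k] integral_elem_sym)
    ultimately have "psi k (elem_sym n) \<in> ring_closure (elem_sym ` {1..})"
      by (rule symmetric_in_closure)
    then show ?thesis
      unfolding eq by (rule closure_hom[OF hom]) (auto simp: e[symmetric] intro: closure_gen)
  qed
qed

end

section \<open>Leading words\<close>

lemma word_of_single_add:
  assumes "c > 0" "\<forall>i\<in>keys \<mu>. k < i"
  shows "word_of (Poly_Mapping.single k c + \<mu>) = c # word_of \<mu>"
proof -
  have k: "lookup \<mu> k = 0" using assms(2) by (metis in_keys_iff less_irrefl)
  have keys: "keys (Poly_Mapping.single k c + \<mu>) = insert k (keys \<mu>)"
    using assms(1) by (auto simp: in_keys_iff lookup_add lookup_single when_def split: if_splits)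
  have "word_of (Poly_Mapping.single k c + \<mu>)
      = map (lookup (Poly_Mapping.single k c + \<mu>)) (k # sorted_list_of_set (keys \<mu>))"
    using assms(2) keys by (intro word_of_eq) auto
  also have "\<dots> = c # word_of \<mu>"
    using assms(2) k by (auto simp: word_of_def lookup_add lookup_single when_def)
  finally show ?thesis .
qed

lemma word_of_ConsE:
  assumes "word_of \<mu> = c # u"
  obtains k \<mu>' where "\<mu> = Poly_Mapping.single k c + \<mu>'" "c > 0" "\<forall>i\<in>keys \<mu>'. k < i"
    "word_of \<mu>' = u" "k \<in> keys \<mu>"
proof -
  obtain k js where js: "sorted_list_of_set (keys \<mu>) = k # js" "c = lookup \<mu> k"
    using assms by (auto simp: word_of_def)
  have set: "set (k # js) = keys \<mu>" and sorted: "sorted_wrt (<) (k # js)"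
    unfolding js(1)[symmetric] by auto
  define \<mu>' where "\<mu>' = \<mu> - Poly_Mapping.single k c"
  have eq: "\<mu> = Poly_Mapping.single k c + \<mu>'"
    by (rule poly_mapping_eqI)
      (auto simp: \<mu>'_def lookup_add lookup_minus lookup_single when_def js(2))
  have keys: "i \<in> keys \<mu> \<and> i \<noteq> k" if "i \<in> keys \<mu>'" for i
    using that by (auto simp: \<mu>'_def in_keys_iff lookup_minus lookup_single when_def js(2) split: if_splits)
  have c: "c > 0" using set js(2) by (auto simp: in_keys_iff[symmetric] simp flip: neq0_conv)
  have gt: "\<forall>i\<in>keys \<mu>'. k < i" using keys set sorted by auto
  show thesis
    by (rule that[OF eq c gt]) (use word_of_single_add[OF c gt] eq assms set in auto)
qed

text \<open>When \<open>\<mu>\<close> has as many variables as the two words have letters, the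
  supports of \<open>p\<close> and \<open>q\<close> are disjoint and no parts merge. A splitting is
  then an interleaving, and removing the least variable of \<open>\<mu>\<close> matches the
  recursion of \<open>shuffle_count\<close>.\<close>

lemma card_splits_words:
  assumes "card (keys \<mu>) = length \<alpha> + length \<beta>"
  shows "card {(p, q). p + q = \<mu> \<and> word_of p = \<alpha> \<and> word_of q = \<beta>} = shuffle_count \<alpha> \<beta> (word_of \<mu>)"
  using assms
proof (induction \<alpha> \<beta> "word_of \<mu>" arbitrary: \<mu> rule: shuffle_count.induct)
  have nil: "p = 0 \<longleftrightarrow> word_of p = []" for p
    by (metis card_eq_0_iff finite_keys keys_eq_empty length_0_conv length_word_of word_of_0)
  {
    case (1 y)
    have "{(p, q). p + q = \<mu> \<and> word_of p = [] \<and> word_of q = y}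
        = {z. z = (0, \<mu>) \<and> word_of \<mu> = y}"
      unfolding nil[symmetric] by (rule set_eqI) (simp add: split_beta prod_eq_iff, metis add_0)
    then show ?case by simp
  next
    case (2 a x)
    have "{(p, q). p + q = \<mu> \<and> word_of p = a # x \<and> word_of q = []}
        = {z. z = (\<mu>, 0) \<and> word_of \<mu> = a # x}"
      unfolding nil[symmetric] by (rule set_eqI) (simp add: split_beta prod_eq_iff, metis add_0_right)
    then show ?case by simp
  next
    case (3 a x b y)
    then have "\<mu> = 0" using nil by metis
    then show ?case using 3 by simp
  next
    case (4 a x b y c u)
    obtain k \<mu>' where \<mu>: "\<mu> = Poly_Mapping.single k c + \<mu>'" and c: "c > 0"
      and gt: "\<forall>i\<in>keys \<mu>'. k < i" and u: "word_of \<mu>' = u" and k: "k \<in> keys \<mu>"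
      using word_of_ConsE[OF 4(3)[symmetric]] by metis
    let ?s = "Poly_Mapping.single k c :: monom"
    have k': "lookup \<mu>' k = 0" using gt by (metis in_keys_iff less_irrefl)
    have card': "card (keys \<mu>') + 1 = card (keys \<mu>)"
      using length_word_of[of \<mu>'] length_word_of[of \<mu>] by (simp only: u 4(3)[symmetric]) simp
    define P where "P = {(p, q). p + q = \<mu> \<and> word_of p = a # x \<and> word_of q = b # y}"
    define P1 where "P1 = {(p, q). p + q = \<mu>' \<and> word_of p = x \<and> word_of q = b # y}"
    define P2 where "P2 = {(p, q). p + q = \<mu>' \<and> word_of p = a # x \<and> word_of q = y}"
    define Q1 where "Q1 = (if c = a then (\<lambda>(p, q). (?s + p, q)) ` P1 else {})"
    define Q2 where "Q2 = (if c = b then (\<lambda>(p, q). (p, ?s + q)) ` P2 else {})"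
    have sub: "keys p \<subseteq> keys (p + q)" "keys q \<subseteq> keys (p + q)" for p q :: monom
      by (auto simp: in_keys_iff lookup_add)
    have word: "word_of (?s + p) = c # word_of p" if "keys p \<subseteq> keys \<mu>'" for p
      using that gt by (intro word_of_single_add[OF c]) auto
    \<comment> \<open>If the least variable \<open>k\<close> does not occur in \<open>t\<close>, its
      whole power belongs to \<open>r\<close>.\<close>
    have peel: "r = ?s + (r - ?s) \<and> (r - ?s) + t = \<mu>' \<and> word_of r = c # word_of (r - ?s)"
      if rt: "r + t = \<mu>" and kt: "k \<notin> keys t" for r t
    proof -
      have lk: "lookup r i + lookup t i = (c when k = i) + lookup \<mu>' i" for i
        using rt by (metis \<mu> lookup_add lookup_single)
      have tk: "lookup t k = 0" using kt by (simp add: in_keys_iff)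
      have rk: "lookup r k = c" using lk[of k] tk k' by simp
      have r: "r = ?s + (r - ?s)"
        by (rule poly_mapping_eqI) (auto simp: lookup_add lookup_minus lookup_single when_def rk)
      have r': "(r - ?s) + t = \<mu>'"
      proof (rule poly_mapping_eqI)
        fix i show "lookup ((r - ?s) + t) i = lookup \<mu>' i"
          using lk[of i] rk tk k' by (auto simp: lookup_add lookup_minus lookup_single when_def)
      qed
      show ?thesis using r r' word[of "r - ?s"] sub(1)[of "r - ?s" t] by auto
    qed
    have "P = Q1 \<union> Q2"
    proof (intro equalityI subsetI)
      fix z assume "z \<in> P"
      then obtain p q where z: "z = (p, q)" and pq: "p + q = \<mu>" "word_of p = a # x" "word_of q = b # y"
        by (auto simp: P_def)
      have "keys \<mu> = keys p \<union> keys q" unfolding pq(1)[symmetric]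
        by (auto simp: in_keys_iff lookup_add)
      moreover have "card (keys p) = length (a # x)" "card (keys q) = length (b # y)"
        using pq length_word_of by metis+
      ultimately have "card (keys p \<inter> keys q) = 0"
        using card_Un_Int[of "keys p" "keys q"] 4(4) by simp
      then have disj: "keys p \<inter> keys q = {}" by simp
      show "z \<in> Q1 \<union> Q2"
      proof (cases "k \<in> keys q")
        case False
        then have "z = (?s + (p - ?s), q)" "(p - ?s, q) \<in> P1" "c = a"
          using peel[of p q] pq by (auto simp: z P1_def)
        then show ?thesis by (auto simp: Q1_def)
      next
        case True
        then have "k \<notin> keys p" using disj by blast
        then have "z = (p, ?s + (q - ?s))" "(p, q - ?s) \<in> P2" "c = b"
          using peel[of q p] pq by (auto simp: z P2_def add.commute)
        then show ?thesis by (auto simp: Q2_def)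
      qed
    next
      fix z assume "z \<in> Q1 \<union> Q2"
      then consider p q where "c = a" "(p, q) \<in> P1" "z = (?s + p, q)"
        | p q where "c = b" "(p, q) \<in> P2" "z = (p, ?s + q)"
        by (auto simp: Q1_def Q2_def split: if_splits)
      then show "z \<in> P"
      proof cases
        case 1
        then have "keys p \<subseteq> keys \<mu>'" using sub(1)[of p q] by (auto simp: P1_def)
        then show ?thesis using 1 word[of p] by (auto simp: P_def P1_def \<mu> add.assoc)
      next
        case 2
        then have "keys q \<subseteq> keys \<mu>'" using sub(2)[of q p] by (auto simp: P2_def)
        then show ?thesis using 2 word[of q] by (auto simp: P_def P2_def \<mu> add.left_commute)
      qed
    qed
    moreover have "Q1 \<inter> Q2 = {}"
    proof -
      have "lookup p k = c" if pq: "(p, q) \<in> Q1" for p q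
      proof -
        obtain p' where p': "p = ?s + p'" "(p', q) \<in> P1" using pq by (auto simp: Q1_def split: if_splits)
        then have "lookup p' k + lookup q k = 0" using k' by (auto simp: P1_def lookup_add)
        then show ?thesis using p' by (simp add: lookup_add)
      qed
      moreover have "lookup p k = 0" if pq: "(p, q) \<in> Q2" for p q
      proof -
        obtain q' where "(p, q') \<in> P2" using pq by (auto simp: Q2_def split: if_splits)
        then have "lookup p k + lookup q' k = 0" using k' by (auto simp: P2_def lookup_add)
        then show ?thesis by simp
      qed
      ultimately show ?thesis using c by fastforce
    qed
    moreover have "P1 \<subseteq> splits \<mu>'" "P2 \<subseteq> splits \<mu>'"
      unfolding P1_def P2_def splits_def by blast+
    then have fin: "finite P1" "finite P2" using finite_splits finite_subset by blast+
    moreover have "finite Q1" "finite Q2" using fin by (auto simp: Q1_def Q2_def)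
    ultimately have "card P = card Q1 + card Q2" by (simp add: card_Un_disjoint)
    moreover have "card Q1 = (if c = a then shuffle_count x (b # y) u else 0)"
    proof (cases "c = a")
      case True
      have "inj_on (\<lambda>(p, q). (?s + p, q)) P1" by (auto simp: inj_on_def)
      then have "card Q1 = card P1" using True by (simp add: Q1_def card_image)
      also have "\<dots> = shuffle_count x (b # y) u"
        unfolding P1_def using 4(1)[OF True, of \<mu>'] 4(4) card' u by simp
      finally show ?thesis using True by simp
    qed (simp add: Q1_def)
    moreover have "card Q2 = (if c = b then shuffle_count (a # x) y u else 0)"
    proof (cases "c = b")
      case True
      have "inj_on (\<lambda>(p, q). (p, ?s + q)) P2" by (auto simp: inj_on_def)
      then have "card Q2 = card P2" using True by (simp add: Q2_def card_image)
      also have "\<dots> = shuffle_count (a # x) y u"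
        unfolding P2_def using 4(2)[OF True, of \<mu>'] 4(4) card' u by simp
      finally show ?thesis using True by simp
    qed (simp add: Q2_def)
    ultimately show ?case unfolding P_def by (simp add: 4(3)[symmetric])
  }
qed

lemma coeff_monomial_qsym_mult:
  assumes "is_composition \<alpha>" "is_composition \<beta>" "card (keys \<mu>) = length \<alpha> + length \<beta>"
  shows "coeff_bdps (monomial_qsym \<alpha> * monomial_qsym \<beta>) \<mu> = of_nat (shuffle_count \<alpha> \<beta> (word_of \<mu>))"
proof -
  define P where "P = {(p, q). p + q = \<mu> \<and> word_of p = \<alpha> \<and> word_of q = \<beta>}"
  have "coeff_bdps (monomial_qsym \<alpha> * monomial_qsym \<beta>) \<mu> = (\<Sum>z\<in>splits \<mu>. if z \<in> P then 1 else 0)"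
    unfolding coeff_mult
    by (rule sum.cong) (auto simp: coeff_monomial_qsym assms P_def splits_def split: if_splits)
  also have "\<dots> = of_nat (card (splits \<mu> \<inter> P))"
    by (simp add: sum.If_cases)
  also have "splits \<mu> \<inter> P = P" unfolding P_def splits_def by blast
  finally show ?thesis using card_splits_words[OF assms(3)] by (simp add: P_def)
qed

text \<open>All words of \<open>f\<close> are bounded by \<open>w\<close> in the order by length and
  then lexicographically; \<open>c\<close> is the coefficient at \<open>w\<close> and may be zero.
  The coefficient is prescribed at every monomial with word \<open>w\<close>, so quasisymmetry of
  \<open>f\<close> does not have to be carried along.\<close>

definition leads :: "rat bdps \<Rightarrow> nat list \<Rightarrow> rat \<Rightarrow> bool" where
  "leads f w c \<longleftrightarrow> (\<forall>\<mu>. coeff_bdps f \<mu> \<noteq> 0 \<longrightarrow>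
      card (keys \<mu>) < length w \<or> card (keys \<mu>) = length w \<and> word_of \<mu> \<le> w) \<and>
    (\<forall>\<mu>. word_of \<mu> = w \<longrightarrow> coeff_bdps f \<mu> = c)"

lemma leads_1: "leads 1 [] 1"
proof -
  have "\<mu> = 0" if "word_of \<mu> = []" for \<mu>
    using that by (metis card_eq_0_iff finite_keys keys_eq_empty length_0_conv length_word_of)
  then show ?thesis by (auto simp: leads_def coeff_simps)
qed

lemma lyndon_is_composition: "lyndon a \<Longrightarrow> is_composition a"
  by (simp add: lyndon_def)

lemma is_composition_concat_factors: "lyndon_factors ls \<Longrightarrow> is_composition (concat ls)"
  by (auto simp: lyndon_factors_def is_composition_def dest!: lyndon_is_composition)

text \<open>Overlapping supports give fewer variables than the leading word has letters. With
  disjoint supports the word is a shuffle of \<open>a\<close> with a word of \<open>f\<close>, and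
  the maximum is reached only through the leading word of \<open>f\<close>, with the multiplicity of
  the maximal shuffle.\<close>

lemma leads_mult:
  assumes fac: "lyndon_factors (a # ls)" and f: "leads f (concat ls) c"
  shows "leads (monomial_qsym a * f) (a @ concat ls) (of_nat (Suc (count (mset ls) a)) * c)"
proof -
  let ?w = "concat ls"
  have a: "is_composition a" "is_composition ?w"
    using fac is_composition_concat_factors[of ls]
    by (auto simp: lyndon_factors_Cons lyndon_is_composition)
  have key: "card (keys (p + q)) < length (a @ ?w) \<or>
      card (keys (p + q)) = length (a @ ?w) \<and> word_of (p + q) \<le> a @ ?w \<and>
      (word_of (p + q) = a @ ?w \<longrightarrow> word_of q = ?w)"
    if p: "word_of p = a" and q: "coeff_bdps f q \<noteq> 0" for p q
  proof -
    have lp: "card (keys p) = length a" using p length_word_of by metis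
    have lq: "card (keys q) \<le> length ?w" "card (keys q) = length ?w \<Longrightarrow> word_of q \<le> ?w"
      using f q unfolding leads_def by auto
    have le: "card (keys (p + q)) \<le> card (keys p) + card (keys q)"
      by (rule le_trans[OF card_mono[OF _ Poly_Mapping.keys_add] card_Un_le]) simp
    show ?thesis
    proof (cases "card (keys (p + q)) = length (a @ ?w)")
      case True
      then have q_len: "card (keys q) = length ?w" using le lp lq by simp
      have "card {(r, s). r + s = p + q \<and> word_of r = a \<and> word_of s = word_of q}
          = shuffle_count a (word_of q) (word_of (p + q))"
        using True q_len by (intro card_splits_words) auto
      moreover have "card {(r, s). r + s = p + q \<and> word_of r = a \<and> word_of s = word_of q} \<noteq> 0"
      proof -
        have "{(r, s). r + s = p + q \<and> word_of r = a \<and> word_of s = word_of q} \<subseteq> splits (p + q)"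
          unfolding splits_def by blast
        then have "finite {(r, s). r + s = p + q \<and> word_of r = a \<and> word_of s = word_of q}"
          using finite_splits finite_subset by blast
        then show ?thesis using p by (auto simp: card_eq_0_iff)
      qed
      ultimately have "word_of (p + q) \<in> shuffles a (word_of q)"
        using shuffle_count_pos by fastforce
      from lyndon_shuffle_le[OF fac _ lq(2)[OF q_len] this]
      show ?thesis using True q_len by auto
    qed (use le lp lq in simp)
  qed
  have nz: "card (keys \<mu>) < length (a @ ?w) \<or> card (keys \<mu>) = length (a @ ?w) \<and> word_of \<mu> \<le> a @ ?w"
    if "coeff_bdps (monomial_qsym a * f) \<mu> \<noteq> 0" for \<mu>
  proof -
    obtain p q where "p + q = \<mu>" "coeff_bdps (monomial_qsym a :: rat bdps) p \<noteq> 0" "coeff_bdps f q \<noteq> 0"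
      using \<open>coeff_bdps (monomial_qsym a * f) \<mu> \<noteq> 0\<close> by (rule coeff_mult_nonzeroE)
    then show ?thesis using key[of p q] by (auto simp: coeff_monomial_qsym[OF a(1)] split: if_splits)
  qed
  have "coeff_bdps (monomial_qsym a * f) \<mu> = of_nat (Suc (count (mset ls) a)) * c"
    if \<mu>: "word_of \<mu> = a @ ?w" for \<mu>
  proof -
    have len: "card (keys \<mu>) = length a + length ?w" using length_word_of[of \<mu>] \<mu> by simp
    \<comment> \<open>At a monomial with the maximal word, \<open>f\<close> can be replaced by
      \<open>c\<close> times the monomial quasisymmetric function of its leading word.\<close>
    have eq: "coeff_bdps (monomial_qsym a :: rat bdps) p * coeff_bdps f q
        = c * (coeff_bdps (monomial_qsym a) p * coeff_bdps (monomial_qsym ?w) q)"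
      if pq: "p + q = \<mu>" for p q
    proof (cases "word_of p = a \<and> coeff_bdps f q \<noteq> 0")
      case True
      then have "word_of q = ?w" using key[of p q] pq \<mu> len by auto
      moreover from this have "coeff_bdps f q = c" using f unfolding leads_def by blast
      ultimately show ?thesis using True by (simp add: coeff_monomial_qsym a)
    next
      case False
      have "c = 0" if "word_of q = ?w" "coeff_bdps f q = 0"
        using f that unfolding leads_def by metis
      then show ?thesis using False by (auto simp: coeff_monomial_qsym a)
    qed
    have "coeff_bdps (monomial_qsym a * f) \<mu>
        = (\<Sum>(p, q)\<in>splits \<mu>. c * (coeff_bdps (monomial_qsym a) p * coeff_bdps (monomial_qsym ?w) q))"
      unfolding coeff_mult using eq by (intro sum.cong) (auto simp: splits_def)
    also have "\<dots> = c * coeff_bdps (monomial_qsym a * monomial_qsym ?w) \<mu>"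
      by (simp add: coeff_mult sum_distrib_left split_def)
    also have "\<dots> = c * of_nat (Suc (count (mset ls) a))"
      using lyndon_shuffle_max[OF fac] by (simp add: coeff_monomial_qsym_mult[OF a len] \<mu>)
    finally show ?thesis by (simp add: mult.commute)
  qed
  then show ?thesis using nz unfolding leads_def by blast
qed

lemma leads_prod_list:
  assumes "lyndon_factors ls"
  shows "\<exists>c. c \<noteq> 0 \<and> leads (prod_list (map monomial_qsym ls)) (concat ls) c"
  using assms
proof (induction ls)
  case Nil
  then show ?case using leads_1 by (intro exI[of _ 1]) simp
next
  case (Cons a ls)
  then obtain c where "c \<noteq> 0" "leads (prod_list (map monomial_qsym ls)) (concat ls) c"
    by (auto simp: lyndon_factors_Cons)
  then show ?case
    using leads_mult[OF Cons.prems]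
    by (intro exI[of _ "of_nat (Suc (count (mset ls) a)) * c"]) (auto simp del: of_nat_Suc)
qed

definition e_prod :: "nat list list \<Rightarrow> rat bdps" where
  "e_prod ls = (\<Prod>b\<in>set ls. e_op (count (mset ls) b) b)"

lemma length_concat_count:
  "length (concat ls) = (\<Sum>b\<in>set ls. count (mset ls) b * length b)"
  by (simp add: length_concat sum_list_map_eq_sum_count count_mset)

text \<open>Up to shorter words, \<open>M\<^sub>a e\<^sub>r(a) = (r + 1) e\<^bsub>r+1\<^esub>(a)\<close>.\<close>

lemma leads_e_prod:
  assumes "lyndon_factors ls"
  shows "leads (e_prod ls) (concat ls) 1"
  using assms
proof (induction ls)
  case Nil
  then show ?case using leads_1 by (simp add: e_prod_def)
next
  case (Cons a ls)
  define r where "r = count (mset ls) a"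
  define R where "R = (\<Prod>b\<in>set ls - {a}. e_op (count (mset ls) b) b)"
  have lyn: "lyndon b" if "b \<in> set (a # ls)" for b
    using that Cons.prems by (auto simp: lyndon_factors_def)
  have comp: "is_composition b" "b \<noteq> []" if "b \<in> set (a # ls)" for b
    using lyn[OF that] by (auto simp: lyndon_def)
  have ls: "e_prod ls = e_op r a * R"
  proof (cases "a \<in> set ls")
    case True
    then show ?thesis by (simp add: e_prod_def R_def r_def prod.remove)
  next
    case False
    then have "r = 0" by (simp add: r_def count_eq_zero_iff)
    then show ?thesis using False by (simp add: e_prod_def R_def)
  qed
  have "e_prod (a # ls) = e_op (Suc r) a * (\<Prod>b\<in>set ls - {a}. e_op (count (mset (a # ls)) b) b)"
    by (simp add: e_prod_def r_def prod.insert_remove)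
  also have "(\<Prod>b\<in>set ls - {a}. e_op (count (mset (a # ls)) b) b) = R"
    unfolding R_def by (intro prod.cong) auto
  finally have als: "e_prod (a # ls) = e_op (Suc r) a * R" .
  \<comment> \<open>The error in trading \<open>e_op (Suc r) a\<close> for \<open>e_op r a\<close>;
    its words have length at most \<open>r * length a\<close>, one copy of \<open>a\<close>
    short.\<close>
  define D where "D = monomial_qsym a * e_op r a - of_nat (Suc r) * e_op (Suc r) a"
  have "max_length R (\<Sum>b\<in>set ls - {a}. count (mset ls) b * length b)"
    unfolding R_def using comp by (intro max_length_prod max_length_e_op) auto
  moreover have "max_length D (r * length a)"
    unfolding D_def using comp by (intro max_length_e_op_step) auto
  ultimately have DR: "max_length (D * R) (r * length a + (\<Sum>b\<in>set ls - {a}. count (mset ls) b * length b))"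
    by (intro max_length_mult)
  have "r * length a + (\<Sum>b\<in>set ls - {a}. count (mset ls) b * length b) = length (concat ls)"
  proof (cases "a \<in> set ls")
    case True
    then show ?thesis by (simp add: length_concat_count r_def sum.remove)
  next
    case False
    then have "r = 0" by (simp add: r_def count_eq_zero_iff)
    then show ?thesis using False by (simp add: length_concat_count)
  qed
  then have DR: "max_length (D * R) (length (concat ls))" using DR by (simp only:)
  have short: "card (keys \<mu>) < length (a @ concat ls)" if nz: "coeff_bdps (D * R) \<mu> \<noteq> 0" for \<mu>
  proof -
    have "card (keys \<mu>) \<le> length (concat ls)" using DR nz unfolding max_length_def by blast
    moreover have "length a > 0" using comp[of a] by simp
    ultimately show ?thesis unfolding length_append by linarith
  qed
  \<comment> \<open>The factor \<open>Suc r\<close> on the left equals the shuffle multiplicity of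
    \<open>a\<close> on the right, so the leading coefficient comes out as 1.\<close>
  have "of_nat (Suc r) * e_prod (a # ls) = monomial_qsym a * e_prod ls - D * R"
    by (simp only: D_def als ls algebra_simps)
  then have "coeff_bdps (of_nat (Suc r) * e_prod (a # ls)) \<mu>
      = coeff_bdps (monomial_qsym a * e_prod ls) \<mu> - coeff_bdps (D * R) \<mu>" for \<mu>
    by (simp only: coeff_minus)
  then have co: "of_nat (Suc r) * coeff_bdps (e_prod (a # ls)) \<mu>
      = coeff_bdps (monomial_qsym a * e_prod ls) \<mu> - coeff_bdps (D * R) \<mu>" for \<mu>
    by (simp only: coeff_of_nat_mult)
  have lead: "leads (monomial_qsym a * e_prod ls) (a @ concat ls) (of_nat (Suc r) * 1)"
    unfolding r_def using Cons by (intro leads_mult) (auto simp: lyndon_factors_Cons)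
  show ?case
    unfolding leads_def
  proof (intro conjI allI impI)
    fix \<mu> assume "coeff_bdps (e_prod (a # ls)) \<mu> \<noteq> 0"
    then have "of_nat (Suc r) * coeff_bdps (e_prod (a # ls)) \<mu> \<noteq> 0" by (simp del: of_nat_Suc)
    then have "coeff_bdps (monomial_qsym a * e_prod ls) \<mu> \<noteq> 0 \<or> coeff_bdps (D * R) \<mu> \<noteq> 0"
      unfolding co by auto
    then show "card (keys \<mu>) < length (concat (a # ls)) \<or>
        card (keys \<mu>) = length (concat (a # ls)) \<and> word_of \<mu> \<le> concat (a # ls)"
      using lead short[of \<mu>] unfolding leads_def by auto
  next
    fix \<mu> assume \<mu>: "word_of \<mu> = concat (a # ls)"
    then have "card (keys \<mu>) = length (a @ concat ls)" using length_word_of[of \<mu>] by simp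
    then have "coeff_bdps (D * R) \<mu> = 0" using short[of \<mu>] by auto
    moreover have "coeff_bdps (monomial_qsym a * e_prod ls) \<mu> = of_nat (Suc r)"
      using lead \<mu> unfolding leads_def by simp
    ultimately have "of_nat (Suc r) * coeff_bdps (e_prod (a # ls)) \<mu> = of_nat (Suc r)"
      unfolding co by simp
    then show "coeff_bdps (e_prod (a # ls)) \<mu> = 1" by (simp del: of_nat_Suc)
  qed
qed

section \<open>Generation\<close>

lemma map_mult_less_iff:
  "k \<ge> 1 \<Longrightarrow> map ((*) k) xs < map ((*) k) ys \<longleftrightarrow> xs < ys" for k :: nat and xs ys :: "nat list"
proof (induction xs arbitrary: ys)
  case Nil
  then show ?case by (cases ys) auto
next
  case (Cons x xs)
  then show ?case by (cases ys) auto
qed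

lemma lyndon_iff:
  "lyndon a \<longleftrightarrow> is_composition a \<and> a \<noteq> [] \<and> (\<forall>p s. a = p @ s \<longrightarrow> p \<noteq> [] \<longrightarrow> s \<noteq> [] \<longrightarrow> a < s)"
  unfolding lyndon_def less_list_iff_lexord[symmetric] strict_suffix_def suffix_def
  by (metis append_self_conv2 self_append_conv2)

lemma lyndon_map_mult_iff:
  assumes "k \<ge> 1"
  shows "lyndon (map ((*) k) a) \<longleftrightarrow> lyndon a"
proof -
  have "is_composition (map ((*) k) a) \<longleftrightarrow> is_composition a"
    using assms by (auto simp: is_composition_def)
  moreover have "(\<forall>p s. map ((*) k) a = p @ s \<longrightarrow> p \<noteq> [] \<longrightarrow> s \<noteq> [] \<longrightarrow> map ((*) k) a < s) \<longleftrightarrow>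
      (\<forall>p s. a = p @ s \<longrightarrow> p \<noteq> [] \<longrightarrow> s \<noteq> [] \<longrightarrow> a < s)"
  proof (intro iffI allI impI)
    fix p s assume "\<forall>p s. map ((*) k) a = p @ s \<longrightarrow> p \<noteq> [] \<longrightarrow> s \<noteq> [] \<longrightarrow> map ((*) k) a < s"
      and a: "a = p @ s" "p \<noteq> []" "s \<noteq> []"
    then have "map ((*) k) a < map ((*) k) s" by (metis map_append map_is_Nil_conv)
    then show "a < s" using map_mult_less_iff[OF assms] by blast
  next
    fix p s assume *: "\<forall>p s. a = p @ s \<longrightarrow> p \<noteq> [] \<longrightarrow> s \<noteq> [] \<longrightarrow> a < s"
      and ps: "map ((*) k) a = p @ s" "p \<noteq> []" "s \<noteq> []"
    then obtain p' s' where s': "a = p' @ s'" "map ((*) k) p' = p" "map ((*) k) s' = s"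
      by (auto simp: map_eq_append_conv)
    then have "a < s'" using * ps by (metis list.map_disc_iff)
    then show "map ((*) k) a < s" unfolding s'(3)[symmetric] map_mult_less_iff[OF assms] .
  qed
  ultimately show ?thesis by (simp add: lyndon_iff)
qed

text \<open>A bijection from \<open>gen_index\<close> onto the Lyndon compositions: the inverse
  divides by the greatest common divisor of the parts, which is recovered as the first
  component.\<close>

definition scaled :: "nat \<times> nat list \<Rightarrow> nat list" where
  "scaled i = map ((*) (fst i)) (snd i)"

lemma lyndon_eq_scaled:
  assumes "lyndon a"
  shows "\<exists>i\<in>gen_index. a = scaled i"
proof -
  define g where "g = Gcd (set a)"
  obtain x where x: "x \<in> set a" "x > 0"
    using assms by (cases a) (auto simp: lyndon_def is_composition_def)
  then have "g \<noteq> 0" unfolding g_def by (auto simp: Gcd_0_iff)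
  define \<alpha> where "\<alpha> = map (\<lambda>x. x div g) a"
  have a: "a = map ((*) g) \<alpha>"
    unfolding \<alpha>_def map_map by (rule sym, rule map_idI) (simp add: g_def)
  have "g = g * Gcd (set \<alpha>)"
    using Gcd_mult[of g "set \<alpha>"] by (simp add: g_def[symmetric] a[symmetric] flip: set_map)
  then have "Gcd (set \<alpha>) = 1" using \<open>g \<noteq> 0\<close> by simp
  moreover have "lyndon \<alpha>" using assms \<open>g \<noteq> 0\<close> by (simp add: a lyndon_map_mult_iff)
  ultimately have "(g, \<alpha>) \<in> gen_index"
    using \<open>g \<noteq> 0\<close> by (simp add: gen_index_def elementary_lyndon_def)
  then show ?thesis by (rule bexI[rotated]) (simp add: scaled_def a)
qed

lemma inj_on_scaled: "inj_on scaled gen_index"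
proof (rule inj_onI)
  fix i j assume ij: "i \<in> gen_index" "j \<in> gen_index" "scaled i = scaled j"
  have g: "Gcd (set (scaled i)) = fst i" if "i \<in> gen_index" for i
    using that Gcd_mult[of "fst i" "set (snd i)"]
    by (auto simp: gen_index_def elementary_lyndon_def scaled_def)
  have n: "fst i = fst j" using g[OF ij(1)] g[OF ij(2)] ij(3) by simp
  moreover have "fst j \<noteq> 0" using ij by (auto simp: gen_index_def)
  ultimately have "snd i = snd j" using ij(3) by (simp add: scaled_def inj_map_eq_map inj_def)
  then show "i = j" using n by (simp add: prod_eq_iff)
qed

abbreviation gen_elem :: "nat \<times> nat list \<Rightarrow> rat bdps" where
  "gen_elem \<equiv> \<lambda>(n, \<alpha>). e_op n \<alpha>"

lemma gen_elem_in_QSymm: "i \<in> gen_index \<Longrightarrow> gen_elem i \<in> QSymm"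
  by (auto simp: gen_index_def elementary_lyndon_def lyndon_def intro: e_op_in_QSymm)

lemma ring_closure_subset_QSymm: "ring_closure (gen_elem ` gen_index) \<subseteq> QSymm"
proof
  fix x assume "x \<in> ring_closure (gen_elem ` gen_index)"
  then show "x \<in> QSymm"
    by induction (auto intro: QSymm_arith gen_elem_in_QSymm[of "(n, \<alpha>)" for n \<alpha>, simplified])
qed

lemma e_op_in_closure:
  assumes "lyndon a"
  shows "e_op n a \<in> ring_closure (gen_elem ` gen_index)"
proof -
  obtain g \<alpha> where i: "(g, \<alpha>) \<in> gen_index" "a = map ((*) g) \<alpha>"
    using lyndon_eq_scaled[OF assms] by (auto simp: scaled_def)
  then have \<alpha>: "elementary_lyndon \<alpha>" "is_composition \<alpha>" "\<alpha> \<noteq> []" "g \<ge> 1"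
    by (auto simp: gen_index_def elementary_lyndon_def lyndon_def)
  have "e_op n a \<in> ring_closure ((\<lambda>i. e_op i \<alpha>) ` {1..})"
    unfolding i(2) by (rule e_op_scaled[OF \<alpha>(2-4)])
  then show ?thesis
  proof induction
    case (closure_gen x)
    then obtain k where "k \<ge> 1" "x = gen_elem (k, \<alpha>)" by auto
    moreover from this have "(k, \<alpha>) \<in> gen_index" using \<alpha> by (simp add: gen_index_def)
    ultimately show ?case by (auto intro: ring_closure.closure_gen)
  qed (auto intro: ring_closure.intros)
qed

text \<open>Induction along \<open>lenlex\<close>, which is well-founded, unlike the lexicographic
  order alone. As \<open>e_prod ls\<close> has leading coefficient 1, subtracting the basis element
  of \<open>w\<close> leaves an integer combination of compositions that are strictly smaller in
  this order.\<close>

lemma monomial_qsym_in_closure: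
  assumes "is_composition w"
  shows "monomial_qsym w \<in> ring_closure (gen_elem ` gen_index)"
  using assms
proof (induction w rule: wf_induct_rule[OF wf_lenlex[OF wf_less_than]])
  case (1 w)
  obtain ls where ls: "lyndon_factors ls" "concat ls = w"
    using lyndon_factorization_exists[OF 1(2)] by blast
  have lead: "leads (e_prod ls) w 1" using leads_e_prod[OF ls(1)] ls(2) by simp
  have cl: "e_prod ls \<in> ring_closure (gen_elem ` gen_index)"
    unfolding e_prod_def using ls(1)
    by (intro closure_prod e_op_in_closure) (auto simp: lyndon_factors_def)
  define H where "H = e_prod ls + - monomial_qsym w"
  have "H \<in> QSymm"
    unfolding H_def using cl ring_closure_subset_QSymm monomial_qsym_in_QSymm[OF 1(2)]
    by (intro QSymm_arith) auto
  then obtain A c where A: "finite A" "\<forall>\<alpha>\<in>A. is_composition \<alpha>"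
    and H: "H = (\<Sum>\<alpha>\<in>A. of_int (c \<alpha>) * monomial_qsym \<alpha>)"
    by (auto simp: QSymm_def)
  have "of_int (c \<alpha>) * monomial_qsym \<alpha> \<in> ring_closure (gen_elem ` gen_index)" if \<alpha>: "\<alpha> \<in> A" for \<alpha>
  proof (cases "c \<alpha> = 0")
    case False
    define \<mu> where "\<mu> = word_monom [0..<length \<alpha>] \<alpha>"
    have \<mu>: "word_of \<mu> = \<alpha>"
      unfolding \<mu>_def using A \<alpha> by (intro word_monom_word_of) (auto simp: strict_sorted_iff)
    have "coeff_bdps H \<mu> = (\<Sum>\<beta>\<in>A. if \<alpha> = \<beta> then of_int (c \<beta>) else 0)"
      unfolding H coeff_sum coeff_of_int_mult using A \<mu>
      by (intro sum.cong) (auto simp: coeff_monomial_qsym)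
    then have "coeff_bdps H \<mu> \<noteq> 0" using A \<alpha> False by simp
    then have nz: "coeff_bdps (e_prod ls) \<mu> \<noteq> (if \<alpha> = w then 1 else 0)"
      using \<mu> by (auto simp: H_def coeff_minus coeff_monomial_qsym[OF 1(2)])
    have "\<alpha> \<noteq> w" using nz lead \<mu> unfolding leads_def by auto
    moreover from this nz have "length \<alpha> < length w \<or> length \<alpha> = length w \<and> \<alpha> \<le> w"
      using lead \<mu> length_word_of[of \<mu>] unfolding leads_def by metis
    ultimately have "(\<alpha>, w) \<in> lenlex less_than"
      by (auto simp: lenlex_conv lexord_lex less_list_iff_lexord[symmetric])
    then show ?thesis using 1(1) A \<alpha> by (intro closure_mult closure_of_int) auto
  qed (simp add: closure_0)
  then have "H \<in> ring_closure (gen_elem ` gen_index)" unfolding H by (rule closure_sum)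
  then have "e_prod ls - H \<in> ring_closure (gen_elem ` gen_index)" by (rule closure_diff[OF cl])
  then show ?case by (simp add: H_def)
qed

theorem QSymm_eq_closure: "QSymm = ring_closure (gen_elem ` gen_index)"
proof
  show "QSymm \<subseteq> ring_closure (gen_elem ` gen_index)"
    unfolding QSymm_def
    by (auto intro!: closure_sum closure_mult closure_of_int monomial_qsym_in_closure)
qed (rule ring_closure_subset_QSymm)

section \<open>Evaluation of integer polynomials\<close>

definition monom_value :: "('i \<Rightarrow> 'r::comm_ring_1) \<Rightarrow> ('i \<Rightarrow>\<^sub>0 nat) \<Rightarrow> 'r" where
  "monom_value v m = (\<Prod>i\<in>keys m. v i ^ lookup m i)"

lemma monom_value_superset:
  assumes "finite A" "keys m \<subseteq> A"
  shows "monom_value v m = (\<Prod>i\<in>A. v i ^ lookup m i)"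
  unfolding monom_value_def using assms
  by (intro prod.mono_neutral_left) (auto simp: in_keys_iff)

lemma monom_value_add: "monom_value v (m + n) = monom_value v m * monom_value v n"
proof -
  let ?A = "keys m \<union> keys n"
  have "keys (m + n) \<subseteq> ?A" by (rule Poly_Mapping.keys_add)
  then show ?thesis
    by (simp add: monom_value_superset[of ?A] lookup_add power_add prod.distrib)
qed

lemma eval_mpoly_superset:
  assumes "finite A" "keys p \<subseteq> A"
  shows "eval_mpoly v p = (\<Sum>m\<in>A. of_int (lookup p m) * monom_value v m)"
  unfolding eval_mpoly_def monom_value_def using assms
  by (intro sum.mono_neutral_left) (auto simp: in_keys_iff)

lemma eval_mpoly_add: "eval_mpoly v (p + q) = eval_mpoly v p + eval_mpoly v q"
proof -
  let ?A = "keys p \<union> keys q"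
  have "keys (p + q) \<subseteq> ?A" by (rule Poly_Mapping.keys_add)
  then show ?thesis
    by (simp add: eval_mpoly_superset[of ?A] lookup_add distrib_right sum.distrib)
qed

lemma eval_mpoly_single: "eval_mpoly v (Poly_Mapping.single m c) = of_int c * monom_value v m"
  by (simp add: eval_mpoly_superset[of "{m}"])

lemma eval_mpoly_sum: "eval_mpoly v (\<Sum>i\<in>A. F i) = (\<Sum>i\<in>A. eval_mpoly v (F i))"
  by (induction A rule: infinite_finite_induct) (auto simp: eval_mpoly_add, simp_all add: eval_mpoly_def)

lemma poly_mapping_sum_single: "p = (\<Sum>m\<in>keys p. Poly_Mapping.single m (lookup p m))"
  for p :: "'a \<Rightarrow>\<^sub>0 'b::comm_monoid_add"
  by (rule poly_mapping_eqI) (auto simp: lookup_sum lookup_single when_def in_keys_iff)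

lemma eval_mpoly_mult: "eval_mpoly v (p * q) = eval_mpoly v p * eval_mpoly v q"
proof -
  have "p * q = (\<Sum>m\<in>keys p. \<Sum>n\<in>keys q.
      Poly_Mapping.single m (lookup p m) * Poly_Mapping.single n (lookup q n))"
    by (subst (1) poly_mapping_sum_single[of p], subst (1) poly_mapping_sum_single[of q])
      (simp add: sum_product)
  then have "eval_mpoly v (p * q) = (\<Sum>m\<in>keys p. \<Sum>n\<in>keys q.
      of_int (lookup p m) * monom_value v m * (of_int (lookup q n) * monom_value v n))"
    by (simp add: eval_mpoly_sum mult_single eval_mpoly_single monom_value_add mult_ac)
  then show ?thesis by (simp add: eval_mpoly_superset[OF finite_keys order_refl] sum_product)
qed

lemma polys_over_add: "p \<in> polys_over I \<Longrightarrow> q \<in> polys_over I \<Longrightarrow> p + q \<in> polys_over I"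
  using Poly_Mapping.keys_add[of p q] by (auto simp: polys_over_def)

lemma polys_over_mult:
  assumes "p \<in> polys_over I" "q \<in> polys_over I"
  shows "p * q \<in> polys_over I"
proof -
  have "keys m \<subseteq> I" if m: "m \<in> keys (p * q)" for m
  proof -
    obtain a b where "m = a + b" "a \<in> keys p" "b \<in> keys q"
      using m Poly_Mapping.keys_mult[of p q] by blast
    then show ?thesis using assms Poly_Mapping.keys_add[of a b] unfolding polys_over_def by blast
  qed
  then show ?thesis by (simp add: polys_over_def)
qed

lemma int_adjoin_eq_closure: "int_adjoin I v = ring_closure (v ` I)"
proof (intro equalityI subsetI)
  fix x assume "x \<in> int_adjoin I v"
  then obtain p where p: "p \<in> polys_over I" "x = eval_mpoly v p" by (auto simp: int_adjoin_def)
  have pow: "v i ^ k \<in> ring_closure (v ` I)" if "i \<in> I" for i k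
    using that by (induction k) (auto intro: closure_1 closure_mult closure_gen)
  have "monom_value v m \<in> ring_closure (v ` I)" if "m \<in> keys p" for m
    unfolding monom_value_def using p that by (intro closure_prod pow) (auto simp: polys_over_def)
  then show "x \<in> ring_closure (v ` I)"
    unfolding p(2) eval_mpoly_superset[OF finite_keys order_refl]
    by (intro closure_sum closure_mult closure_of_int)
next
  fix x assume "x \<in> ring_closure (v ` I)"
  then have "\<exists>p\<in>polys_over I. eval_mpoly v p = x"
  proof induction
    case (closure_gen x)
    then obtain i where "i \<in> I" "x = v i" by blast
    then show ?case
      by (intro bexI[of _ "Poly_Mapping.single (Poly_Mapping.single i 1) 1"])
        (auto simp: eval_mpoly_single monom_value_def polys_over_def)
  next
    case (closure_of_int z)
    show ?case
      by (intro bexI[of _ "Poly_Mapping.single 0 z"])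
        (auto simp: eval_mpoly_single monom_value_def polys_over_def)
  next
    case (closure_add x y)
    then show ?case by (metis eval_mpoly_add polys_over_add)
  next
    case (closure_mult x y)
    then show ?case by (metis eval_mpoly_mult polys_over_mult)
  qed
  then show "x \<in> int_adjoin I v" by (auto simp: int_adjoin_def)
qed

section \<open>Algebraic independence\<close>

definition lyndon_mset :: "nat list multiset \<Rightarrow> bool" where
  "lyndon_mset L \<longleftrightarrow> (\<forall>a\<in>#L. lyndon a)"

definition lyndon_monom :: "nat list multiset \<Rightarrow> rat bdps" where
  "lyndon_monom L = prod_mset (image_mset monomial_qsym L)"

definition lyndon_word :: "nat list multiset \<Rightarrow> nat list" where
  "lyndon_word L = concat (rev (sorted_list_of_multiset L))"

lemma lyndon_monom_add: "lyndon_monom (L + L') = lyndon_monom L * lyndon_monom L'"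
  by (simp add: lyndon_monom_def)

lemma lyndon_factors_sorted_list:
  "lyndon_mset L \<Longrightarrow> lyndon_factors (rev (sorted_list_of_multiset L))"
  by (simp add: lyndon_factors_def lyndon_mset_def sorted_wrt_rev)

lemma inj_on_lyndon_word: "inj_on lyndon_word (Collect lyndon_mset)"
proof (rule inj_onI)
  fix L L' assume LL: "L \<in> Collect lyndon_mset" "L' \<in> Collect lyndon_mset" "lyndon_word L = lyndon_word L'"
  then have "rev (sorted_list_of_multiset L) = rev (sorted_list_of_multiset L')"
    by (intro lyndon_factorization_unique lyndon_factors_sorted_list)
      (auto simp: lyndon_word_def)
  then show "L = L'" by (metis mset_sorted_list_of_multiset rev_rev_ident)
qed

lemma leads_lyndon_monom:
  assumes "lyndon_mset L"
  shows "\<exists>c. c \<noteq> 0 \<and> leads (lyndon_monom L) (lyndon_word L) c"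
proof -
  let ?ls = "rev (sorted_list_of_multiset L)"
  have "prod_list (map monomial_qsym ?ls) = prod_mset (mset (map monomial_qsym ?ls) :: rat bdps multiset)"
    by (rule prod_mset_prod_list[symmetric])
  also have "\<dots> = lyndon_monom L" by (simp add: lyndon_monom_def)
  finally show ?thesis
    using leads_prod_list[OF lyndon_factors_sorted_list[OF assms]] by (simp add: lyndon_word_def)
qed

text \<open>Among the terms with nonzero coefficient, the longest and then lexicographically largest
  leading word belongs to one multiset only, by uniqueness of the Lyndon factorization. At a
  monomial with that word every other term vanishes.\<close>

lemma lyndon_monom_independent:
  assumes "finite A" "\<forall>L\<in>A. lyndon_mset L"
    and "(\<Sum>L\<in>A. const_bdps (c L) * lyndon_monom L) = 0" "L \<in> A"
  shows "c L = 0"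
proof (rule ccontr)
  assume nz: "c L \<noteq> 0"
  define B where "B = {L\<in>A. c L \<noteq> 0}"
  have B: "finite B" "L \<in> B" using assms nz by (auto simp: B_def)
  define n where "n = Max (length ` lyndon_word ` B)"
  define C where "C = {w \<in> lyndon_word ` B. length w = n}"
  have "n \<in> length ` lyndon_word ` B" unfolding n_def using B by (intro Max_in) auto
  then have C: "finite C" "C \<noteq> {}" using B by (auto simp: C_def)
  then have "Max C \<in> C" by (rule Max_in)
  then obtain K where K: "K \<in> B" "length (lyndon_word K) = n" "lyndon_word K = Max C"
    by (auto simp: C_def)
  define w where "w = lyndon_word K"
  define \<mu> where "\<mu> = word_monom [0..<length w] w"
  have lynK: "lyndon_mset K" using K assms by (auto simp: B_def)
  have comp: "is_composition w"
    unfolding w_def lyndon_word_def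
    by (rule is_composition_concat_factors[OF lyndon_factors_sorted_list[OF lynK]])
  have \<mu>: "word_of \<mu> = w"
    unfolding \<mu>_def using comp by (intro word_monom_word_of) (auto simp: strict_sorted_iff)
  have zero: "coeff_bdps (lyndon_monom J) \<mu> = 0" if J: "J \<in> B" "J \<noteq> K" for J
  proof (rule ccontr)
    assume nz: "coeff_bdps (lyndon_monom J) \<mu> \<noteq> 0"
    have lynJ: "lyndon_mset J" using J assms by (auto simp: B_def)
    obtain c' where "leads (lyndon_monom J) (lyndon_word J) c'" using leads_lyndon_monom[OF lynJ] by blast
    then have "card (keys \<mu>) < length (lyndon_word J) \<or>
        card (keys \<mu>) = length (lyndon_word J) \<and> word_of \<mu> \<le> lyndon_word J"
      using nz unfolding leads_def by blast
    then have "length w < length (lyndon_word J) \<or>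
        length w = length (lyndon_word J) \<and> w \<le> lyndon_word J"
      using \<mu> length_word_of[of \<mu>] by simp
    moreover have "length (lyndon_word J) \<le> n" unfolding n_def using B J by (intro Max_ge) auto
    ultimately have eq: "length (lyndon_word J) = n" "w \<le> lyndon_word J"
      using K(2) by (auto simp: w_def)
    then have "lyndon_word J \<le> Max C" using C J by (intro Max_ge) (auto simp: C_def)
    then have "lyndon_word J = lyndon_word K" using eq K(3) by (simp add: w_def)
    then show False using inj_on_lyndon_word lynJ lynK J by (auto dest: inj_onD)
  qed
  obtain c' where c': "c' \<noteq> 0" "leads (lyndon_monom K) w c'"
    using leads_lyndon_monom[OF lynK] by (auto simp: w_def)
  have "0 = coeff_bdps (\<Sum>L\<in>A. const_bdps (c L) * lyndon_monom L) \<mu>"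
    by (simp add: assms(3) zero_bdps.rep_eq)
  also have "\<dots> = (\<Sum>L\<in>A. c L * coeff_bdps (lyndon_monom L) \<mu>)"
    by (simp add: coeff_sum)
  also have "\<dots> = (\<Sum>L\<in>{K}. c L * coeff_bdps (lyndon_monom L) \<mu>)"
    using assms(1) K(1) zero by (intro sum.mono_neutral_right) (auto simp: B_def)
  also have "\<dots> = c K * c'" using c'(2) \<mu> unfolding leads_def by simp
  finally show False using c'(1) K(1) by (simp add: B_def)
qed

text \<open>The span of the products of at least \<open>d\<close> Lyndon monomial quasisymmetric functions.\<close>

inductive_set deep :: "nat \<Rightarrow> rat bdps set" for d where
  deep_0: "0 \<in> deep d"
| deep_step: "x \<in> deep d \<Longrightarrow> lyndon_mset L \<Longrightarrow> d \<le> size L \<Longrightarrow>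
    const_bdps c * lyndon_monom L + x \<in> deep d"

lemma deep_lyndon_monom: "lyndon_mset L \<Longrightarrow> d \<le> size L \<Longrightarrow> const_bdps c * lyndon_monom L \<in> deep d"
  using deep_step[OF deep_0] by fastforce

lemma deep_add: "x \<in> deep d \<Longrightarrow> y \<in> deep d \<Longrightarrow> x + y \<in> deep d"
  by (induction rule: deep.induct) (auto simp: add.assoc intro: deep_step)

lemma deep_const_mult:
  assumes "x \<in> deep d"
  shows "const_bdps a * x \<in> deep d"
  using assms
proof induction
  case (deep_step x L c)
  have "const_bdps a * (const_bdps c * lyndon_monom L + x)
      = const_bdps (a * c) * lyndon_monom L + const_bdps a * x"
    by (simp add: const_bdps_mult algebra_simps)
  then show ?case using deep_step by (simp add: deep.deep_step)
qed (simp add: deep_0)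

lemma deep_sum: "(\<And>i. i \<in> A \<Longrightarrow> F i \<in> deep d) \<Longrightarrow> sum F A \<in> deep d"
  by (induction A rule: infinite_finite_induct) (auto intro: deep_0 deep_add)

lemma deep_mono: "x \<in> deep d \<Longrightarrow> e \<le> d \<Longrightarrow> x \<in> deep e"
  by (induction rule: deep.induct) (auto intro: deep_0 deep_step)

lemma deep_mult:
  assumes "x \<in> deep d" "y \<in> deep e"
  shows "x * y \<in> deep (d + e)"
  using assms(1)
proof induction
  case (deep_step x L c)
  have "const_bdps c * lyndon_monom L * y \<in> deep (d + e)"
    using assms(2)
  proof induction
    case (deep_step y L' c')
    have "const_bdps c * lyndon_monom L * (const_bdps c' * lyndon_monom L' + y)
        = const_bdps (c * c') * lyndon_monom (L + L') + const_bdps c * lyndon_monom L * y"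
      by (simp add: const_bdps_mult lyndon_monom_add algebra_simps)
    moreover have "lyndon_mset (L + L')" "d + e \<le> size (L + L')"
      using deep_step \<open>lyndon_mset L\<close> \<open>d \<le> size L\<close> by (auto simp: lyndon_mset_def)
    ultimately show ?case using deep_step by (simp only: deep.deep_step)
  qed (simp add: deep_0)
  then show ?case using deep_step by (simp add: distrib_right deep_add)
qed (simp add: deep_0)

text \<open>Elements of \<open>deep d\<close> are built with possible repetitions of a multiset;
  collecting these makes linear independence applicable.\<close>

lemma deep_expansion:
  assumes "x \<in> deep d"
  shows "\<exists>A c. finite A \<and> (\<forall>L\<in>A. lyndon_mset L \<and> d \<le> size L) \<and>
    x = (\<Sum>L\<in>A. const_bdps (c L) * lyndon_monom L)"
  using assms
proof induction
  case deep_0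
  show ?case by (rule exI[of _ "{}"]) simp
next
  case (deep_step x L a)
  then obtain A c where A: "finite A" "\<forall>L\<in>A. lyndon_mset L \<and> d \<le> size L"
    and x: "x = (\<Sum>L\<in>A. const_bdps (c L) * lyndon_monom L)" by blast
  define b where "b = (if L \<in> A then c L else 0)"
  have "x = const_bdps b * lyndon_monom L + (\<Sum>L\<in>A - {L}. const_bdps (c L) * lyndon_monom L)"
    using A(1) by (cases "L \<in> A") (auto simp: x b_def sum.remove)
  then have "const_bdps a * lyndon_monom L + x
      = const_bdps (a + b) * lyndon_monom L + (\<Sum>L\<in>A - {L}. const_bdps (c L) * lyndon_monom L)"
    by (simp add: const_bdps_add algebra_simps)
  also have "(\<Sum>L\<in>A - {L}. const_bdps (c L) * lyndon_monom L)
      = (\<Sum>K\<in>A - {L}. const_bdps ((c(L := a + b)) K) * lyndon_monom K)"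
    by (intro sum.cong) auto
  also have "const_bdps (a + b) * lyndon_monom L + \<dots>
      = (\<Sum>K\<in>insert L A. const_bdps ((c(L := a + b)) K) * lyndon_monom K)"
    using A(1) by (simp add: sum.insert_remove)
  finally show ?case using A deep_step
    by (intro exI[of _ "insert L A"] exI[of _ "c(L := a + b)"]) auto
qed

text \<open>Here leading means having the fewest Lyndon factors, the remainder being spanned by
  products with more of them. This is a different notion from \<open>leads\<close>, which compares
  words.\<close>

definition leading_product :: "rat bdps \<Rightarrow> nat list multiset \<Rightarrow> bool" where
  "leading_product x L \<longleftrightarrow> lyndon_mset L \<and>
     (\<exists>c. c \<noteq> 0 \<and> x - const_bdps c * lyndon_monom L \<in> deep (Suc (size L)))"

lemma leading_product_deep:
  assumes "leading_product x L"
  shows "x \<in> deep (size L)"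
proof -
  obtain c where c: "x - const_bdps c * lyndon_monom L \<in> deep (Suc (size L))" and L: "lyndon_mset L"
    using assms by (auto simp: leading_product_def)
  have "(x - const_bdps c * lyndon_monom L) + const_bdps c * lyndon_monom L \<in> deep (size L)"
    using deep_mono[OF c] L by (intro deep_add deep_lyndon_monom) auto
  then show ?thesis by simp
qed

lemma leading_product_1: "leading_product 1 {#}"
  unfolding leading_product_def
  by (auto simp: lyndon_mset_def lyndon_monom_def deep_0 intro!: exI[of _ 1])

lemma leading_product_mult:
  assumes "leading_product x L" "leading_product y K"
  shows "leading_product (x * y) (L + K)"
proof -
  obtain a where a: "a \<noteq> 0" "x - const_bdps a * lyndon_monom L \<in> deep (Suc (size L))"
    and L: "lyndon_mset L" using assms by (auto simp: leading_product_def)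
  obtain b where b: "b \<noteq> 0" "y - const_bdps b * lyndon_monom K \<in> deep (Suc (size K))"
    and K: "lyndon_mset K" using assms by (auto simp: leading_product_def)
  have "x * y - const_bdps (a * b) * lyndon_monom (L + K)
      = (x - const_bdps a * lyndon_monom L) * y
        + (const_bdps a * lyndon_monom L) * (y - const_bdps b * lyndon_monom K)"
    by (simp add: const_bdps_mult lyndon_monom_add algebra_simps)
  moreover have "(x - const_bdps a * lyndon_monom L) * y \<in> deep (Suc (size L) + size K)"
    by (rule deep_mult[OF a(2) leading_product_deep[OF assms(2)]])
  moreover have "(const_bdps a * lyndon_monom L) * (y - const_bdps b * lyndon_monom K)
      \<in> deep (size L + Suc (size K))"
    by (rule deep_mult[OF deep_lyndon_monom[OF L order_refl] b(2)])
  ultimately have "x * y - const_bdps (a * b) * lyndon_monom (L + K) \<in> deep (Suc (size (L + K)))"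
    by (simp add: deep_add)
  then show ?thesis using a b L K unfolding leading_product_def
    by (intro conjI exI[of _ "a * b"]) (auto simp: lyndon_mset_def)
qed

lemma leading_product_power:
  "leading_product x {#a#} \<Longrightarrow> leading_product (x ^ k) (replicate_mset k a)"
proof (induction k)
  case (Suc k)
  then have "leading_product (x * x ^ k) ({#a#} + replicate_mset k a)"
    by (intro leading_product_mult) auto
  then show ?case by simp
qed (simp add: leading_product_1)

lemma leading_product_prod:
  "(\<And>i. i \<in> A \<Longrightarrow> leading_product (f i) (L i)) \<Longrightarrow> leading_product (prod f A) (sum L A)"
  by (induction A rule: infinite_finite_induct) (auto simp: leading_product_1 leading_product_mult)

text \<open>In Newton's recursion every term with \<open>k < n\<close> is a product of a Lyndon
  composition and an element of \<open>deep 1\<close>. The term \<open>k = n\<close> carries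
  \<open>e_op 0 \<alpha>\<close>, which is 1, and leaves the multiple of \<open>\<alpha>\<close> by
  \<open>Suc n\<close> with sign \<open>(-1) ^ n\<close>; division by \<open>Suc n\<close> gives the
  coefficient.\<close>

lemma leading_product_e_op:
  assumes "lyndon \<alpha>"
  shows "leading_product (e_op (Suc n) \<alpha>) {#map ((*) (Suc n)) \<alpha>#}"
proof (induction n rule: less_induct)
  case (less n)
  have M: "monomial_qsym (map ((*) (Suc k)) \<alpha>) \<in> deep 1" for k
    using deep_lyndon_monom[of "{#map ((*) (Suc k)) \<alpha>#}" 1 1] assms
    by (simp add: lyndon_mset_def lyndon_monom_def lyndon_map_mult_iff)
  define D where "D = (\<Sum>k<n. const_bdps ((-1) ^ k) * monomial_qsym (map ((*) (Suc k)) \<alpha>) * e_op (n - k) \<alpha>)"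
  have "D \<in> deep 2"
    unfolding D_def
  proof (rule deep_sum)
    fix k assume "k \<in> {..<n}"
    then have k: "k < n" by simp
    define l where "l = n - Suc k"
    have l: "n - k = Suc l" "l < n" using k by (auto simp: l_def)
    have "e_op (n - k) \<alpha> \<in> deep 1"
      using leading_product_deep[OF less[OF l(2)]] by (simp add: l(1))
    then have "const_bdps ((-1) ^ k) * monomial_qsym (map ((*) (Suc k)) \<alpha>) * e_op (n - k) \<alpha> \<in> deep (1 + 1)"
      by (intro deep_mult deep_const_mult M)
    then show "const_bdps ((-1) ^ k) * monomial_qsym (map ((*) (Suc k)) \<alpha>) * e_op (n - k) \<alpha> \<in> deep 2"
      by (simp add: numeral_2_eq_2)
  qed
  have "of_nat (Suc n) * e_op (Suc n) \<alpha>
      = (\<Sum>k\<le>n. const_bdps ((-1) ^ k) * monomial_qsym (map ((*) (Suc k)) \<alpha>) * e_op (n - k) \<alpha>)"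
    unfolding e_op_def lambda_op_Suc by (simp add: psi_monomial_qsym)
  also have "\<dots> = D + const_bdps ((-1) ^ n) * monomial_qsym (map ((*) (Suc n)) \<alpha>)"
    by (simp add: D_def lessThan_Suc_atMost[symmetric])
  finally have "const_bdps (1 / of_nat (Suc n)) * (of_nat (Suc n) * e_op (Suc n) \<alpha>)
      = const_bdps (1 / of_nat (Suc n)) * D
        + const_bdps (1 / of_nat (Suc n)) * const_bdps ((-1) ^ n) * monomial_qsym (map ((*) (Suc n)) \<alpha>)"
    by (simp only: distrib_left mult.assoc)
  moreover have "const_bdps (1 / of_nat (Suc n)) * (of_nat (Suc n) * e_op (Suc n) \<alpha>) = e_op (Suc n) \<alpha>"
    by (rule bdps_eqI) (simp del: of_nat_Suc)
  ultimately have e: "e_op (Suc n) \<alpha> = const_bdps (1 / of_nat (Suc n)) * D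
        + const_bdps (1 / of_nat (Suc n)) * const_bdps ((-1) ^ n) * monomial_qsym (map ((*) (Suc n)) \<alpha>)"
    by (simp only:)
  have "lyndon_monom {#map ((*) (Suc n)) \<alpha>#} = monomial_qsym (map ((*) (Suc n)) \<alpha>)"
    by (simp add: lyndon_monom_def)
  then have "e_op (Suc n) \<alpha>
      - const_bdps (1 / of_nat (Suc n) * (-1) ^ n) * lyndon_monom {#map ((*) (Suc n)) \<alpha>#}
      = const_bdps (1 / of_nat (Suc n)) * D"
    by (simp only: e const_bdps_mult add_diff_cancel_right')
  also have "\<dots> \<in> deep 2" using \<open>D \<in> deep 2\<close> by (rule deep_const_mult)
  finally show ?case
    using assms unfolding leading_product_def
    by (intro conjI exI[of _ "1 / of_nat (Suc n) * (-1) ^ n"])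
      (auto simp: lyndon_mset_def lyndon_map_mult_iff numeral_2_eq_2 simp del: of_nat_Suc)
qed

definition exponent_mset :: "(nat \<times> nat list \<Rightarrow>\<^sub>0 nat) \<Rightarrow> nat list multiset" where
  "exponent_mset m = (\<Sum>i\<in>keys m. replicate_mset (lookup m i) (scaled i))"

lemma leading_product_gens:
  assumes "keys m \<subseteq> gen_index"
  shows "leading_product (monom_value gen_elem m) (exponent_mset m)"
  unfolding monom_value_def exponent_mset_def
proof (intro leading_product_prod leading_product_power)
  fix i assume "i \<in> keys m"
  then obtain n \<alpha> where i: "i = (Suc n, \<alpha>)" "lyndon \<alpha>"
    using assms by (cases i; cases "fst i") (auto simp: gen_index_def elementary_lyndon_def)
  then show "leading_product (gen_elem i) {#scaled i#}"
    using leading_product_e_op[of \<alpha> n] by (simp add: scaled_def)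
qed

lemma inj_on_exponent_mset: "inj_on exponent_mset {m. keys m \<subseteq> gen_index}"
proof (rule inj_onI)
  have count: "count (exponent_mset m) (scaled j) = lookup m j"
    if "keys m \<subseteq> gen_index" "j \<in> gen_index" for m j
  proof -
    have "count (exponent_mset m) (scaled j) = (\<Sum>i\<in>keys m. if i = j then lookup m i else 0)"
      unfolding exponent_mset_def count_sum using that inj_on_scaled
      by (intro sum.cong) (auto dest: inj_onD)
    then show ?thesis by (simp add: in_keys_iff)
  qed
  fix m n assume mn: "m \<in> {m. keys m \<subseteq> gen_index}" "n \<in> {m. keys m \<subseteq> gen_index}"
    "exponent_mset m = exponent_mset n"
  show "m = n"
  proof (rule poly_mapping_eqI)
    fix j
    show "lookup m j = lookup n j"
    proof (cases "j \<in> gen_index")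
      case True
      then show ?thesis using count[of m j] count[of n j] mn by simp
    next
      case False
      then have "j \<notin> keys m" "j \<notin> keys n" using mn by auto
      then show ?thesis by (simp add: in_keys_iff)
    qed
  qed
qed

text \<open>Modulo products with more factors, the monomials of \<open>p\<close> with the fewest
  Lyndon factors reduce to nonzero multiples of pairwise different products. These cannot be
  cancelled by the remainder, whose products have more factors.\<close>

theorem gen_elem_independent: "algebraically_independent gen_index gen_elem"
  unfolding algebraically_independent_def
proof (intro ballI impI)
  fix p :: "(nat \<times> nat list) int_mpoly"
  assume p: "p \<in> polys_over gen_index" "eval_mpoly gen_elem p = 0"
  show "p = 0"
  proof (rule ccontr)
    assume "p \<noteq> 0"
    define K where "K = keys p"
    have K: "finite K" "K \<noteq> {}" "\<forall>m\<in>K. keys m \<subseteq> gen_index"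
      using p \<open>p \<noteq> 0\<close> by (auto simp: K_def polys_over_def)
    define E where "E m = monom_value gen_elem m" for m
    have lead: "leading_product (E m) (exponent_mset m)" if "m \<in> K" for m
      unfolding E_def using K that by (intro leading_product_gens) auto
    then have "\<forall>m\<in>K. \<exists>c. c \<noteq> 0 \<and>
        E m - const_bdps c * lyndon_monom (exponent_mset m) \<in> deep (Suc (size (exponent_mset m)))"
      by (auto simp: leading_product_def)
    then obtain c where c: "\<And>m. m \<in> K \<Longrightarrow> c m \<noteq> 0"
      "\<And>m. m \<in> K \<Longrightarrow> E m - const_bdps (c m) * lyndon_monom (exponent_mset m) \<in> deep (Suc (size (exponent_mset m)))"
      by metis
    \<comment> \<open>Only the monomials of \<open>p\<close> attaining this minimum survive modulo
      \<open>deep (Suc d)\<close>.\<close>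
    define d where "d = Min ((\<lambda>m. size (exponent_mset m)) ` K)"
    have dle: "d \<le> size (exponent_mset m)" if "m \<in> K" for m
      unfolding d_def using K that by (intro Min_le) auto
    have "d \<in> (\<lambda>m. size (exponent_mset m)) ` K" unfolding d_def using K by (intro Min_in) auto
    then obtain m0 where m0: "m0 \<in> K" "size (exponent_mset m0) = d" by auto
    define K0 where "K0 = {m\<in>K. size (exponent_mset m) = d}"
    define q where "q m = of_int (lookup p m) * c m" for m
    let ?T = "\<lambda>m. if m \<in> K0 then const_bdps (q m) * lyndon_monom (exponent_mset m) else 0"
    have "of_int (lookup p m) * E m - ?T m \<in> deep (Suc d)" if m: "m \<in> K" for m
    proof (cases "m \<in> K0")
      case True
      have "const_bdps (of_int (lookup p m)) * (E m - const_bdps (c m) * lyndon_monom (exponent_mset m))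
          \<in> deep (Suc d)"
        using c(2)[OF m] True by (intro deep_const_mult) (simp add: K0_def)
      then show ?thesis using True
        by (simp add: q_def const_bdps_mult right_diff_distrib mult.assoc of_int_bdps)
    next
      case False
      then have "Suc d \<le> size (exponent_mset m)" using dle[OF m] m by (auto simp: K0_def)
      then have "E m \<in> deep (Suc d)" using leading_product_deep[OF lead[OF m]] deep_mono by blast
      then show ?thesis using False by (simp add: of_int_bdps deep_const_mult)
    qed
    then have "(\<Sum>m\<in>K. of_int (lookup p m) * E m - ?T m) \<in> deep (Suc d)" by (rule deep_sum)
    moreover have "(\<Sum>m\<in>K. of_int (lookup p m) * E m) = 0"
      using p(2) unfolding eval_mpoly_superset[OF finite_keys order_refl] K_def E_def .
    ultimately have "- (\<Sum>m\<in>K. ?T m) \<in> deep (Suc d)" by (simp add: sum_subtractf)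
    also have "(\<Sum>m\<in>K. ?T m) = (\<Sum>m\<in>K0. const_bdps (q m) * lyndon_monom (exponent_mset m))"
    proof -
      have "K0 = K \<inter> {m. m \<in> K0}" by (auto simp: K0_def)
      then show ?thesis using K(1) by (simp add: sum.inter_restrict[symmetric] sum.If_cases)
    qed
    finally have low: "- (\<Sum>m\<in>K0. const_bdps (q m) * lyndon_monom (exponent_mset m)) \<in> deep (Suc d)" .
    obtain A b where A: "finite A" "\<forall>L\<in>A. lyndon_mset L \<and> Suc d \<le> size L"
      and sumA: "- (\<Sum>m\<in>K0. const_bdps (q m) * lyndon_monom (exponent_mset m))
        = (\<Sum>L\<in>A. const_bdps (b L) * lyndon_monom L)"
      using deep_expansion[OF low] by (elim exE conjE)
    have inj: "inj_on exponent_mset K0"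
      by (rule inj_on_subset[OF inj_on_exponent_mset]) (use K in \<open>auto simp: K0_def\<close>)
    \<comment> \<open>The two families consist of multisets of size \<open>d\<close> and of size at
      least \<open>Suc d\<close>, so they are disjoint, and one coefficient function makes the
      relation a vanishing combination of distinct products.\<close>
    define g where "g L = (if L \<in> A then b L else q (inv_into K0 exponent_mset L))" for L
    have disj: "exponent_mset m \<notin> A" if "m \<in> K0" for m using A that by (auto simp: K0_def)
    have gq: "g (exponent_mset m) = q m" if "m \<in> K0" for m
      using disj[OF that] inj that by (simp add: g_def inv_into_f_f)
    have "(\<Sum>L\<in>exponent_mset ` K0 \<union> A. const_bdps (g L) * lyndon_monom L)
        = (\<Sum>L\<in>exponent_mset ` K0. const_bdps (g L) * lyndon_monom L)
          + (\<Sum>L\<in>A. const_bdps (g L) * lyndon_monom L)"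
      using K(1) A(1) disj by (intro sum.union_disjoint) (auto simp: K0_def)
    also have "(\<Sum>L\<in>exponent_mset ` K0. const_bdps (g L) * lyndon_monom L)
        = (\<Sum>m\<in>K0. const_bdps (q m) * lyndon_monom (exponent_mset m))"
      by (simp add: sum.reindex[OF inj] gq)
    also have "(\<Sum>L\<in>A. const_bdps (g L) * lyndon_monom L) = (\<Sum>L\<in>A. const_bdps (b L) * lyndon_monom L)"
      by (simp add: g_def)
    finally have zero: "(\<Sum>L\<in>exponent_mset ` K0 \<union> A. const_bdps (g L) * lyndon_monom L) = 0"
      by (simp add: sumA[symmetric])
    have "g (exponent_mset m0) = 0"
    proof (rule lyndon_monom_independent[OF _ _ zero])
      show "finite (exponent_mset ` K0 \<union> A)" using K(1) A(1) by (simp add: K0_def)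
      show "\<forall>L\<in>exponent_mset ` K0 \<union> A. lyndon_mset L"
        using A lead by (auto simp: K0_def leading_product_def)
      show "exponent_mset m0 \<in> exponent_mset ` K0 \<union> A" using m0 by (auto simp: K0_def)
    qed
    moreover have "m0 \<in> K0" using m0 by (simp add: K0_def)
    ultimately have "q m0 = 0" using gq by simp
    then show False using c(1)[OF m0(1)] m0(1) by (simp add: q_def K_def in_keys_iff)
  qed
qed

theorem theorem2p1:
  shows "QSymm = int_adjoin gen_index (\<lambda>(n, \<alpha>). e_op n \<alpha>) \<and>
         algebraically_independent gen_index (\<lambda>(n, \<alpha>). e_op n \<alpha>)"
  using QSymm_eq_closure gen_elem_independent by (simp add: int_adjoin_eq_closure)

end
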